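(* Let $A$ and $B$ be locally finite positively graded elementary algebras over a field $\Bbbk$, with $A_0=\bigoplus_{i=1}^r\Bbbk e_i$ and $B_0=\bigoplus_{j=1}^s\Bbbk f_j$, and assume that $A$ satisfies the standing hypotheses. Let $F:\operatorname{GrMod}A\to\operatorname{GrMod}B$ be a graded Morita equivalence. Then $r=s$; let $\sigma$ be a permutation of $\{1,\ldots,r\}$ and $m_1,\ldots,m_r$ integers such that $F(Ae_i)\cong Bf_{\sigma(i)}\langle m_i\rangle$ for all $i$ (such $\sigma$ and $m_i$ exist). Let $\Pi$ be the permutation matrix of $\sigma$ (with $\Pi_{\sigma(i),i}=1$ and all other entries $0$) and $X(x)=\operatorname{diag}(x^{m_1},\ldots,x^{m_r})$. Then $$C_B(x)=\Pi\,X(x)\,C_A(x)\,X(x)^{-1}\,\Pi^T.$$ Hence $B$ also satisfies the standing hypotheses, $A$ and $B$ have the same signed Euler--Smith profile at $1$, and $\mathcal G_B^+\cong\mathcal G_A^+$ and $\mathcal G_B^-\cong\mathcal G_A^-$ as $\mathbb Q[[t]]$-modules.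
   Context: All algebras are associative and unital; $\Bbbk$ is an arbitrary field. A locally finite positively graded elementary algebra is a graded algebra $A=\bigoplus_{n\ge0}A_n$ with $\dim_\Bbbk A_n<\infty$ for all $n$ and $A_0=\bigoplus_{i=1}^r\Bbbk e_i$ for primitive orthogonal idempotents $e_1,\ldots,e_r$. Put $J=A_{>0}$. The vertex simples are the graded left modules $S_j=Ae_j/Je_j$. Shifts: $M\langle m\rangle_n=M_{n-m}$. A graded module is of graded type $\mathrm{FP}_\infty$ if it has a projective resolution by finitely generated graded projectives in every homological degree. The matrix Hilbert series $C_A(x)\in M_r(\mathbb Z[[x]])$ has entries $C_A(x)_{ij}=\sum_{n\ge0}\dim_\Bbbk(e_iA_ne_j)x^n$. Standing hypotheses on $A$: every $S_j$ is of graded type $\mathrm{FP}_\infty$, and $C_A(x)\in M_r(\mathbb Q(x))$. Put $\mathcal E_A(x)=C_A(x)^{-1}\in GL_r(\mathbb Q(x))$. Put $t=x-1$. There are $U,V\in GL_r(\mathbb Q[[t]])$ and unique integers $a_1\le\cdots\le a_r$ with $U\,\mathcal E_A(1+t)\,V=\operatorname{diag}(t^{a_1},\ldots,t^{a_r})$; $(a_1,\ldots,a_r)$ is the signed Euler--Smith profile at $1$. With $\Lambda_A=\mathcal E_A(1+t)\,\mathbb Q[[t]]^r\subset\mathbb Q((t))^r$, put $\mathcal G_A^+=\mathbb Q[[t]]^r/(\mathbb Q[[t]]^r\cap\Lambda_A)$ and $\mathcal G_A^-=\Lambda_A/(\mathbb Q[[t]]^r\cap\Lambda_A)$. The same notation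 is used for $B$, with idempotents $f_j$. $\operatorname{GrMod}A$ is the category of graded left $A$-modules with degree-preserving morphisms. A graded Morita equivalence is a $\Bbbk$-linear equivalence $F:\operatorname{GrMod}A\to\operatorname{GrMod}B$ together with a natural isomorphism $F\circ\langle1\rangle\cong\langle1\rangle\circ F$. *)

theory Defs
  imports
    "HOL-Computational_Algebra.Computational_Algebra"
    "HOL-Computational_Algebra.Field_as_Ring"
    "HOL-Combinatorics.Permutations"
    "HOL-Algebra.AbelCoset"
    "HOL-Algebra.Module"
    "Jordan_Normal_Form.Gauss_Jordan_Elimination"
begin

section \<open>Categories, functors, equivalences\<close>

record ('o, 'm) cat =
  ob :: "'o set"
  hm :: "'o \<Rightarrow> 'o \<Rightarrow> 'm set"
  idt :: "'o \<Rightarrow> 'm"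
  cmp :: "'o \<Rightarrow> 'o \<Rightarrow> 'o \<Rightarrow> 'm \<Rightarrow> 'm \<Rightarrow> 'm"

text \<open>\<open>cmp C L M N g f\<close> is the composite of \<open>f \<in> hm C L M\<close> followed by \<open>g \<in> hm C M N\<close>.
  Morphisms do not carry their source and target, so these are passed to a functor:
  \<open>fmor F M N f\<close> is the image of \<open>f \<in> hm C M N\<close>.\<close>

record ('o, 'm, 'p, 'n) cfunctor =
  fob :: "'o \<Rightarrow> 'p"
  fmor :: "'o \<Rightarrow> 'o \<Rightarrow> 'm \<Rightarrow> 'n"

definition is_functor ::
  "('o, 'm) cat \<Rightarrow> ('p, 'n) cat \<Rightarrow> ('o, 'm, 'p, 'n) cfunctor \<Rightarrow> bool" where
  "is_functor C D F \<longleftrightarrow>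
     (\<forall>M \<in> ob C. fob F M \<in> ob D) \<and>
     (\<forall>M \<in> ob C. \<forall>N \<in> ob C. \<forall>f \<in> hm C M N. fmor F M N f \<in> hm D (fob F M) (fob F N)) \<and>
     (\<forall>M \<in> ob C. fmor F M M (idt C M) = idt D (fob F M)) \<and>
     (\<forall>L \<in> ob C. \<forall>M \<in> ob C. \<forall>N \<in> ob C. \<forall>f \<in> hm C L M. \<forall>g \<in> hm C M N.
        fmor F L N (cmp C L M N g f) =
          cmp D (fob F L) (fob F M) (fob F N) (fmor F M N g) (fmor F L M f))"

definition id_functor :: "('o, 'm, 'o, 'm) cfunctor" where
  "id_functor = \<lparr>fob = (\<lambda>M. M), fmor = (\<lambda>M N f. f)\<rparr>"

definition comp_functor ::
  "('p, 'n, 'q, 'l) cfunctor \<Rightarrow> ('o, 'm, 'p, 'n) cfunctor \<Rightarrow> ('o, 'm, 'q, 'l) cfunctor" where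
  "comp_functor G F =
     \<lparr>fob = (\<lambda>M. fob G (fob F M)),
      fmor = (\<lambda>M N f. fmor G (fob F M) (fob F N) (fmor F M N f))\<rparr>"

definition is_iso_in :: "('o, 'm) cat \<Rightarrow> 'o \<Rightarrow> 'o \<Rightarrow> 'm \<Rightarrow> bool" where
  "is_iso_in C M N f \<longleftrightarrow> f \<in> hm C M N \<and>
     (\<exists>g \<in> hm C N M. cmp C M N M g f = idt C M \<and> cmp C N M N f g = idt C N)"

definition naturally_isomorphic ::
  "('o, 'm) cat \<Rightarrow> ('p, 'n) cat \<Rightarrow> ('o, 'm, 'p, 'n) cfunctor \<Rightarrow> ('o, 'm, 'p, 'n) cfunctor \<Rightarrow> bool"
where
  "naturally_isomorphic C D F G \<longleftrightarrow>
     (\<exists>\<eta>. (\<forall>M \<in> ob C. is_iso_in D (fob F M) (fob G M) (\<eta> M)) \<and>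
          (\<forall>M \<in> ob C. \<forall>N \<in> ob C. \<forall>f \<in> hm C M N.
             cmp D (fob F M) (fob F N) (fob G N) (\<eta> N) (fmor F M N f) =
             cmp D (fob F M) (fob G M) (fob G N) (fmor G M N f) (\<eta> M)))"

definition is_equivalence ::
  "('o, 'm) cat \<Rightarrow> ('p, 'n) cat \<Rightarrow> ('o, 'm, 'p, 'n) cfunctor \<Rightarrow> bool" where
  "is_equivalence C D F \<longleftrightarrow> is_functor C D F \<and>
     (\<exists>G. is_functor D C G \<and>
          naturally_isomorphic C C (comp_functor G F) id_functor \<and>
          naturally_isomorphic D D (comp_functor F G) id_functor)"


section \<open>Left modules over a not necessarily commutative ring\<close>

text \<open>The scalar ring is a type; modules have explicit carriers. The record
  \<^typ>\<open>('a, 'm) module\<close> is reused, its fields \<open>mult\<close> and \<open>one\<close> playing no role.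
  The sort \<open>{ring, monoid_mult}\<close> is that of unital rings, the zero ring included.\<close>

locale left_module = abelian_group M
  for M :: "('a :: {ring, monoid_mult}, 'm, 'z) module_scheme" (structure) +
  assumes act_closed: "x \<in> carrier M \<Longrightarrow> a \<odot> x \<in> carrier M"
    and act_add_left: "x \<in> carrier M \<Longrightarrow> (a + b) \<odot> x = a \<odot> x \<oplus> b \<odot> x"
    and act_add_right: "x \<in> carrier M \<Longrightarrow> y \<in> carrier M \<Longrightarrow> a \<odot> (x \<oplus> y) = a \<odot> x \<oplus> a \<odot> y"
    and act_assoc: "x \<in> carrier M \<Longrightarrow> (a * b) \<odot> x = a \<odot> (b \<odot> x)"
    and act_one: "x \<in> carrier M \<Longrightarrow> 1 \<odot> x = x"

definition mod_hom ::
  "('a, 'm, 'y) module_scheme \<Rightarrow> ('a, 'n, 'z) module_scheme \<Rightarrow> ('m \<Rightarrow> 'n) set" where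
  "mod_hom M N = {f \<in> carrier M \<rightarrow>\<^sub>E carrier N.
     (\<forall>x \<in> carrier M. \<forall>y \<in> carrier M. f (x \<oplus>\<^bsub>M\<^esub> y) = f x \<oplus>\<^bsub>N\<^esub> f y) \<and>
     (\<forall>a. \<forall>x \<in> carrier M. f (a \<odot>\<^bsub>M\<^esub> x) = a \<odot>\<^bsub>N\<^esub> f x)}"

definition mod_iso ::
  "('a, 'm, 'y) module_scheme \<Rightarrow> ('a, 'n, 'z) module_scheme \<Rightarrow> bool" where
  "mod_iso M N \<longleftrightarrow> (\<exists>f \<in> mod_hom M N. bij_betw f (carrier M) (carrier N))"

definition quotient_module ::
  "('a, 'm, 'z) module_scheme \<Rightarrow> 'm set \<Rightarrow> ('a, 'm set) module" where
  "quotient_module M H =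
     \<lparr>carrier = a_rcosets\<^bsub>M\<^esub> H, mult = undefined, one = undefined,
      zero = H, add = set_add M, smult = (\<lambda>a X. \<Union>x\<in>X. H +>\<^bsub>M\<^esub> (a \<odot>\<^bsub>M\<^esub> x))\<rparr>"

definition finitely_generated :: "('a, 'm, 'z) module_scheme \<Rightarrow> bool" where
  "finitely_generated M \<longleftrightarrow>
     (\<exists>X. finite X \<and> X \<subseteq> carrier M \<and>
          (\<forall>y \<in> carrier M. \<exists>c. y = (\<Oplus>\<^bsub>M\<^esub>x\<in>X. c x \<odot>\<^bsub>M\<^esub> x)))"


section \<open>Graded algebras and graded modules\<close>

record ('k, 'a) graded_algebra =
  scal :: "'k \<Rightarrow> 'a \<Rightarrow> 'a"
  deg :: "nat \<Rightarrow> 'a set"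
  rk :: nat
  idem :: "nat \<Rightarrow> 'a"

text \<open>The vertices, and all matrix indices, are \<open>0, \<dots>, r - 1\<close>.\<close>

definition primitive_idempotent :: "'a :: ring \<Rightarrow> bool" where
  "primitive_idempotent e \<longleftrightarrow> e * e = e \<and> e \<noteq> 0 \<and>
     (\<forall>u v. u * u = u \<and> v * v = v \<and> u * v = 0 \<and> v * u = 0 \<and> e = u + v \<longrightarrow> u = 0 \<or> v = 0)"

text \<open>Finite dimensionality of the components is required separately, because the library
  function \<open>dim\<close> is \<open>0\<close> on infinite-dimensional subspaces. That the sum of the lines
  \<open>k e\<^sub>i\<close> in \<open>span_idem\<close> is direct follows from orthogonality.\<close>

locale elementary_graded_algebra = vector_space "scal A"
  for A :: "('k :: field, 'a :: {ring, monoid_mult}) graded_algebra" +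
  assumes scal_mult_left: "scal A c x * y = scal A c (x * y)"
    and scal_mult_right: "x * scal A c y = scal A c (x * y)"
    and deg_subspace: "subspace (deg A n)"
    and deg_direct_sum:
      "\<exists>!f. (\<forall>n. f n \<in> deg A n) \<and> finite {n. f n \<noteq> 0} \<and> x = (\<Sum>n | f n \<noteq> 0. f n)"
    and deg_one: "1 \<in> deg A 0"
    and deg_mult: "x \<in> deg A m \<Longrightarrow> y \<in> deg A n \<Longrightarrow> x * y \<in> deg A (m + n)"
    and deg_finite_dim: "\<exists>S. finite S \<and> span S = deg A n"
    and idem_primitive: "i < rk A \<Longrightarrow> primitive_idempotent (idem A i)"
    and idem_orthogonal: "i < rk A \<Longrightarrow> j < rk A \<Longrightarrow> i \<noteq> j \<Longrightarrow> idem A i * idem A j = 0"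
    and span_idem: "deg A 0 = span (idem A ` {..<rk A})"

definition positive_part :: "('k, 'a :: ring) graded_algebra \<Rightarrow> 'a set" where
  "positive_part A = {(\<Sum>n\<in>S. f n) | S f. finite S \<and> (\<forall>n\<in>S. n > 0 \<and> f n \<in> deg A n)}"

record ('a, 'm) gmodule = "('a, 'm) module" +
  gpart :: "int \<Rightarrow> 'm set"

locale graded_module = left_module M
  for A :: "('k :: field, 'a :: {ring, monoid_mult}) graded_algebra"
  and M :: "('a, 'm) gmodule" (structure) +
  assumes gpart_subgroup: "additive_subgroup (gpart M n) M"
    and gpart_direct_sum: "x \<in> carrier M \<Longrightarrow>
      \<exists>!f. (\<forall>n. f n \<in> gpart M n) \<and> finite {n. f n \<noteq> \<zero>} \<and> x = (\<Oplus>n\<in>{n. f n \<noteq> \<zero>}. f n)"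
    and gpart_act: "a \<in> deg A i \<Longrightarrow> x \<in> gpart M n \<Longrightarrow> a \<odot> x \<in> gpart M (int i + n)"

definition gr_hom :: "('a, 'm) gmodule \<Rightarrow> ('a, 'n) gmodule \<Rightarrow> ('m \<Rightarrow> 'n) set" where
  "gr_hom M N = {f \<in> mod_hom M N. \<forall>n. f ` gpart M n \<subseteq> gpart N n}"

definition gr_iso :: "('a, 'm) gmodule \<Rightarrow> ('a, 'n) gmodule \<Rightarrow> bool" where
  "gr_iso M N \<longleftrightarrow> (\<exists>f \<in> gr_hom M N. bij_betw f (carrier M) (carrier N))"

definition shift :: "int \<Rightarrow> ('a, 'm) gmodule \<Rightarrow> ('a, 'm) gmodule" where
  "shift m M = M\<lparr>gpart := (\<lambda>n. gpart M (n - m))\<rparr>"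

definition gr_quotient :: "('a, 'm) gmodule \<Rightarrow> 'm set \<Rightarrow> ('a, 'm set) gmodule" where
  "gr_quotient M H =
     module.extend (quotient_module M H)
       (gmodule.fields (\<lambda>n. (\<lambda>x. H +>\<^bsub>M\<^esub> x) ` gpart M n))"

definition vertex_projective ::
  "('k, 'a :: {ring, monoid_mult}) graded_algebra \<Rightarrow> nat \<Rightarrow> ('a, 'a) gmodule" where
  "vertex_projective A j =
     \<lparr>carrier = {a * idem A j | a. True}, mult = undefined, one = undefined,
      zero = 0, add = (+), smult = (*),
      gpart = (\<lambda>n. if n \<ge> 0 then {a * idem A j | a. a \<in> deg A (nat n)} else {0})\<rparr>"

definition vertex_simple ::
  "('k, 'a :: {ring, monoid_mult}) graded_algebra \<Rightarrow> nat \<Rightarrow> ('a, 'a set) gmodule" where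
  "vertex_simple A j =
     gr_quotient (vertex_projective A j) {a * idem A j | a. a \<in> positive_part A}"


section \<open>The category of graded modules\<close>

text \<open>The type \<open>'u\<close> is the universe of sets in which the carriers of the objects live.
  Morphisms are extensional functions, so that equality of morphisms is equality in HOL.\<close>

definition GrMod ::
  "('k :: field, 'a :: {ring, monoid_mult}) graded_algebra \<Rightarrow> (('a, 'u) gmodule, 'u \<Rightarrow> 'u) cat"
where
  "GrMod A =
     \<lparr>ob = {M. graded_module A M}, hm = gr_hom, idt = (\<lambda>M. \<lambda>x\<in>carrier M. x),
      cmp = (\<lambda>L M N g f. compose (carrier L) g f)\<rparr>"

definition shift_functor ::
  "int \<Rightarrow> (('a, 'u) gmodule, 'u \<Rightarrow> 'u, ('a, 'u) gmodule, 'u \<Rightarrow> 'u) cfunctor" where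
  "shift_functor m = \<lparr>fob = shift m, fmor = (\<lambda>M N f. f)\<rparr>"

definition hom_add ::
  "('a, 'm) gmodule \<Rightarrow> ('a, 'n) gmodule \<Rightarrow> ('m \<Rightarrow> 'n) \<Rightarrow> ('m \<Rightarrow> 'n) \<Rightarrow> 'm \<Rightarrow> 'n" where
  "hom_add M N f g = (\<lambda>x\<in>carrier M. f x \<oplus>\<^bsub>N\<^esub> g x)"

definition hom_scale ::
  "('k, 'a :: {ring, monoid_mult}) graded_algebra \<Rightarrow> ('a, 'm) gmodule \<Rightarrow> ('a, 'n) gmodule \<Rightarrow>
     'k \<Rightarrow> ('m \<Rightarrow> 'n) \<Rightarrow> 'm \<Rightarrow> 'n" where
  "hom_scale A M N c f = (\<lambda>x\<in>carrier M. scal A c 1 \<odot>\<^bsub>N\<^esub> f x)"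

definition linear_functor ::
  "('k :: field, 'a :: {ring, monoid_mult}) graded_algebra \<Rightarrow>
   ('k, 'b :: {ring, monoid_mult}) graded_algebra \<Rightarrow>
   (('a, 'u) gmodule, 'u \<Rightarrow> 'u, ('b, 'u) gmodule, 'u \<Rightarrow> 'u) cfunctor \<Rightarrow> bool" where
  "linear_functor A B F \<longleftrightarrow>
     (\<forall>M \<in> ob (GrMod A). \<forall>N \<in> ob (GrMod A).
        (\<forall>f \<in> gr_hom M N. \<forall>g \<in> gr_hom M N.
           fmor F M N (hom_add M N f g) =
             hom_add (fob F M) (fob F N) (fmor F M N f) (fmor F M N g)) \<and>
        (\<forall>c. \<forall>f \<in> gr_hom M N.
           fmor F M N (hom_scale A M N c f) =
             hom_scale B (fob F M) (fob F N) c (fmor F M N f)))"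

definition graded_morita_equivalence ::
  "('k :: field, 'a :: {ring, monoid_mult}) graded_algebra \<Rightarrow>
   ('k, 'b :: {ring, monoid_mult}) graded_algebra \<Rightarrow>
   (('a, 'u) gmodule, 'u \<Rightarrow> 'u, ('b, 'u) gmodule, 'u \<Rightarrow> 'u) cfunctor \<Rightarrow> bool" where
  "graded_morita_equivalence A B F \<longleftrightarrow>
     is_equivalence (GrMod A) (GrMod B) F \<and> linear_functor A B F \<and>
     naturally_isomorphic (GrMod A) (GrMod B)
       (comp_functor F (shift_functor 1)) (comp_functor (shift_functor 1) F)"

text \<open>\<open>F(A e\<^sub>i) \<cong> B f\<^sub>j\<langle>m\<rangle>\<close>. The carrier of \<^term>\<open>vertex_projective A i\<close> is a set in
  the type of \<open>A\<close>, not in the universe, so \<open>F\<close> is applied to copies of it in the universe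
  (all of which are isomorphic, and which exist as soon as \<open>'a\<close> embeds into \<open>'u\<close>).\<close>

definition maps_vertex_projective ::
  "(('a, 'u) gmodule, 'u \<Rightarrow> 'u, ('b, 'u) gmodule, 'u \<Rightarrow> 'u) cfunctor \<Rightarrow>
   ('k :: field, 'a :: {ring, monoid_mult}) graded_algebra \<Rightarrow>
   ('k, 'b :: {ring, monoid_mult}) graded_algebra \<Rightarrow> nat \<Rightarrow> nat \<Rightarrow> int \<Rightarrow> bool" where
  "maps_vertex_projective F A B i j m \<longleftrightarrow>
     (\<forall>P \<in> ob (GrMod A). gr_iso P (vertex_projective A i) \<longrightarrow>
        gr_iso (fob F P) (shift m (vertex_projective B j)))"


section \<open>Finiteness conditions\<close>

definition gr_projective ::
  "('k :: field, 'a :: {ring, monoid_mult}) graded_algebra \<Rightarrow> ('a, 'u) gmodule \<Rightarrow> bool" where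
  "gr_projective A P \<longleftrightarrow> graded_module A P \<and>
     (\<forall>(M :: ('a, 'u) gmodule) (N :: ('a, 'u) gmodule) g f.
        graded_module A M \<and> graded_module A N \<and>
        g \<in> gr_hom M N \<and> g ` carrier M = carrier N \<and> f \<in> gr_hom P N \<longrightarrow>
        (\<exists>h \<in> gr_hom P M. compose (carrier P) g h = f))"

definition gr_FP_infinity ::
  "'u itself \<Rightarrow> ('k :: field, 'a :: {ring, monoid_mult}) graded_algebra \<Rightarrow>
     ('a, 'n) gmodule \<Rightarrow> bool" where
  "gr_FP_infinity U A N \<longleftrightarrow>
     (\<exists>(P :: nat \<Rightarrow> ('a, 'u) gmodule) d \<epsilon>.
        (\<forall>n. gr_projective A (P n) \<and> finitely_generated (P n)) \<and>
        (\<forall>n. d n \<in> gr_hom (P (Suc n)) (P n)) \<and> \<epsilon> \<in> gr_hom (P 0) N \<and>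
        \<epsilon> ` carrier (P 0) = carrier N \<and>
        d 0 ` carrier (P 1) = {x \<in> carrier (P 0). \<epsilon> x = \<zero>\<^bsub>N\<^esub>} \<and>
        (\<forall>n. d (Suc n) ` carrier (P (Suc (Suc n))) =
               {x \<in> carrier (P (Suc n)). d n x = \<zero>\<^bsub>P n\<^esub>}))"


section \<open>Matrix Hilbert series and Euler matrix\<close>

definition hilbert_matrix ::
  "('k :: field, 'a :: {ring, monoid_mult}) graded_algebra \<Rightarrow> int fps mat" where
  "hilbert_matrix A = mat (rk A) (rk A) (\<lambda>(i, j). Abs_fps (\<lambda>n.
     int (vector_space.dim (scal A) {idem A i * a * idem A j | a. a \<in> deg A n})))"

definition int_fps_to_fls :: "int fps \<Rightarrow> rat fls" where
  "int_fps_to_fls f = fps_to_fls (Abs_fps (\<lambda>n. of_int (fps_nth f n)))"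

abbreviation hilbert_matrix_fls ::
  "('k :: field, 'a :: {ring, monoid_mult}) graded_algebra \<Rightarrow> rat fls mat" where
  "hilbert_matrix_fls A \<equiv> map_mat int_fps_to_fls (hilbert_matrix A)"

text \<open>The Laurent expansion of a rational function \<open>f(x)\<close> at \<open>x = c\<close>, in the variable \<open>x - c\<close>:
  for \<open>c = 0\<close> the embedding of \<open>\<rat>(x)\<close> into \<open>\<rat>((x))\<close>, for \<open>c = 1\<close> the map
  \<open>f \<mapsto> f(1 + t)\<close> into \<open>\<rat>((t))\<close>.\<close>

definition laurent_at :: "rat \<Rightarrow> rat poly fract \<Rightarrow> rat fls" where
  "laurent_at c f =
     (let (p, q) = quot_of_fract f
      in fps_to_fls (fps_of_poly (pcompose p [:c, 1:])) /
         fps_to_fls (fps_of_poly (pcompose q [:c, 1:])))"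

definition rational_hilbert ::
  "('k :: field, 'a :: {ring, monoid_mult}) graded_algebra \<Rightarrow> rat poly fract mat \<Rightarrow> bool" where
  "rational_hilbert A R \<longleftrightarrow> R \<in> carrier_mat (rk A) (rk A) \<and>
     map_mat (laurent_at 0) R = hilbert_matrix_fls A"

definition standing_hypotheses ::
  "'u itself \<Rightarrow> ('k :: field, 'a :: {ring, monoid_mult}) graded_algebra \<Rightarrow> bool" where
  "standing_hypotheses U A \<longleftrightarrow>
     (\<forall>j < rk A. gr_FP_infinity U A (vertex_simple A j)) \<and> (\<exists>R. rational_hilbert A R)"

abbreviation matrix_inverse :: "'a :: field mat \<Rightarrow> 'a mat" where
  "matrix_inverse M \<equiv> the (mat_inverse M)"

definition euler_matrix ::
  "('k :: field, 'a :: {ring, monoid_mult}) graded_algebra \<Rightarrow> rat poly fract mat" where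
  "euler_matrix A = matrix_inverse (THE R. rational_hilbert A R)"

definition euler_matrix_at_1 ::
  "('k :: field, 'a :: {ring, monoid_mult}) graded_algebra \<Rightarrow> rat fls mat" where
  "euler_matrix_at_1 A = map_mat (laurent_at 1) (euler_matrix A)"

definition euler_smith_profile ::
  "('k :: field, 'a :: {ring, monoid_mult}) graded_algebra \<Rightarrow> int list \<Rightarrow> bool" where
  "euler_smith_profile A as \<longleftrightarrow> length as = rk A \<and> sorted as \<and>
     (\<exists>U \<in> carrier_mat (rk A) (rk A). \<exists>V \<in> carrier_mat (rk A) (rk A).
        invertible_mat U \<and> invertible_mat V \<and>
        map_mat fps_to_fls (U :: rat fps mat) * euler_matrix_at_1 A * map_mat fps_to_fls V =
          mat_diag (rk A) (\<lambda>i. fls_X_intpow (as ! i)))"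

definition laurent_module :: "nat \<Rightarrow> (rat fps, rat fls vec) module" where
  "laurent_module r =
     \<lparr>carrier = carrier_vec r, mult = undefined, one = undefined,
      zero = 0\<^sub>v r, add = (+), smult = (\<lambda>f v. fps_to_fls f \<cdot>\<^sub>v v)\<rparr>"

definition standard_lattice :: "nat \<Rightarrow> rat fls vec set" where
  "standard_lattice r = {v \<in> carrier_vec r. \<forall>i < r. v $ i \<in> range fps_to_fls}"

definition euler_lattice ::
  "('k :: field, 'a :: {ring, monoid_mult}) graded_algebra \<Rightarrow> rat fls vec set" where
  "euler_lattice A = (\<lambda>v. euler_matrix_at_1 A *\<^sub>v v) ` standard_lattice (rk A)"

definition G_plus ::
  "('k :: field, 'a :: {ring, monoid_mult}) graded_algebra \<Rightarrow> (rat fps, rat fls vec set) module"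
where
  "G_plus A = quotient_module
     ((laurent_module (rk A))\<lparr>carrier := standard_lattice (rk A)\<rparr>)
     (standard_lattice (rk A) \<inter> euler_lattice A)"

definition G_minus ::
  "('k :: field, 'a :: {ring, monoid_mult}) graded_algebra \<Rightarrow> (rat fps, rat fls vec set) module"
where
  "G_minus A = quotient_module
     ((laurent_module (rk A))\<lparr>carrier := euler_lattice A\<rparr>)
     (standard_lattice (rk A) \<inter> euler_lattice A)"

definition permutation_matrix :: "nat \<Rightarrow> (nat \<Rightarrow> nat) \<Rightarrow> 'a :: {zero, one} mat" where
  "permutation_matrix r \<sigma> = mat r r (\<lambda>(i, j). if i = \<sigma> j then 1 else 0)"

end

theory Submission
  imports Defs "Jordan_Normal_Form.Determinant"
begin

text \<open>
  For a graded module \<open>M\<close> let \<open>e\<^sub>i M\<^sub>n\<close> be the space of elements of degree \<open>n\<close> which \<open>e\<^sub>i\<close> fixes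
  (\<open>vpart\<close>). By the Yoneda lemma it is \<open>Hom(A e\<^sub>i\<langle>n\<rangle>, M)\<close> (\<open>vertex_generator_hom\<close>), and a graded module
  is the sum of these spaces. So everything that is claimed about \<open>B\<close> can be read off from the spaces
  \<open>f\<^sub>j N\<^sub>k\<close>, and the proof consists in transferring them along \<open>F\<close>.

  An equivalence carries every \<open>A e\<^sub>i\<langle>n\<rangle>\<close> to some \<open>B f\<^sub>j\<langle>k\<rangle>\<close> (\<open>equivalence_vertex_generator\<close>). The reason is
  that the image of some \<open>B f\<^sub>j\<langle>k\<rangle>\<close> under the inverse equivalence maps onto \<open>A e\<^sub>i\<langle>n\<rangle>\<close>, hence has it as a
  retract, while the endomorphism ring of \<open>B f\<^sub>j\<langle>k\<rangle>\<close> is the field of scalars, with \<open>0\<close> and \<open>1\<close> as its only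
  idempotents. As \<open>F\<close> is invertible and commutes with shifts, this gives a bijection \<open>\<sigma>\<close> of the vertices
  and integers \<open>m\<^sub>i\<close> with \<open>F(A e\<^sub>i\<langle>n\<rangle>) \<cong> B f\<^bsub>\<sigma> i\<^esub>\<langle>n + m\<^sub>i\<rangle>\<close> (\<open>graded_morita_matching\<close>). Since \<open>F\<close> is fully
  faithful and linear, there are linear bijections, natural in \<open>M\<close>,

    \<open>e\<^sub>i M\<^sub>n = Hom(A e\<^sub>i\<langle>n\<rangle>, M) \<cong> Hom(B f\<^bsub>\<sigma> i\<^esub>\<langle>n + m\<^sub>i\<rangle>, F M) = f\<^bsub>\<sigma> i\<^esub> (F M)\<^bsub>n + m\<^sub>i\<^esub>\<close>,

  the transfer maps \<open>\<tau>\<close> of the locale \<open>vertex_matching\<close>. They have two kinds of consequences.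

  For \<open>M = A e\<^sub>j\<close> the transfer identifies \<open>e\<^sub>i A\<^sub>n e\<^sub>j\<close> with the component of \<open>f\<^bsub>\<sigma> i\<^esub> B f\<^bsub>\<sigma> j\<^esub>\<close> in degree
  \<open>n + m\<^sub>i - m\<^sub>j\<close> (\<open>corner_transfer\<close>). This is the formula for \<open>C\<^sub>B\<close>, entry by entry (\<open>hilbert_matrix_conj\<close>).

  For general \<open>M\<close> it shows that \<open>F\<close> preserves exactness, finite generation and the one-dimensional modules
  at a vertex (\<open>F_exact\<close>, \<open>F_finitely_generated\<close>, \<open>F_vertex_line\<close>). It also preserves projectivity,
  because lifting problems can be moved from one category to the other (\<open>F_projective\<close>). So \<open>F\<close> turns a
  resolution of the simple module at \<open>i\<close> by finitely generated projectives into a resolution, up to a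
  shift, of the simple module at \<open>\<sigma> i\<close> (\<open>F_FP_infinity_vertex_simple\<close>).

  The remaining claims follow from the formula. It says that \<open>C\<^sub>A\<close> and \<open>C\<^sub>B\<close>, and hence their inverses, are
  conjugate over \<open>\<rat>(x)\<close> by the matrix \<open>\<Pi> X(x)\<close>. At \<open>x = 1 + t\<close> the powers of \<open>x\<close> are units of \<open>\<rat>[[t]]\<close>,
  so this matrix is invertible over \<open>\<rat>[[t]]\<close> (\<open>euler_matrix_conj\<close>). Multiplication by it and by its
  inverse does not change the Smith form (\<open>euler_smith_profile_conj\<close>), and the inverse maps \<open>\<rat>[[t]]\<^sup>r\<close>
  onto itself and the lattice of \<open>B\<close> onto that of \<open>A\<close>, which gives the isomorphisms of the quotients
  (\<open>mod_iso_conj\<close>).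
\<close>

section \<open>Equivalences are fully faithful\<close>

locale category =
  fixes C :: "('o, 'm) cat"
  assumes idt_hm: "M \<in> ob C \<Longrightarrow> idt C M \<in> hm C M M"
    and cmp_hm: "\<lbrakk>L \<in> ob C; M \<in> ob C; N \<in> ob C; f \<in> hm C L M; g \<in> hm C M N\<rbrakk>
      \<Longrightarrow> cmp C L M N g f \<in> hm C L N"
    and cmp_idt_left: "\<lbrakk>M \<in> ob C; N \<in> ob C; f \<in> hm C M N\<rbrakk> \<Longrightarrow> cmp C M N N (idt C N) f = f"
    and cmp_idt_right: "\<lbrakk>M \<in> ob C; N \<in> ob C; f \<in> hm C M N\<rbrakk> \<Longrightarrow> cmp C M M N f (idt C M) = f"
    and cmp_assoc: "\<lbrakk>K \<in> ob C; L \<in> ob C; M \<in> ob C; N \<in> ob C; f \<in> hm C K L; g \<in> hm C L M; h \<in> hm C M N\<rbrakk>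
      \<Longrightarrow> cmp C K M N h (cmp C K L M g f) = cmp C K L N (cmp C L M N h g) f"

lemma is_functorD:
  assumes "is_functor C D F"
  shows "M \<in> ob C \<Longrightarrow> fob F M \<in> ob D"
    and "\<lbrakk>M \<in> ob C; N \<in> ob C; f \<in> hm C M N\<rbrakk> \<Longrightarrow> fmor F M N f \<in> hm D (fob F M) (fob F N)"
    and "M \<in> ob C \<Longrightarrow> fmor F M M (idt C M) = idt D (fob F M)"
    and "\<lbrakk>L \<in> ob C; M \<in> ob C; N \<in> ob C; f \<in> hm C L M; g \<in> hm C M N\<rbrakk> \<Longrightarrow>
        fmor F L N (cmp C L M N g f) =
          cmp D (fob F L) (fob F M) (fob F N) (fmor F M N g) (fmor F L M f)"
  using assms unfolding is_functor_def by simp_all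

lemma naturally_isomorphic_idE:
  assumes "naturally_isomorphic C C (comp_functor G F) id_functor"
  obtains \<eta> where "\<And>M. M \<in> ob C \<Longrightarrow> is_iso_in C (fob G (fob F M)) M (\<eta> M)"
    "\<And>M N f. \<lbrakk>M \<in> ob C; N \<in> ob C; f \<in> hm C M N\<rbrakk> \<Longrightarrow>
      cmp C (fob G (fob F M)) (fob G (fob F N)) N (\<eta> N)
        (fmor G (fob F M) (fob F N) (fmor F M N f)) =
      cmp C (fob G (fob F M)) M N f (\<eta> M)"
proof -
  obtain \<eta> where "\<forall>M\<in>ob C. is_iso_in C (fob G (fob F M)) M (\<eta> M)"
    "\<forall>M\<in>ob C. \<forall>N\<in>ob C. \<forall>f\<in>hm C M N.
      cmp C (fob G (fob F M)) (fob G (fob F N)) N (\<eta> N)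
        (fmor G (fob F M) (fob F N) (fmor F M N f)) =
      cmp C (fob G (fob F M)) M N f (\<eta> M)"
    using assms unfolding naturally_isomorphic_def comp_functor_def id_functor_def by auto
  then show thesis by (intro that[of \<eta>]) simp_all
qed

text \<open>By naturality of \<open>\<eta> : G \<circ> F \<rightarrow> id\<close>, a morphism \<open>f : M \<rightarrow> N\<close> is recovered from \<open>F f\<close> as \<open>\<eta>\<^sub>N \<circ>
  G(F f) \<circ> \<eta>\<^sub>M\<^sup>-\<^sup>1\<close>.\<close>

lemma faithful_if_left_inverse:
  assumes "category C" and F: "is_functor C D F" and G: "is_functor D C G"
    and GF: "naturally_isomorphic C C (comp_functor G F) id_functor"
    and M: "M \<in> ob C" and N: "N \<in> ob C" and f: "f \<in> hm C M N" and g: "g \<in> hm C M N"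
    and eq: "fmor F M N f = fmor F M N g"
  shows "f = g"
proof -
  interpret category C by fact
  obtain \<eta> where iso: "\<And>M. M \<in> ob C \<Longrightarrow> is_iso_in C (fob G (fob F M)) M (\<eta> M)"
    and nat: "\<And>M N f. \<lbrakk>M \<in> ob C; N \<in> ob C; f \<in> hm C M N\<rbrakk> \<Longrightarrow>
      cmp C (fob G (fob F M)) (fob G (fob F N)) N (\<eta> N)
        (fmor G (fob F M) (fob F N) (fmor F M N f)) =
      cmp C (fob G (fob F M)) M N f (\<eta> M)"
    using naturally_isomorphic_idE[OF GF] by blast
  let ?M' = "fob G (fob F M)"
  have M': "?M' \<in> ob C" by (intro is_functorD(1)[OF F] is_functorD(1)[OF G] M)
  obtain k where k: "k \<in> hm C M ?M'" "cmp C M ?M' M (\<eta> M) k = idt C M" "\<eta> M \<in> hm C ?M' M"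
    using iso[OF M] unfolding is_iso_in_def by blast
  have "h = cmp C M ?M' N (cmp C ?M' M N h (\<eta> M)) k" if "h \<in> hm C M N" for h
    using cmp_assoc[OF M M' M N k(1,3) that] k(2) cmp_idt_right[OF M N that] by simp
  from this[OF f] this[OF g] nat[OF M N f] nat[OF M N g] eq show ?thesis by metis
qed

text \<open>A preimage of \<open>h\<close> is \<open>f = \<eta>\<^sub>N \<circ> G(h) \<circ> \<eta>\<^sub>M\<^sup>-\<^sup>1\<close>: by naturality \<open>G(F f) = G(h)\<close>, and \<open>G\<close> is
  faithful.\<close>

lemma full_if_equivalence:
  assumes "category C" "category D" and F: "is_functor C D F" and G: "is_functor D C G"
    and GF: "naturally_isomorphic C C (comp_functor G F) id_functor"
    and FG: "naturally_isomorphic D D (comp_functor F G) id_functor"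
    and M: "M \<in> ob C" and N: "N \<in> ob C" and h: "h \<in> hm D (fob F M) (fob F N)"
  shows "\<exists>f \<in> hm C M N. fmor F M N f = h"
proof -
  interpret C: category C by fact
  obtain \<eta> where iso: "\<And>M. M \<in> ob C \<Longrightarrow> is_iso_in C (fob G (fob F M)) M (\<eta> M)"
    and nat: "\<And>M N f. \<lbrakk>M \<in> ob C; N \<in> ob C; f \<in> hm C M N\<rbrakk> \<Longrightarrow>
      cmp C (fob G (fob F M)) (fob G (fob F N)) N (\<eta> N)
        (fmor G (fob F M) (fob F N) (fmor F M N f)) =
      cmp C (fob G (fob F M)) M N f (\<eta> M)"
    using naturally_isomorphic_idE[OF GF] by blast
  let ?M' = "fob G (fob F M)" and ?N' = "fob G (fob F N)"
  have FM: "fob F M \<in> ob D" and FN: "fob F N \<in> ob D" by (intro is_functorD(1)[OF F] M N)+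
  have M': "?M' \<in> ob C" and N': "?N' \<in> ob C" by (intro is_functorD(1)[OF G] FM FN)+
  obtain k where k: "k \<in> hm C M ?M'" "cmp C ?M' M ?M' k (\<eta> M) = idt C ?M'" "\<eta> M \<in> hm C ?M' M"
    using iso[OF M] unfolding is_iso_in_def by blast
  obtain l where l: "l \<in> hm C N ?N'" "cmp C ?N' N ?N' l (\<eta> N) = idt C ?N'" "\<eta> N \<in> hm C ?N' N"
    using iso[OF N] unfolding is_iso_in_def by blast
  have Gh: "fmor G (fob F M) (fob F N) h \<in> hm C ?M' ?N'" by (intro is_functorD(2)[OF G] FM FN h)
  define a where "a = cmp C ?M' ?N' N (\<eta> N) (fmor G (fob F M) (fob F N) h)"
  have a: "a \<in> hm C ?M' N" unfolding a_def by (rule C.cmp_hm[OF M' N' N Gh l(3)])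
  define f where "f = cmp C M ?M' N a k"
  have f: "f \<in> hm C M N" unfolding f_def by (rule C.cmp_hm[OF M M' N k(1) a])
  have Ff: "fmor F M N f \<in> hm D (fob F M) (fob F N)" by (intro is_functorD(2)[OF F] M N f)
  then have GFf: "fmor G (fob F M) (fob F N) (fmor F M N f) \<in> hm C ?M' ?N'"
    by (intro is_functorD(2)[OF G] FM FN)
  have "cmp C ?M' M N f (\<eta> M) = a"
    unfolding f_def using C.cmp_assoc[OF M' M M' N k(3) k(1) a] k(2) C.cmp_idt_right[OF M' N a] by simp
  then have "cmp C ?M' ?N' N (\<eta> N) (fmor G (fob F M) (fob F N) (fmor F M N f)) =
    cmp C ?M' ?N' N (\<eta> N) (fmor G (fob F M) (fob F N) h)"
    using nat[OF M N f] a_def by simp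
  moreover have "u = cmp C ?M' N ?N' l (cmp C ?M' ?N' N (\<eta> N) u)" if "u \<in> hm C ?M' ?N'" for u
    using C.cmp_assoc[OF M' N' N N' that l(3,1)] l(2) C.cmp_idt_left[OF M' N' that] by simp
  ultimately have "fmor G (fob F M) (fob F N) (fmor F M N f) = fmor G (fob F M) (fob F N) h"
    using GFf Gh by metis
  then have "fmor F M N f = h"
    by (rule faithful_if_left_inverse[OF \<open>category D\<close> G F FG FM FN Ff h])
  with f show ?thesis by blast
qed

lemma iso_in_sym: "is_iso_in C M N f \<Longrightarrow> \<exists>g. is_iso_in C N M g"
proof -
  assume f: "is_iso_in C M N f"
  then obtain g where g: "g \<in> hm C N M" "cmp C M N M g f = idt C M" "cmp C N M N f g = idt C N"
    and "f \<in> hm C M N"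
    unfolding is_iso_in_def by auto
  then have "is_iso_in C N M g" unfolding is_iso_in_def by (auto intro: bexI[of _ f])
  then show ?thesis ..
qed

lemma functor_iso:
  assumes F: "is_functor C D F" and M: "M \<in> ob C" and N: "N \<in> ob C" and f: "is_iso_in C M N f"
  shows "is_iso_in D (fob F M) (fob F N) (fmor F M N f)"
proof -
  obtain g where g: "g \<in> hm C N M" "cmp C M N M g f = idt C M" "cmp C N M N f g = idt C N"
    and f': "f \<in> hm C M N" using f unfolding is_iso_in_def by blast
  have "cmp D (fob F M) (fob F N) (fob F M) (fmor F N M g) (fmor F M N f) = idt D (fob F M)"
    using is_functorD(4)[OF F M N M f' g(1)] g(2) is_functorD(3)[OF F M] by metis
  moreover have "cmp D (fob F N) (fob F M) (fob F N) (fmor F M N f) (fmor F N M g) = idt D (fob F N)"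
    using is_functorD(4)[OF F N M N g(1) f'] g(3) is_functorD(3)[OF F N] by metis
  ultimately show ?thesis unfolding is_iso_in_def
    using is_functorD(2)[OF F M N f'] is_functorD(2)[OF F N M g(1)] by auto
qed

lemma (in category) iso_in_trans:
  assumes L: "L \<in> ob C" and M: "M \<in> ob C" and N: "N \<in> ob C"
    and f: "is_iso_in C L M f" and g: "is_iso_in C M N g"
  shows "is_iso_in C L N (cmp C L M N g f)"
proof -
  obtain f' where f': "f \<in> hm C L M" "f' \<in> hm C M L" "cmp C L M L f' f = idt C L" "cmp C M L M f f' = idt C M"
    using f unfolding is_iso_in_def by blast
  obtain g' where g': "g \<in> hm C M N" "g' \<in> hm C N M" "cmp C M N M g' g = idt C M" "cmp C N M N g g' = idt C N"
    using g unfolding is_iso_in_def by blast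
  let ?h = "cmp C N M L f' g'" and ?k = "cmp C L M N g f"
  have h: "?h \<in> hm C N L" and k: "?k \<in> hm C L N" by (intro cmp_hm L M N f' g')+
  have "cmp C L N L ?h ?k = cmp C L M L f' (cmp C L N M g' ?k)"
    using cmp_assoc[OF L N M L k g'(2) f'(2)] by simp
  also have "cmp C L N M g' ?k = f"
    using cmp_assoc[OF L M N M f'(1) g'(1,2)] g'(3) cmp_idt_left[OF L M f'(1)] by simp
  finally have 1: "cmp C L N L ?h ?k = idt C L" using f'(3) by simp
  have "cmp C N L N ?k ?h = cmp C N M N g (cmp C N L M f ?h)"
    using cmp_assoc[OF N L M N h f'(1) g'(1)] by simp
  also have "cmp C N L M f ?h = g'"
    using cmp_assoc[OF N M L M g'(2) f'(2,1)] f'(4) cmp_idt_left[OF N M g'(2)] by simp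
  finally have "cmp C N L N ?k ?h = idt C N" using g'(4) by simp
  with 1 h k show ?thesis unfolding is_iso_in_def by (auto intro: bexI[of _ ?h])
qed

lemma equivalence_inverse:
  assumes "is_equivalence C D F"
  obtains G where "is_equivalence D C G"
    "naturally_isomorphic C C (comp_functor G F) id_functor"
    "naturally_isomorphic D D (comp_functor F G) id_functor"
  using assms unfolding is_equivalence_def by blast

section \<open>The category of graded modules\<close>

lemma gr_homI:
  assumes "\<And>x. x \<in> carrier M \<Longrightarrow> f x \<in> carrier N" "f \<in> extensional (carrier M)"
    "\<And>x y. x \<in> carrier M \<Longrightarrow> y \<in> carrier M \<Longrightarrow> f (x \<oplus>\<^bsub>M\<^esub> y) = f x \<oplus>\<^bsub>N\<^esub> f y"
    "\<And>a x. x \<in> carrier M \<Longrightarrow> f (a \<odot>\<^bsub>M\<^esub> x) = a \<odot>\<^bsub>N\<^esub> f x"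
    "\<And>n x. x \<in> gpart M n \<Longrightarrow> f x \<in> gpart N n"
  shows "f \<in> gr_hom M N"
  using assms unfolding gr_hom_def mod_hom_def by (auto simp: PiE_iff)

lemma gr_homD:
  assumes "f \<in> gr_hom M N"
  shows "x \<in> carrier M \<Longrightarrow> f x \<in> carrier N" "f \<in> extensional (carrier M)"
    "x \<in> carrier M \<Longrightarrow> y \<in> carrier M \<Longrightarrow> f (x \<oplus>\<^bsub>M\<^esub> y) = f x \<oplus>\<^bsub>N\<^esub> f y"
    "x \<in> carrier M \<Longrightarrow> f (a \<odot>\<^bsub>M\<^esub> x) = a \<odot>\<^bsub>N\<^esub> f x"
    "x \<in> gpart M n \<Longrightarrow> f x \<in> gpart N n"
  using assms unfolding gr_hom_def mod_hom_def by (simp_all add: PiE_iff image_subset_iff)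

lemma (in graded_module) gpart_carrier: "x \<in> gpart M n \<Longrightarrow> x \<in> carrier M"
  using additive_subgroup.a_subset[OF gpart_subgroup] by blast

lemma gr_hom_id: "graded_module A M \<Longrightarrow> (\<lambda>x\<in>carrier M. x) \<in> gr_hom M M"
proof -
  assume "graded_module A M"
  then interpret graded_module A M .
  show ?thesis by (rule gr_homI) (auto simp: act_closed gpart_carrier)
qed

lemma gr_hom_compose:
  assumes "graded_module A L" and f: "f \<in> gr_hom L M" and g: "g \<in> gr_hom M N"
  shows "compose (carrier L) g f \<in> gr_hom L N"
proof -
  interpret graded_module A L by fact
  show ?thesis
    by (rule gr_homI) (use gr_homD[OF f] gr_homD[OF g] in
        \<open>simp_all add: compose_def act_closed gpart_carrier\<close>)
qed

lemma gr_hom_eqI: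
  assumes "f \<in> gr_hom M N" "g \<in> gr_hom M N'" "\<And>x. x \<in> carrier M \<Longrightarrow> f x = g x"
  shows "f = g"
  using gr_homD(2)[OF assms(1)] gr_homD(2)[OF assms(2)] assms(3) by (rule extensionalityI)

lemma GrMod_simps [simp]:
  "ob (GrMod A) = {M. graded_module A M}" "hm (GrMod A) = gr_hom"
  "idt (GrMod A) M = (\<lambda>x\<in>carrier M. x)" "cmp (GrMod A) L M N g f = compose (carrier L) g f"
  by (simp_all add: GrMod_def)

lemma category_GrMod: "category (GrMod A)"
proof (rule category.intro)
  fix M :: "('b, 'u) gmodule"
  assume "M \<in> ob (GrMod A)"
  then have M: "graded_module A M" by simp
  show "idt (GrMod A) M \<in> hm (GrMod A) M M" using gr_hom_id[OF M] by simp
next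
  fix M N :: "('b, 'u) gmodule" and f
  assume "M \<in> ob (GrMod A)" "N \<in> ob (GrMod A)" "f \<in> hm (GrMod A) M N"
  then have M: "graded_module A M" and N: "graded_module A N" and f: "f \<in> gr_hom M N" by simp_all
  have "compose (carrier M) (\<lambda>x\<in>carrier N. x) f = f"
    by (rule gr_hom_eqI[OF gr_hom_compose[OF M f gr_hom_id[OF N]] f])
      (simp add: compose_def gr_homD(1)[OF f])
  then show "cmp (GrMod A) M N N (idt (GrMod A) N) f = f" by simp
  have "compose (carrier M) f (\<lambda>x\<in>carrier M. x) = f"
    by (rule gr_hom_eqI[OF gr_hom_compose[OF M gr_hom_id[OF M] f] f])
      (simp add: compose_def)
  then show "cmp (GrMod A) M M N f (idt (GrMod A) M) = f" by simp
next
  fix L M N :: "('b, 'u) gmodule" and f g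
  assume "L \<in> ob (GrMod A)" "f \<in> hm (GrMod A) L M" "g \<in> hm (GrMod A) M N"
  then have L: "graded_module A L" and f: "f \<in> gr_hom L M" and g: "g \<in> gr_hom M N" by simp_all
  show "cmp (GrMod A) L M N g f \<in> hm (GrMod A) L N" using gr_hom_compose[OF L f g] by simp
next
  fix K L M N :: "('b, 'u) gmodule" and f g h
  assume "f \<in> hm (GrMod A) K L"
  then have f: "f \<in> gr_hom K L" by simp
  show "cmp (GrMod A) K M N h (cmp (GrMod A) K L M g f) =
         cmp (GrMod A) K L N (cmp (GrMod A) L M N h g) f"
    unfolding GrMod_simps by (rule compose_assoc) (use gr_homD(1)[OF f] in blast)
qed

section \<open>Elementary graded algebras\<close>

context elementary_graded_algebra
begin

lemma idem_sq: "i < rk A \<Longrightarrow> idem A i * idem A i = idem A i"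
  and idem_nonzero: "i < rk A \<Longrightarrow> idem A i \<noteq> 0"
  using idem_primitive unfolding primitive_idempotent_def by blast+

lemma idem_mult: "i < rk A \<Longrightarrow> j < rk A \<Longrightarrow> idem A i * idem A j = (if i = j then idem A i else 0)"
  using idem_sq idem_orthogonal by simp

lemma idem_deg: "i < rk A \<Longrightarrow> idem A i \<in> deg A 0"
  unfolding span_idem by (rule span_base) simp

lemma sum_idem: "(\<Sum>i<rk A. idem A i) = 1"
proof -
  let ?s = "\<Sum>i<rk A. idem A i"
  have "x * ?s = x" if "x \<in> span (idem A ` {..<rk A})" for x
    using that
  proof (induction rule: span_induct_alt)
    case (step c x y)
    then obtain i where i: "i < rk A" "x = idem A i" by blast
    have "x * ?s = (\<Sum>j<rk A. if i = j then idem A i else 0)"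
      unfolding sum_distrib_left i(2) by (rule sum.cong) (use i(1) idem_mult in auto)
    also have "\<dots> = x" using i by simp
    finally show ?case using step by (simp add: distrib_right scal_mult_left)
  qed simp
  from this[of 1] show ?thesis using deg_one span_idem by simp
qed

lemma scal_one_mult: "scal A c 1 * x = scal A c x" and mult_scal_one: "x * scal A c 1 = scal A c x"
  by (simp_all add: scal_mult_left scal_mult_right)

lemma scal_one_deg: "scal A c 1 \<in> deg A 0"
  using deg_one deg_subspace subspace_scale by blast

lemma deg_zero: "0 \<in> deg A n" and deg_add: "x \<in> deg A n \<Longrightarrow> y \<in> deg A n \<Longrightarrow> x + y \<in> deg A n"
  and deg_scal: "x \<in> deg A n \<Longrightarrow> scal A c x \<in> deg A n"
  using deg_subspace subspace_0 subspace_add subspace_scale by blast+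

text \<open>Each \<open>e\<^sub>i\<close> is a common eigenvector of the degree-zero part, on both sides.\<close>

lemma deg0_idem:
  assumes "a \<in> deg A 0" "i < rk A"
  shows "\<exists>c. a * idem A i = scal A c (idem A i) \<and> idem A i * a = scal A c (idem A i)"
  using assms(1) unfolding span_idem
proof (induction rule: span_induct_alt)
  case base
  show ?case by (rule exI[of _ 0]) simp
next
  case (step c x y)
  then obtain j where j: "j < rk A" "x = idem A j" by blast
  from step obtain d where d: "y * idem A i = scal A d (idem A i)" "idem A i * y = scal A d (idem A i)"
    by blast
  show ?case
    by (rule exI[of _ "(if i = j then c else 0) + d"])
      (use idem_mult assms(2) j d in \<open>auto simp: distrib_left distrib_right scal_mult_left
        scal_mult_right scale_left_distrib\<close>)
qed

lemma homogeneous_induct [case_names zero add homogeneous]: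
  assumes "P 0" "\<And>x y. P x \<Longrightarrow> P y \<Longrightarrow> P (x + y)" "\<And>n x. x \<in> deg A n \<Longrightarrow> P x"
  shows "P a"
proof -
  obtain f where f: "\<And>n. f n \<in> deg A n" "finite {n. f n \<noteq> 0}" "a = (\<Sum>n | f n \<noteq> 0. f n)"
    using deg_direct_sum[of a] by blast
  have "P (\<Sum>n\<in>K. f n)" if "finite K" for K
    using that
  proof (induction K)
    case (insert n K)
    then show ?case using assms(2)[OF assms(3)[OF f(1)[of n]]] by simp
  qed (simp add: assms(1))
  with f show ?thesis by simp
qed

end

section \<open>Graded modules and their homogeneous components\<close>

context left_module
begin

lemma act_zero_right: "a \<odot> \<zero> = \<zero>"
proof -
  have "a \<odot> \<zero> \<oplus> a \<odot> \<zero> = a \<odot> \<zero>" using act_add_right[of \<zero> \<zero> a] by simp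
  then show ?thesis using act_closed[of \<zero> a] by (metis add.l_cancel_one zero_closed)
qed

lemma act_zero_left: "x \<in> carrier M \<Longrightarrow> 0 \<odot> x = \<zero>"
proof -
  assume x: "x \<in> carrier M"
  have "0 \<odot> x \<oplus> 0 \<odot> x = 0 \<odot> x" using act_add_left[OF x, of 0 0] by simp
  then show ?thesis using act_closed[OF x, of 0] by (metis add.l_cancel_one)
qed

end

lemma (in left_module) act_diff_eq_zero:
  assumes x: "x \<in> carrier M" and eq: "a \<odot> x = b \<odot> x"
  shows "(a - b) \<odot> x = \<zero>"
proof -
  have "(a - b) \<odot> x \<oplus> b \<odot> x = \<zero> \<oplus> b \<odot> x"
    using act_add_left[OF x, of "a - b" b] eq act_closed[OF x] by simp
  then show ?thesis by (subst (asm) add.right_cancel) (use act_closed[OF x] in auto)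
qed

context graded_module
begin

lemma gpart_zero: "\<zero> \<in> gpart M n"
  and gpart_add: "x \<in> gpart M n \<Longrightarrow> y \<in> gpart M n \<Longrightarrow> x \<oplus> y \<in> gpart M n"
  using additive_subgroup.zero_closed[OF gpart_subgroup]
    additive_subgroup.a_closed[OF gpart_subgroup] by blast+

definition hcomp where
  "hcomp x = (THE f. (\<forall>n. f n \<in> gpart M n) \<and> finite {n. f n \<noteq> \<zero>} \<and> x = (\<Oplus>n\<in>{n. f n \<noteq> \<zero>}. f n))"

lemma hcomp:
  assumes "x \<in> carrier M"
  shows hcomp_gpart: "hcomp x n \<in> gpart M n" and hcomp_finite: "finite {n. hcomp x n \<noteq> \<zero>}"
    and hcomp_finsum: "(\<Oplus>n\<in>{n. hcomp x n \<noteq> \<zero>}. hcomp x n) = x"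
  using theI'[OF gpart_direct_sum[OF assms]] unfolding hcomp_def[symmetric] by simp_all

text \<open>Uniqueness of the homogeneous decomposition, for sums over any finite set that contains the
  degrees of the nonzero summands.\<close>

lemma hcomp_eqI:
  assumes K: "finite K" and g: "\<And>k. g k \<in> gpart M k" "\<And>k. k \<notin> K \<Longrightarrow> g k = \<zero>"
    and x: "x = (\<Oplus>k\<in>K. g k)"
  shows "hcomp x = g"
proof -
  have gc: "\<And>k. g k \<in> carrier M" using g gpart_carrier by blast
  have sub: "{n. g n \<noteq> \<zero>} \<subseteq> K" using g by blast
  have eq: "x = (\<Oplus>k\<in>{n. g n \<noteq> \<zero>}. g k)" unfolding x
    by (rule add.finprod_mono_neutral_cong_right) (use K sub gc in auto)
  have "x \<in> carrier M" unfolding x using gc by (intro finsum_closed) auto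
  from the1_equality[OF gpart_direct_sum[OF this]] show ?thesis
    unfolding hcomp_def using g eq finite_subset[OF sub K] by simp
qed

lemma hcomp_homogeneous:
  assumes "x \<in> gpart M n"
  shows "hcomp x = (\<lambda>k. if k = n then x else \<zero>)"
  by (rule hcomp_eqI[of "{n}"]) (use assms gpart_carrier gpart_zero in auto)

lemma gpart_disjoint: "x \<in> gpart M m \<Longrightarrow> x \<in> gpart M n \<Longrightarrow> m \<noteq> n \<Longrightarrow> x = \<zero>"
  using hcomp_homogeneous[of x m] hcomp_homogeneous[of x n] by metis

lemma hcomp_add:
  assumes x: "x \<in> carrier M" and y: "y \<in> carrier M"
  shows "hcomp (x \<oplus> y) = (\<lambda>n. hcomp x n \<oplus> hcomp y n)"
proof (rule hcomp_eqI)
  let ?K = "{n. hcomp x n \<noteq> \<zero>} \<union> {n. hcomp y n \<noteq> \<zero>}"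
  show fin: "finite ?K" using hcomp_finite x y by simp
  have c: "hcomp x n \<in> carrier M" "hcomp y n \<in> carrier M" for n
    using gpart_carrier hcomp_gpart x y by blast+
  have "(\<Oplus>n\<in>?K. hcomp x n) = x"
    by (subst (2) hcomp_finsum[OF x, symmetric], rule add.finprod_mono_neutral_cong_right)
      (use fin c in auto)
  moreover have "(\<Oplus>n\<in>?K. hcomp y n) = y"
    by (subst (2) hcomp_finsum[OF y, symmetric], rule add.finprod_mono_neutral_cong_right)
      (use fin c in auto)
  ultimately show "x \<oplus> y = (\<Oplus>n\<in>?K. hcomp x n \<oplus> hcomp y n)"
    using c by (subst finsum_addf) auto
qed (use hcomp_gpart gpart_add x y in auto)

lemma finsum_induct:
  assumes "finite K" "\<And>k. k \<in> K \<Longrightarrow> g k \<in> carrier M" "\<And>k. k \<in> K \<Longrightarrow> P (g k)"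
    and "P \<zero>" "\<And>x y. x \<in> carrier M \<Longrightarrow> y \<in> carrier M \<Longrightarrow> P x \<Longrightarrow> P y \<Longrightarrow> P (x \<oplus> y)"
  shows "P (\<Oplus>k\<in>K. g k)"
  using assms(1-3)
  by (induction K) (use assms(4,5) in \<open>auto simp: Pi_iff finsum_closed\<close>)

end

lemma gr_hom_zero:
  assumes "graded_module A M" "graded_module A N" "f \<in> gr_hom M N"
  shows "f \<zero>\<^bsub>M\<^esub> = \<zero>\<^bsub>N\<^esub>"
proof -
  interpret M: graded_module A M by fact
  interpret N: graded_module A N by fact
  have "f (0 \<odot>\<^bsub>M\<^esub> \<zero>\<^bsub>M\<^esub>) = 0 \<odot>\<^bsub>N\<^esub> f \<zero>\<^bsub>M\<^esub>" using gr_homD(4)[OF assms(3)] by simp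
  then show ?thesis using gr_homD(1)[OF assms(3)] by (simp add: M.act_zero_left N.act_zero_left)
qed

lemma gr_hom_hcomp:
  assumes M: "graded_module A M" and N: "graded_module A N" and f: "f \<in> gr_hom M N"
    and x: "x \<in> carrier M"
  shows "graded_module.hcomp N (f x) = (\<lambda>n. f (graded_module.hcomp M x n))"
proof -
  interpret M: graded_module A M by fact
  interpret N: graded_module A N by fact
  show ?thesis
  proof (rule N.hcomp_eqI)
    let ?K = "{n. M.hcomp x n \<noteq> \<zero>\<^bsub>M\<^esub>}"
    show "finite ?K" by (rule M.hcomp_finite[OF x])
    show "f (M.hcomp x k) \<in> gpart N k" for k
      using M.hcomp_gpart[OF x] gr_homD(5)[OF f] by blast
    show "f (M.hcomp x k) = \<zero>\<^bsub>N\<^esub>" if "k \<notin> ?K" for k using that gr_hom_zero[OF M N f] by simp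
    have c: "M.hcomp x n \<in> carrier M" for n using M.hcomp_gpart[OF x] M.gpart_carrier by blast
    have "f (\<Oplus>\<^bsub>M\<^esub>n\<in>K. M.hcomp x n) = (\<Oplus>\<^bsub>N\<^esub>n\<in>K. f (M.hcomp x n))" if "finite K" for K
      using that
    proof (induction K)
      case (insert n K)
      then have "(\<Oplus>\<^bsub>M\<^esub>n\<in>insert n K. M.hcomp x n) = M.hcomp x n \<oplus>\<^bsub>M\<^esub> (\<Oplus>\<^bsub>M\<^esub>n\<in>K. M.hcomp x n)"
        using c by (intro M.finsum_insert) auto
      moreover have "(\<Oplus>\<^bsub>N\<^esub>n\<in>insert n K. f (M.hcomp x n)) = f (M.hcomp x n) \<oplus>\<^bsub>N\<^esub> (\<Oplus>\<^bsub>N\<^esub>n\<in>K. f (M.hcomp x n))"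
        using c insert gr_homD(1)[OF f] by (intro N.finsum_insert) auto
      moreover have "(\<Oplus>\<^bsub>M\<^esub>n\<in>K. M.hcomp x n) \<in> carrier M" using c by (intro M.finsum_closed) auto
      ultimately show ?case using insert gr_homD(3)[OF f] c by simp
    qed (simp add: gr_hom_zero[OF M N f])
    from this[OF M.hcomp_finite[OF x]] show "f x = (\<Oplus>\<^bsub>N\<^esub>n\<in>?K. f (M.hcomp x n))"
      unfolding M.hcomp_finsum[OF x] .
  qed
qed

text \<open>The vertex component \<open>e\<^sub>i M\<^sub>n\<close>.\<close>

definition vpart ::
  "('k, 'a) graded_algebra \<Rightarrow> ('a, 'm) gmodule \<Rightarrow> nat \<Rightarrow> int \<Rightarrow> 'm set" where
  "vpart A M i n = {x \<in> gpart M n. idem A i \<odot>\<^bsub>M\<^esub> x = x}"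

text \<open>As the \<open>e\<^sub>i\<close> sum to \<open>1\<close>, a graded module is the sum of its vertex components, and so is the kernel of a
  graded homomorphism, which is a graded submodule. The zero homomorphism gives plain induction.\<close>

lemma kernel_induct [consumes 6, case_names zero add vpart]:
  assumes A: "elementary_graded_algebra A" and M: "graded_module A M" and N: "graded_module A N"
    and f: "f \<in> gr_hom M N" and x: "x \<in> carrier M" and fx: "f x = \<zero>\<^bsub>N\<^esub>"
    and P0: "P \<zero>\<^bsub>M\<^esub>"
    and Padd: "\<And>x y. x \<in> carrier M \<Longrightarrow> y \<in> carrier M \<Longrightarrow> P x \<Longrightarrow> P y \<Longrightarrow> P (x \<oplus>\<^bsub>M\<^esub> y)"
    and Pv: "\<And>i n x. i < rk A \<Longrightarrow> x \<in> vpart A M i n \<Longrightarrow> f x = \<zero>\<^bsub>N\<^esub> \<Longrightarrow> P x"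
  shows "P x"
proof -
  interpret A: elementary_graded_algebra A by fact
  interpret M: graded_module A M by fact
  interpret N: graded_module A N by fact
  have f_comp: "f (M.hcomp x n) = \<zero>\<^bsub>N\<^esub>" for n
    using fun_cong[OF gr_hom_hcomp[OF M N f x], of n] fx
      fun_cong[OF N.hcomp_homogeneous[OF N.gpart_zero, of 0], of n] by simp
  have "P (M.hcomp x n)" for n
  proof -
    let ?y = "M.hcomp x n"
    have y: "?y \<in> gpart M n" by (rule M.hcomp_gpart[OF x])
    then have yc: "?y \<in> carrier M" by (rule M.gpart_carrier)
    have "P ((\<Sum>i\<in>S. idem A i) \<odot>\<^bsub>M\<^esub> ?y)" if "finite S" "S \<subseteq> {..<rk A}" for S
      using that
    proof (induction S)
      case (insert i S)
      then have i: "i < rk A" by simp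
      have "idem A i \<odot>\<^bsub>M\<^esub> ?y \<in> vpart A M i n"
        using M.gpart_act[OF A.idem_deg[OF i] y] M.act_assoc[OF yc, of "idem A i" "idem A i"] A.idem_sq[OF i]
        by (simp add: vpart_def)
      moreover have "f (idem A i \<odot>\<^bsub>M\<^esub> ?y) = \<zero>\<^bsub>N\<^esub>"
        using gr_homD(4)[OF f yc] f_comp by (simp add: N.act_zero_right)
      ultimately have "P (idem A i \<odot>\<^bsub>M\<^esub> ?y)" by (rule Pv[OF i])
      then have "P (idem A i \<odot>\<^bsub>M\<^esub> ?y \<oplus>\<^bsub>M\<^esub> (\<Sum>i\<in>S. idem A i) \<odot>\<^bsub>M\<^esub> ?y)"
        using insert by (intro Padd M.act_closed yc) simp_all
      then show ?case using insert(1,2) by (simp add: M.act_add_left[OF yc])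
    qed (use P0 yc in \<open>simp add: M.act_zero_left\<close>)
    from this[of "{..<rk A}"] show ?thesis by (simp add: A.sum_idem M.act_one[OF yc])
  qed
  then have "P (\<Oplus>\<^bsub>M\<^esub>n\<in>{n. M.hcomp x n \<noteq> \<zero>\<^bsub>M\<^esub>}. M.hcomp x n)"
    by (rule M.finsum_induct[where P = P, OF M.hcomp_finite[OF x] M.gpart_carrier[OF M.hcomp_gpart[OF x]] _ P0 Padd])
  then show ?thesis unfolding M.hcomp_finsum[OF x] .
qed

definition zero_map :: "('a, 'm) gmodule \<Rightarrow> ('a, 'n) gmodule \<Rightarrow> 'm \<Rightarrow> 'n" where
  "zero_map M N = (\<lambda>x\<in>carrier M. \<zero>\<^bsub>N\<^esub>)"

lemma zero_map:
  assumes "graded_module A M" "graded_module A N"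
  shows "zero_map M N \<in> gr_hom M N"
proof -
  interpret M: graded_module A M by fact
  interpret N: graded_module A N by fact
  show ?thesis by (rule gr_homI)
      (auto simp: zero_map_def M.act_closed N.act_zero_right M.gpart_carrier N.gpart_zero)
qed

lemma vpart_induct [consumes 3, case_names zero add vpart]:
  assumes A: "elementary_graded_algebra A" and M: "graded_module A M" and x: "x \<in> carrier M"
    and "P \<zero>\<^bsub>M\<^esub>"
    and "\<And>x y. x \<in> carrier M \<Longrightarrow> y \<in> carrier M \<Longrightarrow> P x \<Longrightarrow> P y \<Longrightarrow> P (x \<oplus>\<^bsub>M\<^esub> y)"
    and "\<And>i n x. i < rk A \<Longrightarrow> x \<in> vpart A M i n \<Longrightarrow> P x"
  shows "P x"
  by (rule kernel_induct[OF A M M zero_map[OF M M] x])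
    (use assms in \<open>auto simp: zero_map_def\<close>)

text \<open>A graded homomorphism commutes with the projections onto the vertex components, so an arbitrary
  preimage of an element of \<open>e\<^sub>i N\<^sub>n\<close> can be projected to one in \<open>e\<^sub>i M\<^sub>n\<close>.\<close>

lemma gr_hom_lift_vpart:
  assumes A: "elementary_graded_algebra A" and M: "graded_module A M" and N: "graded_module A N"
    and f: "f \<in> gr_hom M N" and x: "x \<in> carrier M" and i: "i < rk A" and fx: "f x \<in> vpart A N i n"
  shows "\<exists>y \<in> vpart A M i n. f y = f x"
proof -
  interpret A: elementary_graded_algebra A by fact
  interpret M: graded_module A M by fact
  interpret N: graded_module A N by fact
  let ?y = "M.hcomp x n"
  have y: "?y \<in> gpart M n" by (rule M.hcomp_gpart[OF x])
  then have yc: "?y \<in> carrier M" by (rule M.gpart_carrier)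
  have "f ?y = f x"
    using fun_cong[OF gr_hom_hcomp[OF M N f x], of n] fun_cong[OF N.hcomp_homogeneous[of "f x" n], of n] fx
    by (simp add: vpart_def)
  then have "f (idem A i \<odot>\<^bsub>M\<^esub> ?y) = f x" using gr_homD(4)[OF f yc] fx by (simp add: vpart_def)
  moreover have "idem A i \<odot>\<^bsub>M\<^esub> ?y \<in> vpart A M i n"
    using M.gpart_act[OF A.idem_deg[OF i] y] M.act_assoc[OF yc, of "idem A i" "idem A i"] A.idem_sq[OF i]
    by (simp add: vpart_def)
  ultimately show ?thesis by blast
qed

lemma gr_hom_lift_gpart:
  assumes M: "graded_module A M" and N: "graded_module A N"
    and f: "f \<in> gr_hom M N" and x: "x \<in> carrier M" and fx: "f x \<in> gpart N n"
  shows "\<exists>y \<in> gpart M n. f y = f x"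
proof -
  interpret M: graded_module A M by fact
  interpret N: graded_module A N by fact
  have "f (M.hcomp x n) = f x"
    using gr_hom_hcomp[OF M N f x] N.hcomp_homogeneous[OF fx] by metis
  then show ?thesis using M.hcomp_gpart[OF x] by blast
qed

text \<open>The inverse preserves degrees because a homogeneous element of \<open>N\<close> has a homogeneous preimage,
  which is its only one.\<close>

lemma gr_hom_inv:
  assumes M: "graded_module A M" and N: "graded_module A N"
    and f: "f \<in> gr_hom M N" and bij: "bij_betw f (carrier M) (carrier N)"
  defines "g \<equiv> restrict (inv_into (carrier M) f) (carrier N)"
  shows "g \<in> gr_hom N M" "\<And>x. x \<in> carrier M \<Longrightarrow> g (f x) = x" "\<And>y. y \<in> carrier N \<Longrightarrow> f (g y) = y"
    "bij_betw g (carrier N) (carrier M)"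
proof -
  interpret M: graded_module A M by fact
  interpret N: graded_module A N by fact
  show gf: "\<And>x. x \<in> carrier M \<Longrightarrow> g (f x) = x" and fg: "\<And>y. y \<in> carrier N \<Longrightarrow> f (g y) = y"
    using bij gr_homD(1)[OF f] by (auto simp: g_def bij_betw_inv_into_left bij_betw_inv_into_right)
  have gc: "\<And>y. y \<in> carrier N \<Longrightarrow> g y \<in> carrier M"
    using bij by (simp add: g_def bij_betw_def inv_into_into)
  show "bij_betw g (carrier N) (carrier M)"
    by (rule bij_betwI[of _ _ _ f]) (use gf fg gc gr_homD(1)[OF f] in auto)
  have inj: "x = y" if "x \<in> carrier M" "y \<in> carrier M" "f x = f y" for x y
    using gf that by metis
  show "g \<in> gr_hom N M"
  proof (rule gr_homI)
    show "g (x \<oplus>\<^bsub>N\<^esub> y) = g x \<oplus>\<^bsub>M\<^esub> g y" if "x \<in> carrier N" "y \<in> carrier N" for x y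
      by (rule inj) (use that gc fg gr_homD(3)[OF f] in auto)
    show "g (a \<odot>\<^bsub>N\<^esub> x) = a \<odot>\<^bsub>M\<^esub> g x" if "x \<in> carrier N" for x a
      by (rule inj) (use that gc fg gr_homD(4)[OF f] in \<open>auto simp: M.act_closed N.act_closed\<close>)
    show "g x \<in> gpart M n" if x: "x \<in> gpart N n" for x n
    proof -
      have xc: "x \<in> carrier N" using x by (rule N.gpart_carrier)
      obtain y where "y \<in> gpart M n" "f y = x"
        using gr_hom_lift_gpart[OF M N f gc[OF xc], of n] fg[OF xc] x by auto
      then show ?thesis using gf M.gpart_carrier by metis
    qed
  qed (use gc g_def in auto)
qed

lemma is_iso_in_GrMod:
  assumes M: "graded_module A M" and N: "graded_module A N"
  shows "is_iso_in (GrMod A) M N f \<longleftrightarrow> f \<in> gr_hom M N \<and> bij_betw f (carrier M) (carrier N)"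
proof
  assume "is_iso_in (GrMod A) M N f"
  then obtain g where f: "f \<in> gr_hom M N" and g: "g \<in> gr_hom N M"
    and gf: "compose (carrier M) g f = (\<lambda>x\<in>carrier M. x)" and fg: "compose (carrier N) f g = (\<lambda>x\<in>carrier N. x)"
    unfolding is_iso_in_def by auto
  have "g (f x) = x" if "x \<in> carrier M" for x
    using fun_cong[OF gf, of x] that by (simp add: compose_def)
  moreover have "f (g x) = x" if "x \<in> carrier N" for x
    using fun_cong[OF fg, of x] that by (simp add: compose_def)
  ultimately have "bij_betw f (carrier M) (carrier N)"
    by (intro bij_betwI[of _ _ _ g]) (use gr_homD(1)[OF f] gr_homD(1)[OF g] in auto)
  with f show "f \<in> gr_hom M N \<and> bij_betw f (carrier M) (carrier N)" by simp
next
  assume f: "f \<in> gr_hom M N \<and> bij_betw f (carrier M) (carrier N)"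
  then have f1: "f \<in> gr_hom M N" and f2: "bij_betw f (carrier M) (carrier N)" by simp_all
  note g = gr_hom_inv[OF M N f1 f2]
  let ?g = "restrict (inv_into (carrier M) f) (carrier N)"
  have "compose (carrier M) ?g f = (\<lambda>x\<in>carrier M. x)" "compose (carrier N) f ?g = (\<lambda>x\<in>carrier N. x)"
    unfolding compose_def by (rule restrict_ext; use g in simp)+
  then show "is_iso_in (GrMod A) M N f"
    unfolding is_iso_in_def using f1 g(1) by auto
qed

section \<open>Shifts, copies and bottom quotients of graded modules\<close>

lemma shift_simps [simp]:
  "carrier (shift m M) = carrier M" "add (shift m M) = add M" "zero (shift m M) = zero M"
  "smult (shift m M) = smult M" "gpart (shift m M) n = gpart M (n - m)"
  "finsum (shift m M) = finsum M" "a_inv (shift m M) = a_inv M"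
  by (simp_all add: shift_def finsum_def fun_eq_iff a_inv_def)

lemma shift_shift [simp]: "shift m (shift n M) = shift (m + n) M" and shift_zero [simp]: "shift 0 M = M"
  by (simp_all add: shift_def algebra_simps)

lemma gr_hom_shift [simp]: "gr_hom (shift m M) (shift m N) = gr_hom M N"
proof -
  have "(\<forall>n. f ` gpart M (n - m) \<subseteq> gpart N (n - m)) \<longleftrightarrow> (\<forall>n. f ` gpart M n \<subseteq> gpart N n)" for f
    by (metis add_diff_cancel_right')
  then show ?thesis unfolding gr_hom_def mod_hom_def by simp
qed

lemma vpart_shift [simp]: "vpart A (shift m M) i n = vpart A M i (n - m)"
  by (simp add: vpart_def)

lemma left_module_cong:
  fixes M N :: "('a :: {ring, monoid_mult}, 'm) gmodule"
  assumes "left_module M" "carrier N = carrier M" "add N = add M" "zero N = zero M" "smult N = smult M"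
  shows "left_module N"
  using assms unfolding left_module_def left_module_axioms_def abelian_group_def abelian_monoid_def
    abelian_group_axioms_def by simp

lemma graded_module_shift:
  assumes "graded_module A M"
  shows "graded_module A (shift m M)"
proof -
  interpret M: graded_module A M by fact
  interpret N: left_module "shift m M" by (rule left_module_cong[OF M.left_module_axioms]) simp_all
  show ?thesis
  proof (intro graded_module.intro graded_module_axioms.intro N.left_module_axioms)
    show "additive_subgroup (gpart (shift m M) n) (shift m M)" for n
      using M.gpart_subgroup[of "n - m"] unfolding additive_subgroup_def by simp
    show "a \<odot>\<^bsub>shift m M\<^esub> x \<in> gpart (shift m M) (int i + n)"
      if "a \<in> deg A i" "x \<in> gpart (shift m M) n" for a i x n
      using M.gpart_act[of a i x "n - m"] that by (simp add: algebra_simps)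
    fix x assume "x \<in> carrier (shift m M)"
    then have x: "x \<in> carrier M" by simp
    let ?D = "\<lambda>f x. (\<forall>n. f n \<in> gpart M (n - m)) \<and> finite {n. f n \<noteq> \<zero>\<^bsub>M\<^esub>} \<and> x = (\<Oplus>\<^bsub>M\<^esub>n\<in>{n. f n \<noteq> \<zero>\<^bsub>M\<^esub>}. f n)"
    have "M.hcomp x = (\<lambda>n. f (n + m))" if "?D f x" for f
    proof (rule M.hcomp_eqI)
      let ?K = "(\<lambda>n. n - m) ` {n. f n \<noteq> \<zero>\<^bsub>M\<^esub>}"
      show "finite ?K" using that by simp
      show "f (k + m) \<in> gpart M k" for k using that by (metis add_diff_cancel_right')
      then have c: "f (k + m) \<in> carrier M" for k using M.gpart_carrier by blast
      show "f (k + m) = \<zero>\<^bsub>M\<^esub>" if "k \<notin> ?K" for k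
      proof (rule ccontr)
        assume "f (k + m) \<noteq> \<zero>\<^bsub>M\<^esub>"
        then have "k + m - m \<in> ?K" by blast
        then show False using that by simp
      qed
      have "(\<Oplus>\<^bsub>M\<^esub>k\<in>?K. f (k + m)) = (\<Oplus>\<^bsub>M\<^esub>n\<in>{n. f n \<noteq> \<zero>\<^bsub>M\<^esub>}. f (n - m + m))"
        using c by (intro M.add.finprod_reindex) (auto simp: inj_on_def)
      then show "x = (\<Oplus>\<^bsub>M\<^esub>k\<in>?K. f (k + m))" using that by simp
    qed
    moreover have "?D (\<lambda>n. M.hcomp x (n - m)) x"
    proof (intro conjI allI)
      show "M.hcomp x (n - m) \<in> gpart M (n - m)" for n by (rule M.hcomp_gpart[OF x])
      then have c: "M.hcomp x (n - m) \<in> carrier M" for n using M.gpart_carrier by blast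
      have eq: "{n. M.hcomp x (n - m) \<noteq> \<zero>\<^bsub>M\<^esub>} = (\<lambda>n. n + m) ` {n. M.hcomp x n \<noteq> \<zero>\<^bsub>M\<^esub>}"
        by (auto simp: image_iff) (metis diff_add_cancel)
      show "finite {n. M.hcomp x (n - m) \<noteq> \<zero>\<^bsub>M\<^esub>}" unfolding eq by (intro finite_imageI M.hcomp_finite[OF x])
      have "(\<Oplus>\<^bsub>M\<^esub>n\<in>{n. M.hcomp x (n - m) \<noteq> \<zero>\<^bsub>M\<^esub>}. M.hcomp x (n - m)) =
          (\<Oplus>\<^bsub>M\<^esub>n\<in>{n. M.hcomp x n \<noteq> \<zero>\<^bsub>M\<^esub>}. M.hcomp x (n + m - m))"
        unfolding eq using c by (intro M.add.finprod_reindex) (auto simp: inj_on_def)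
      then show "x = (\<Oplus>\<^bsub>M\<^esub>n\<in>{n. M.hcomp x (n - m) \<noteq> \<zero>\<^bsub>M\<^esub>}. M.hcomp x (n - m))"
        using M.hcomp_finsum[OF x] by simp
    qed
    ultimately have "\<exists>!f. ?D f x"
    proof (intro ex1I)
      fix f assume f: "?D f x" and *: "\<And>f. ?D f x \<Longrightarrow> M.hcomp x = (\<lambda>n. f (n + m))"
      show "f = (\<lambda>n. M.hcomp x (n - m))" using *[OF f] by (simp add: fun_eq_iff)
    qed
    then show "\<exists>!f. (\<forall>n. f n \<in> gpart (shift m M) n) \<and> finite {n. f n \<noteq> \<zero>\<^bsub>shift m M\<^esub>} \<and>
          x = (\<Oplus>\<^bsub>shift m M\<^esub>n\<in>{n. f n \<noteq> \<zero>\<^bsub>shift m M\<^esub>}. f n)"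
      by simp
  qed
qed

text \<open>Transport of structure along an injection. It serves to put the modules \<open>A e\<^sub>i\<close>, whose
  carriers lie in the type of the algebra, into the universe of the objects of \<^const>\<open>GrMod\<close>.\<close>

definition copy :: "('m \<Rightarrow> 'u) \<Rightarrow> ('a, 'm) gmodule \<Rightarrow> ('a, 'u) gmodule" where
  "copy h M = (let g = inv_into (carrier M) h in
     \<lparr>carrier = h ` carrier M, mult = undefined, one = undefined, zero = h \<zero>\<^bsub>M\<^esub>,
      add = (\<lambda>x y. h (g x \<oplus>\<^bsub>M\<^esub> g y)), smult = (\<lambda>a x. h (a \<odot>\<^bsub>M\<^esub> g x)),
      gpart = (\<lambda>n. h ` gpart M n)\<rparr>)"

lemma graded_module_copy:
  assumes M: "graded_module A M" and h: "inj_on h (carrier M)"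
  shows "graded_module A (copy h M)" "restrict h (carrier M) \<in> gr_hom M (copy h M)"
    "bij_betw (restrict h (carrier M)) (carrier M) (carrier (copy h M))"
proof -
  interpret M: graded_module A M by fact
  let ?N = "copy h M"
  have inv: "inv_into (carrier M) h (h x) = x" if "x \<in> carrier M" for x
    using h that by (rule inv_into_f_f)
  have N: "carrier ?N = h ` carrier M" "\<zero>\<^bsub>?N\<^esub> = h \<zero>\<^bsub>M\<^esub>" "gpart ?N n = h ` gpart M n"
    "x \<in> carrier M \<Longrightarrow> y \<in> carrier M \<Longrightarrow> h x \<oplus>\<^bsub>?N\<^esub> h y = h (x \<oplus>\<^bsub>M\<^esub> y)"
    "x \<in> carrier M \<Longrightarrow> a \<odot>\<^bsub>?N\<^esub> h x = h (a \<odot>\<^bsub>M\<^esub> x)" for x y a n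
    by (simp_all add: copy_def Let_def inv)
  have inj: "h x = h y \<longleftrightarrow> x = y" if "x \<in> carrier M" "y \<in> carrier M" for x y
    using h that by (auto simp: inj_on_def)
  interpret N: abelian_group ?N
  proof (rule abelian_groupI)
    fix x y z assume "x \<in> carrier ?N" "y \<in> carrier ?N" "z \<in> carrier ?N"
    then show "x \<oplus>\<^bsub>?N\<^esub> y \<oplus>\<^bsub>?N\<^esub> z = x \<oplus>\<^bsub>?N\<^esub> (y \<oplus>\<^bsub>?N\<^esub> z)" by (auto simp: N M.a_assoc)
  next
    fix x y assume "x \<in> carrier ?N" "y \<in> carrier ?N"
    then show "x \<oplus>\<^bsub>?N\<^esub> y = y \<oplus>\<^bsub>?N\<^esub> x" by (auto simp: N M.a_comm)
  next
    fix x assume "x \<in> carrier ?N"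
    then obtain u where u: "u \<in> carrier M" "x = h u" by (auto simp: N)
    show "\<exists>y\<in>carrier ?N. y \<oplus>\<^bsub>?N\<^esub> x = \<zero>\<^bsub>?N\<^esub>"
      by (rule bexI[of _ "h (\<ominus>\<^bsub>M\<^esub> u)"]) (use u in \<open>auto simp: N M.l_neg\<close>)
  qed (auto simp: N)
  interpret N: left_module ?N
    by unfold_locales (auto simp: N M.act_closed M.act_add_left M.act_add_right M.act_assoc M.act_one)
  have finsum: "(\<Oplus>\<^bsub>?N\<^esub>n\<in>K. h (f n)) = h (\<Oplus>\<^bsub>M\<^esub>n\<in>K. f n)"
    if "finite K" "\<And>n. f n \<in> carrier M" for K :: "int set" and f
    using that(1)
  proof (induction K)
    case (insert n K)
    have "(\<Oplus>\<^bsub>?N\<^esub>n\<in>insert n K. h (f n)) = h (f n) \<oplus>\<^bsub>?N\<^esub> (\<Oplus>\<^bsub>?N\<^esub>n\<in>K. h (f n))"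
      using that(2) insert by (intro N.finsum_insert) (auto simp: N)
    moreover have "(\<Oplus>\<^bsub>M\<^esub>n\<in>insert n K. f n) = f n \<oplus>\<^bsub>M\<^esub> (\<Oplus>\<^bsub>M\<^esub>n\<in>K. f n)"
      using that(2) insert by (intro M.finsum_insert) auto
    moreover have "(\<Oplus>\<^bsub>M\<^esub>n\<in>K. f n) \<in> carrier M" using that(2) by (intro M.finsum_closed) auto
    ultimately show ?case using insert that(2) by (simp add: N)
  qed (simp add: N)
  show "graded_module A ?N"
  proof (intro graded_module.intro graded_module_axioms.intro N.left_module_axioms)
    show "additive_subgroup (gpart ?N n) ?N" for n
    proof (rule additive_subgroup.intro, rule N.add.subgroupI)
      show "gpart ?N n \<subseteq> carrier ?N" using M.gpart_carrier by (auto simp: N)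
      show "gpart ?N n \<noteq> {}" using M.gpart_zero by (auto simp: N)
      fix x assume "x \<in> gpart ?N n"
      then obtain u where u: "u \<in> gpart M n" "x = h u" by (auto simp: N)
      note uc = M.gpart_carrier[OF u(1)]
      have "\<ominus>\<^bsub>?N\<^esub> x = h (\<ominus>\<^bsub>M\<^esub> u)"
        by (rule N.minus_equality) (use u uc in \<open>auto simp: N M.l_neg\<close>)
      moreover have "\<ominus>\<^bsub>M\<^esub> u \<in> gpart M n"
        using additive_subgroup.a_inv_closed[OF M.gpart_subgroup u(1)] .
      ultimately show "\<ominus>\<^bsub>?N\<^esub> x \<in> gpart ?N n" by (auto simp: N)
      fix y assume "y \<in> gpart ?N n"
      with u uc show "x \<oplus>\<^bsub>?N\<^esub> y \<in> gpart ?N n"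
        using M.gpart_carrier M.gpart_add by (auto simp: N)
    qed
    show "a \<odot>\<^bsub>?N\<^esub> x \<in> gpart ?N (int i + n)" if "a \<in> deg A i" "x \<in> gpart ?N n" for a i x n
      using that M.gpart_act M.gpart_carrier by (auto simp: N)
    fix x' assume "x' \<in> carrier ?N"
    then obtain x where x: "x \<in> carrier M" "x' = h x" by (auto simp: N)
    have hc: "M.hcomp x n \<in> carrier M" for n using M.hcomp_gpart[OF x(1)] M.gpart_carrier by blast
    show "\<exists>!f. (\<forall>n. f n \<in> gpart ?N n) \<and> finite {n. f n \<noteq> \<zero>\<^bsub>?N\<^esub>} \<and>
        x' = (\<Oplus>\<^bsub>?N\<^esub>n\<in>{n. f n \<noteq> \<zero>\<^bsub>?N\<^esub>}. f n)"
    proof (rule ex1I[of _ "\<lambda>n. h (M.hcomp x n)"], intro conjI allI)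
      show "h (M.hcomp x n) \<in> gpart ?N n" for n using M.hcomp_gpart[OF x(1)] by (simp add: N)
      have eq: "{n. h (M.hcomp x n) \<noteq> \<zero>\<^bsub>?N\<^esub>} = {n. M.hcomp x n \<noteq> \<zero>\<^bsub>M\<^esub>}" using hc by (simp add: N inj)
      show "finite {n. h (M.hcomp x n) \<noteq> \<zero>\<^bsub>?N\<^esub>}" unfolding eq by (rule M.hcomp_finite[OF x(1)])
      show "x' = (\<Oplus>\<^bsub>?N\<^esub>n\<in>{n. h (M.hcomp x n) \<noteq> \<zero>\<^bsub>?N\<^esub>}. h (M.hcomp x n))"
        unfolding eq finsum[OF M.hcomp_finite[OF x(1)] hc] M.hcomp_finsum[OF x(1)] by (rule x(2))
    next
      fix f assume f: "(\<forall>n. f n \<in> gpart ?N n) \<and> finite {n. f n \<noteq> \<zero>\<^bsub>?N\<^esub>} \<and>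
        x' = (\<Oplus>\<^bsub>?N\<^esub>n\<in>{n. f n \<noteq> \<zero>\<^bsub>?N\<^esub>}. f n)"
      then have "\<forall>n. \<exists>u. u \<in> gpart M n \<and> f n = h u" by (auto simp: N)
      then obtain g where g: "\<And>n. g n \<in> gpart M n" "\<And>n. f n = h (g n)" by metis
      then have fg: "f = (\<lambda>n. h (g n))" by auto
      have gc: "g n \<in> carrier M" for n using g M.gpart_carrier by blast
      have eq: "{n. f n \<noteq> \<zero>\<^bsub>?N\<^esub>} = {n. g n \<noteq> \<zero>\<^bsub>M\<^esub>}" using gc by (simp add: N inj g(2))
      have fin: "finite {n. g n \<noteq> \<zero>\<^bsub>M\<^esub>}" and "x' = (\<Oplus>\<^bsub>?N\<^esub>n\<in>{n. g n \<noteq> \<zero>\<^bsub>M\<^esub>}. h (g n))"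
        using f unfolding eq by (simp_all add: fg)
      then have "h x = h (\<Oplus>\<^bsub>M\<^esub>n\<in>{n. g n \<noteq> \<zero>\<^bsub>M\<^esub>}. g n)" unfolding finsum[OF fin gc] using x by simp
      then have "x = (\<Oplus>\<^bsub>M\<^esub>n\<in>{n. g n \<noteq> \<zero>\<^bsub>M\<^esub>}. g n)"
        using x(1) gc by (subst (asm) inj) (auto intro: M.finsum_closed)
      from M.hcomp_eqI[OF fin g(1) _ this] show "f = (\<lambda>n. h (M.hcomp x n))" by (simp add: fg)
    qed
  qed
  show "restrict h (carrier M) \<in> gr_hom M ?N"
    by (rule gr_homI) (auto simp: N M.act_closed M.gpart_carrier)
  show "bij_betw (restrict h (carrier M)) (carrier M) (carrier ?N)"
    using h by (simp add: bij_betw_def N inj_on_def)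
qed

text \<open>For a graded module without negative degrees, the quotient by everything of positive
  degree, realised on the degree-zero component.\<close>

definition bottom_module :: "('a :: {ring, monoid_mult}, 'm) gmodule \<Rightarrow> ('a, 'm) gmodule" where
  "bottom_module M = M\<lparr>carrier := gpart M 0, smult := (\<lambda>a x. graded_module.hcomp M (a \<odot>\<^bsub>M\<^esub> x) 0),
     gpart := (\<lambda>n. if n = 0 then gpart M 0 else {\<zero>\<^bsub>M\<^esub>})\<rparr>"

lemma (in graded_module) hcomp_act:
  assumes a: "a \<in> deg A m" and x: "x \<in> carrier M"
  shows "hcomp (a \<odot> x) (int m + n) = a \<odot> hcomp x n"
proof -
  have c: "hcomp x k \<in> carrier M" for k using hcomp_gpart[OF x] gpart_carrier by blast
  have "hcomp (a \<odot> x) = (\<lambda>k. a \<odot> hcomp x (k - int m))"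
  proof (rule hcomp_eqI)
    let ?K = "(\<lambda>n. int m + n) ` {n. hcomp x n \<noteq> \<zero>}"
    show "finite ?K" using hcomp_finite[OF x] by simp
    show "a \<odot> hcomp x (k - int m) \<in> gpart M k" for k
      using gpart_act[OF a hcomp_gpart[OF x], of "k - int m"] by simp
    show "a \<odot> hcomp x (k - int m) = \<zero>" if "k \<notin> ?K" for k
    proof -
      have "hcomp x (k - int m) = \<zero>"
      proof (rule ccontr)
        assume "hcomp x (k - int m) \<noteq> \<zero>"
        then have "int m + (k - int m) \<in> ?K" by blast
        then show False using that by simp
      qed
      then show ?thesis by (simp add: act_zero_right)
    qed
    have "(\<Oplus>k\<in>?K. a \<odot> hcomp x (k - int m)) = (\<Oplus>n\<in>{n. hcomp x n \<noteq> \<zero>}. a \<odot> hcomp x (int m + n - int m))"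
      using c act_closed by (intro add.finprod_reindex) (auto simp: inj_on_def)
    also have "\<dots> = (\<Oplus>n\<in>{n. hcomp x n \<noteq> \<zero>}. a \<odot> hcomp x n)" by simp
    also have "\<dots> = a \<odot> (\<Oplus>n\<in>{n. hcomp x n \<noteq> \<zero>}. hcomp x n)"
    proof -
      have "(\<Oplus>n\<in>K. a \<odot> hcomp x n) = a \<odot> (\<Oplus>n\<in>K. hcomp x n)" if "finite K" for K
        using that
      proof (induction K)
        case (insert n K)
        have "(\<Oplus>n\<in>insert n K. a \<odot> hcomp x n) = a \<odot> hcomp x n \<oplus> (\<Oplus>n\<in>K. a \<odot> hcomp x n)"
          using c act_closed insert by (intro finsum_insert) auto
        moreover have "(\<Oplus>n\<in>insert n K. hcomp x n) = hcomp x n \<oplus> (\<Oplus>n\<in>K. hcomp x n)"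
          using c insert by (intro finsum_insert) auto
        moreover have "(\<Oplus>n\<in>K. hcomp x n) \<in> carrier M" using c by (intro finsum_closed) auto
        ultimately show ?case using insert c by (simp add: act_add_right)
      qed (simp add: act_zero_right)
      then show ?thesis using hcomp_finite[OF x] by blast
    qed
    also have "\<dots> = a \<odot> x" by (simp add: hcomp_finsum[OF x])
    finally show "a \<odot> x = (\<Oplus>k\<in>?K. a \<odot> hcomp x (k - int m))" by simp
  qed
  then show ?thesis by simp
qed

lemma graded_module_bottom:
  assumes A: "elementary_graded_algebra A" and M: "graded_module A M"
    and neg: "\<And>n. n < 0 \<Longrightarrow> gpart M n \<subseteq> {\<zero>\<^bsub>M\<^esub>}"
  shows "graded_module A (bottom_module M)"
proof -
  interpret A: elementary_graded_algebra A by fact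
  interpret M: graded_module A M by fact
  let ?N = "bottom_module M"
  have N: "carrier ?N = gpart M 0" "\<zero>\<^bsub>?N\<^esub> = \<zero>\<^bsub>M\<^esub>" "add ?N = add M"
    "a \<odot>\<^bsub>?N\<^esub> x = M.hcomp (a \<odot>\<^bsub>M\<^esub> x) 0" "gpart ?N n = (if n = 0 then gpart M 0 else {\<zero>\<^bsub>M\<^esub>})" for a x n
    by (simp_all add: bottom_module_def)
  have c: "x \<in> carrier M" if "x \<in> gpart M 0" for x using that by (rule M.gpart_carrier)
  have minus: "\<ominus>\<^bsub>M\<^esub> x \<in> gpart M n" if "x \<in> gpart M n" for x n
    using additive_subgroup.a_inv_closed[OF M.gpart_subgroup that] .
  have h0: "M.hcomp x 0 = x" if "x \<in> gpart M 0" for x using M.hcomp_homogeneous[OF that] by simp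
  have hneg: "M.hcomp x n = \<zero>\<^bsub>M\<^esub>" if "x \<in> carrier M" "n < 0" for x n
    using M.hcomp_gpart[OF that(1)] neg[OF that(2)] by blast
  \<comment> \<open>In the absence of negative degrees, the components of \<open>x\<close> in positive degrees do not contribute to the
    component of \<open>a x\<close> in degree zero. This is what associativity of the new action needs.\<close>
  have key: "M.hcomp (a \<odot>\<^bsub>M\<^esub> x) 0 = M.hcomp (a \<odot>\<^bsub>M\<^esub> M.hcomp x 0) 0" if x: "x \<in> carrier M" for a x
  proof -
    have y: "M.hcomp x 0 \<in> carrier M" using M.hcomp_gpart[OF x] c by blast
    show ?thesis
    proof (induction a rule: A.homogeneous_induct)
      case zero
      then show ?case using x y by (simp add: M.act_zero_left)
    next
      case (add a b)
      then show ?case using x y by (simp add: M.act_add_left M.hcomp_add M.act_closed)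
    next
      case (homogeneous m a)
      show ?case
        using M.hcomp_act[OF homogeneous x, of "- int m"] M.hcomp_act[OF homogeneous y, of "- int m"]
          hneg[OF x, of "- int m"] hneg[OF y, of "- int m"] h0[OF M.hcomp_gpart[OF x]]
        by (cases "m = 0") auto
    qed
  qed
  interpret N: abelian_group ?N
  proof (rule abelian_groupI)
    fix x assume "x \<in> carrier ?N"
    then show "\<exists>y\<in>carrier ?N. y \<oplus>\<^bsub>?N\<^esub> x = \<zero>\<^bsub>?N\<^esub>"
      using minus c by (intro bexI[of _ "\<ominus>\<^bsub>M\<^esub> x"]) (auto simp: N M.l_neg)
  next
    fix x y assume "x \<in> carrier ?N" "y \<in> carrier ?N"
    then show "x \<oplus>\<^bsub>?N\<^esub> y = y \<oplus>\<^bsub>?N\<^esub> x" using c by (simp add: N M.a_comm)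
  qed (auto simp: N M.gpart_add M.gpart_zero M.a_assoc c)
  interpret N: left_module ?N
  proof
    fix a b x assume "x \<in> carrier ?N"
    then have x: "x \<in> gpart M 0" by (simp add: N)
    show "a \<odot>\<^bsub>?N\<^esub> x \<in> carrier ?N" using x by (simp add: N M.hcomp_gpart M.act_closed c)
    show "(a + b) \<odot>\<^bsub>?N\<^esub> x = a \<odot>\<^bsub>?N\<^esub> x \<oplus>\<^bsub>?N\<^esub> b \<odot>\<^bsub>?N\<^esub> x"
      using x by (simp add: N M.act_add_left M.hcomp_add M.act_closed c)
    show "(a * b) \<odot>\<^bsub>?N\<^esub> x = a \<odot>\<^bsub>?N\<^esub> (b \<odot>\<^bsub>?N\<^esub> x)"
      using key[of "b \<odot>\<^bsub>M\<^esub> x" a] x by (simp add: N M.act_assoc M.act_closed c)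
    show "1 \<odot>\<^bsub>?N\<^esub> x = x" using x by (simp add: N M.act_one c h0)
  next
    fix a x y assume "x \<in> carrier ?N" "y \<in> carrier ?N"
    then show "a \<odot>\<^bsub>?N\<^esub> (x \<oplus>\<^bsub>?N\<^esub> y) = a \<odot>\<^bsub>?N\<^esub> x \<oplus>\<^bsub>?N\<^esub> a \<odot>\<^bsub>?N\<^esub> y"
      by (simp add: N M.act_add_right M.hcomp_add M.act_closed c)
  qed
  show ?thesis
  proof (intro graded_module.intro graded_module_axioms.intro N.left_module_axioms)
    show "additive_subgroup (gpart ?N n) ?N" for n
    proof (rule additive_subgroup.intro, rule N.add.subgroupI)
      fix x assume x: "x \<in> gpart ?N n"
      then have "x \<in> gpart M 0" using M.gpart_zero by (auto simp: N split: if_splits)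
      then have "\<ominus>\<^bsub>?N\<^esub> x = \<ominus>\<^bsub>M\<^esub> x"
        using minus c by (intro N.minus_equality) (auto simp: N M.l_neg)
      then show "\<ominus>\<^bsub>?N\<^esub> x \<in> gpart ?N n" using x minus by (auto simp: N split: if_splits)
    next
      show "gpart ?N n \<noteq> {}" using M.gpart_zero[of 0] by (auto simp: N)
    qed (use M.gpart_zero M.gpart_add in \<open>auto simp: N split: if_splits\<close>)
    show "a \<odot>\<^bsub>?N\<^esub> x \<in> gpart ?N (int i + n)" if a: "a \<in> deg A i" and x: "x \<in> gpart ?N n" for a i x n
    proof -
      have x0: "x \<in> gpart M 0" using x M.gpart_zero by (auto simp: N split: if_splits)
      have "M.hcomp (a \<odot>\<^bsub>M\<^esub> x) 0 = (if i = 0 then a \<odot>\<^bsub>M\<^esub> x else \<zero>\<^bsub>M\<^esub>)"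
        using M.hcomp_homogeneous[OF M.gpart_act[OF a x0]] by auto
      moreover have "a \<odot>\<^bsub>M\<^esub> x \<in> gpart M 0" if "i = 0" using M.gpart_act[OF a x0] that by simp
      moreover have "a \<odot>\<^bsub>M\<^esub> x = \<zero>\<^bsub>M\<^esub>" if "n \<noteq> 0" using x that by (simp add: N M.act_zero_right)
      ultimately show ?thesis using M.gpart_zero by (auto simp: N)
    qed
    fix x assume "x \<in> carrier ?N"
    then have x: "x \<in> gpart M 0" by (simp add: N)
    show "\<exists>!f. (\<forall>n. f n \<in> gpart ?N n) \<and> finite {n. f n \<noteq> \<zero>\<^bsub>?N\<^esub>} \<and>
        x = (\<Oplus>\<^bsub>?N\<^esub>n\<in>{n. f n \<noteq> \<zero>\<^bsub>?N\<^esub>}. f n)"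
    proof (rule ex1I[of _ "\<lambda>n. if n = 0 then x else \<zero>\<^bsub>M\<^esub>"])
      have "{n :: int. (if n = 0 then x else \<zero>\<^bsub>M\<^esub>) \<noteq> \<zero>\<^bsub>M\<^esub>} = (if x = \<zero>\<^bsub>M\<^esub> then {} else {0})" by auto
      then show "(\<forall>n. (if n = 0 then x else \<zero>\<^bsub>M\<^esub>) \<in> gpart ?N n) \<and>
          finite {n::int. (if n = 0 then x else \<zero>\<^bsub>M\<^esub>) \<noteq> \<zero>\<^bsub>?N\<^esub>} \<and>
          x = (\<Oplus>\<^bsub>?N\<^esub>n\<in>{n. (if n = 0 then x else \<zero>\<^bsub>M\<^esub>) \<noteq> \<zero>\<^bsub>?N\<^esub>}. (if n = 0 then x else \<zero>\<^bsub>M\<^esub>))"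
        using x c[OF x] by (auto simp: N)
    next
      fix f assume f: "(\<forall>n. f n \<in> gpart ?N n) \<and> finite {n. f n \<noteq> \<zero>\<^bsub>?N\<^esub>} \<and>
        x = (\<Oplus>\<^bsub>?N\<^esub>n\<in>{n. f n \<noteq> \<zero>\<^bsub>?N\<^esub>}. f n)"
      then have fn: "f n \<in> gpart ?N n" for n by blast
      have f0: "f n = \<zero>\<^bsub>M\<^esub>" if "n \<noteq> 0" for n using fn[of n] that by (simp add: N)
      have f1: "f 0 \<in> gpart M 0" using fn[of 0] by (simp add: N)
      have "{n. f n \<noteq> \<zero>\<^bsub>?N\<^esub>} = (if f 0 = \<zero>\<^bsub>M\<^esub> then {} else {0})"
        using f0 by (simp add: N set_eq_iff) metis
      then have "x = f 0" using f f1 c[OF f1] by (auto simp: N split: if_splits)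
      then show "f = (\<lambda>n. if n = 0 then x else \<zero>\<^bsub>M\<^esub>)" using f0 by auto
    qed
  qed
qed

section \<open>Vertex generators\<close>

text \<open>\<open>P\<close> is a copy of \<open>A e\<^sub>i\<langle>n\<rangle>\<close>, with \<open>p\<close> in the place of \<open>e\<^sub>i\<close>. The last condition says that \<open>p\<close> satisfies no
  relations other than those that follow from \<open>e\<^sub>i p = p\<close>.\<close>

definition vertex_generator ::
  "('k :: field, 'a :: {ring, monoid_mult}) graded_algebra \<Rightarrow> ('a, 'm) gmodule \<Rightarrow> nat \<Rightarrow> int \<Rightarrow> 'm \<Rightarrow> bool"
where
  "vertex_generator A P i n p \<longleftrightarrow> graded_module A P \<and> p \<in> vpart A P i n \<and>
     (\<forall>x \<in> carrier P. \<exists>a. x = a \<odot>\<^bsub>P\<^esub> p) \<and>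
     (\<forall>k. \<forall>x \<in> gpart P k. x = \<zero>\<^bsub>P\<^esub> \<or> (n \<le> k \<and> (\<exists>a \<in> deg A (nat (k - n)). x = a \<odot>\<^bsub>P\<^esub> p))) \<and>
     (\<forall>a. a \<odot>\<^bsub>P\<^esub> p = \<zero>\<^bsub>P\<^esub> \<longrightarrow> a * idem A i = 0)"

lemma vpartD:
  assumes "x \<in> vpart A M i n"
  shows "x \<in> gpart M n" "idem A i \<odot>\<^bsub>M\<^esub> x = x" "graded_module A M \<Longrightarrow> x \<in> carrier M"
  using assms graded_module.gpart_carrier[of A M x n] by (simp_all add: vpart_def)

lemma vpartI: "x \<in> gpart M n \<Longrightarrow> idem A i \<odot>\<^bsub>M\<^esub> x = x \<Longrightarrow> x \<in> vpart A M i n"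
  by (simp add: vpart_def)

lemma gr_hom_vpart:
  assumes "graded_module A M" "f \<in> gr_hom M N" "x \<in> vpart A M i n"
  shows "f x \<in> vpart A N i n"
  using gr_homD(4)[OF assms(2) vpartD(3)[OF assms(3,1)], of "idem A i"] gr_homD(5)[OF assms(2) vpartD(1)[OF assms(3)]]
    vpartD(2)[OF assms(3)] by (simp add: vpart_def)

lemma (in graded_module) zero_vpart: "\<zero> \<in> vpart A M i n"
  by (rule vpartI) (simp_all add: gpart_zero act_zero_right)

lemma (in graded_module) add_vpart: "x \<in> vpart A M i n \<Longrightarrow> y \<in> vpart A M i n \<Longrightarrow> x \<oplus> y \<in> vpart A M i n"
  using gpart_add[of x n y] gpart_carrier[of x n] gpart_carrier[of y n] by (simp add: vpart_def act_add_right)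

lemma (in graded_module) act_vpart:
  assumes A: "elementary_graded_algebra A" and i: "i < rk A"
    and a: "a \<in> deg A m" "idem A i * a = a" and x: "x \<in> gpart M n"
  shows "a \<odot> x \<in> vpart A M i (int m + n)"
  using gpart_act[OF a(1) x] act_assoc[OF gpart_carrier[OF x], of "idem A i" a] a(2)
  by (simp add: vpart_def)

lemma (in graded_module) scal_vpart:
  assumes A: "elementary_graded_algebra A" and x: "x \<in> vpart A M i n"
  shows "scal A c 1 \<odot> x \<in> vpart A M i n"
proof -
  interpret A: elementary_graded_algebra A by fact
  have xc: "x \<in> carrier M" using x gpart_carrier[of x n] by (simp add: vpart_def)
  have "idem A i \<odot> (scal A c 1 \<odot> x) = scal A c 1 \<odot> (idem A i \<odot> x)"
    using act_assoc[OF xc, of "idem A i" "scal A c 1"] act_assoc[OF xc, of "scal A c 1" "idem A i"]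
    by (simp add: A.scal_one_mult A.mult_scal_one)
  then show ?thesis using gpart_act[OF A.scal_one_deg, of x n c] x by (simp add: vpart_def)
qed

lemma vertex_generatorD:
  assumes "vertex_generator A P i n p"
  shows "graded_module A P" "p \<in> vpart A P i n" "p \<in> carrier P"
    "x \<in> carrier P \<Longrightarrow> \<exists>a. x = a \<odot>\<^bsub>P\<^esub> p"
    "x \<in> gpart P k \<Longrightarrow> x = \<zero>\<^bsub>P\<^esub> \<or> (n \<le> k \<and> (\<exists>a \<in> deg A (nat (k - n)). x = a \<odot>\<^bsub>P\<^esub> p))"
    "a \<odot>\<^bsub>P\<^esub> p = \<zero>\<^bsub>P\<^esub> \<Longrightarrow> a * idem A i = 0"
  using assms vpartD(3)[of p A P i n] by (simp_all add: vertex_generator_def)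

lemma vertex_generator_nonzero:
  assumes A: "elementary_graded_algebra A" and P: "vertex_generator A P i n p" and i: "i < rk A"
  shows "p \<noteq> \<zero>\<^bsub>P\<^esub>"
proof
  interpret A: elementary_graded_algebra A by fact
  interpret P: graded_module A P using vertex_generatorD(1)[OF P] .
  assume "p = \<zero>\<^bsub>P\<^esub>"
  then have "1 \<odot>\<^bsub>P\<^esub> p = \<zero>\<^bsub>P\<^esub>" using P.act_one by simp
  then show False using vertex_generatorD(6)[OF P] A.idem_nonzero[OF i] by fastforce
qed

text \<open>The Yoneda lemma, \<open>Hom(A e\<^sub>i\<langle>n\<rangle>, M) = e\<^sub>i M\<^sub>n\<close>: the assignment \<open>a p \<mapsto> a y\<close> is well defined, because
  \<open>a p = 0\<close> implies \<open>a e\<^sub>i = 0\<close> and so \<open>a y = a e\<^sub>i y = 0\<close>.\<close>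

lemma vertex_generator_hom:
  assumes P: "vertex_generator A P i n p" and M: "graded_module A M" and y: "y \<in> vpart A M i n"
  shows "\<exists>\<phi> \<in> gr_hom P M. \<phi> p = y"
proof -
  interpret P: graded_module A P using vertex_generatorD(1)[OF P] .
  interpret M: graded_module A M by fact
  note pc = vertex_generatorD(3)[OF P]
  have yc: "y \<in> carrier M" by (rule vpartD(3)[OF y M])
  have eq: "a \<odot>\<^bsub>M\<^esub> y = b \<odot>\<^bsub>M\<^esub> y" if "a \<odot>\<^bsub>P\<^esub> p = b \<odot>\<^bsub>P\<^esub> p" for a b
  proof -
    have "(a - b) * idem A i = 0"
      by (rule vertex_generatorD(6)[OF P P.act_diff_eq_zero[OF pc that]])
    then have "(a - b) \<odot>\<^bsub>M\<^esub> y = \<zero>\<^bsub>M\<^esub>"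
      using M.act_assoc[OF yc, of "a - b" "idem A i"] vpartD(2)[OF y] M.act_zero_left[OF yc] by simp
    then show ?thesis using M.act_add_left[OF yc, of "a - b" b] M.act_closed[OF yc] by simp
  qed
  define \<phi> where "\<phi> = (\<lambda>x\<in>carrier P. (SOME a. x = a \<odot>\<^bsub>P\<^esub> p) \<odot>\<^bsub>M\<^esub> y)"
  have \<phi>: "\<phi> (a \<odot>\<^bsub>P\<^esub> p) = a \<odot>\<^bsub>M\<^esub> y" for a
  proof -
    have "a \<odot>\<^bsub>P\<^esub> p = (SOME b. a \<odot>\<^bsub>P\<^esub> p = b \<odot>\<^bsub>P\<^esub> p) \<odot>\<^bsub>P\<^esub> p" by (rule someI[of _ a]) simp
    from eq[OF this] show ?thesis using P.act_closed[OF pc] by (simp add: \<phi>_def)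
  qed
  have "\<phi> \<in> gr_hom P M"
  proof (rule gr_homI)
    show "\<phi> \<in> extensional (carrier P)" by (simp add: \<phi>_def)
    fix x assume "x \<in> carrier P"
    then obtain a where a: "x = a \<odot>\<^bsub>P\<^esub> p" using vertex_generatorD(4)[OF P] by blast
    show "\<phi> x \<in> carrier M" using a \<phi> M.act_closed[OF yc] by simp
    show "\<phi> (b \<odot>\<^bsub>P\<^esub> x) = b \<odot>\<^bsub>M\<^esub> \<phi> x" for b
      using \<phi>[of "b * a"] P.act_assoc[OF pc] M.act_assoc[OF yc] a \<phi> by simp
    fix x' assume "x' \<in> carrier P"
    then obtain a' where a': "x' = a' \<odot>\<^bsub>P\<^esub> p" using vertex_generatorD(4)[OF P] by blast
    show "\<phi> (x \<oplus>\<^bsub>P\<^esub> x') = \<phi> x \<oplus>\<^bsub>M\<^esub> \<phi> x'"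
      using \<phi>[of "a + a'"] P.act_add_left[OF pc] M.act_add_left[OF yc] a a' \<phi> by simp
  next
    fix k x assume "x \<in> gpart P k"
    from vertex_generatorD(5)[OF P this] show "\<phi> x \<in> gpart M k"
    proof
      assume "x = \<zero>\<^bsub>P\<^esub>"
      then have "x = 0 \<odot>\<^bsub>P\<^esub> p" using P.act_zero_left[OF pc] by simp
      then show ?thesis using \<phi> M.act_zero_left[OF yc] M.gpart_zero by simp
    next
      assume "n \<le> k \<and> (\<exists>a\<in>deg A (nat (k - n)). x = a \<odot>\<^bsub>P\<^esub> p)"
      then obtain a where "n \<le> k" "a \<in> deg A (nat (k - n))" "x = a \<odot>\<^bsub>P\<^esub> p" by blast
      then show ?thesis using M.gpart_act[of a _ y n] vpartD(1)[OF y] \<phi> by fastforce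
    qed
  qed
  moreover have "\<phi> p = y" using \<phi>[of 1] P.act_one[OF pc] M.act_one[OF yc] by simp
  ultimately show ?thesis by blast
qed

lemma vertex_generator_hom_unique:
  assumes P: "vertex_generator A P i n p" and f: "f \<in> gr_hom P M" and g: "g \<in> gr_hom P M"
    and eq: "f p = g p"
  shows "f = g"
proof (rule gr_hom_eqI[OF f g])
  fix x assume "x \<in> carrier P"
  then obtain a where a: "x = a \<odot>\<^bsub>P\<^esub> p" using vertex_generatorD(4)[OF P] by blast
  then show "f x = g x"
    using gr_homD(4)[OF f vertex_generatorD(3)[OF P]] gr_homD(4)[OF g vertex_generatorD(3)[OF P]] eq by simp
qed

lemma vertex_generator_shift:
  assumes "vertex_generator A P i n p"
  shows "vertex_generator A (shift m P) i (n + m) p"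
proof -
  have "k - m - n = k - (n + m)" "n \<le> k - m \<longleftrightarrow> n + m \<le> k" for k by auto
  then show ?thesis
    using vertex_generatorD[OF assms] graded_module_shift[OF vertex_generatorD(1)[OF assms], of m]
    unfolding vertex_generator_def by (metis (no_types, lifting) add_diff_cancel_right' shift_simps(1,3-5) vpart_shift)
qed

lemma vertex_generator_transport:
  assumes P: "vertex_generator A P i n p" and Q: "graded_module A Q"
    and f: "f \<in> gr_hom P Q" and bij: "bij_betw f (carrier P) (carrier Q)"
  shows "vertex_generator A Q i n (f p)"
proof -
  note PM = vertex_generatorD(1)[OF P] and pc = vertex_generatorD(3)[OF P]
  interpret P: graded_module A P by (rule PM)
  interpret Q: graded_module A Q by (rule Q)
  note g = gr_hom_inv[OF PM Q f bij]
  let ?g = "restrict (inv_into (carrier P) f) (carrier Q)"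
  have f0: "f \<zero>\<^bsub>P\<^esub> = \<zero>\<^bsub>Q\<^esub>" by (rule gr_hom_zero[OF PM Q f])
  show ?thesis unfolding vertex_generator_def
  proof (intro conjI allI ballI impI)
    show "graded_module A Q" by (rule Q)
    show "f p \<in> vpart A Q i n" by (rule gr_hom_vpart[OF PM f vertex_generatorD(2)[OF P]])
    show "\<exists>a. x = a \<odot>\<^bsub>Q\<^esub> f p" if x: "x \<in> carrier Q" for x
    proof -
      obtain a where "?g x = a \<odot>\<^bsub>P\<^esub> p" using vertex_generatorD(4)[OF P gr_homD(1)[OF g(1) x]] by blast
      then have "f (?g x) = a \<odot>\<^bsub>Q\<^esub> f p" using gr_homD(4)[OF f pc] by simp
      then show ?thesis using g(3)[OF x] by auto
    qed
    show "x = \<zero>\<^bsub>Q\<^esub> \<or> (n \<le> k \<and> (\<exists>a\<in>deg A (nat (k - n)). x = a \<odot>\<^bsub>Q\<^esub> f p))" if x: "x \<in> gpart Q k" for k x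
    proof -
      have "f (?g x) = x" by (rule g(3)[OF Q.gpart_carrier[OF x]])
      with vertex_generatorD(5)[OF P gr_homD(5)[OF g(1) x]] show ?thesis
        using f0 gr_homD(4)[OF f pc] by metis
    qed
    show "a * idem A i = 0" if "a \<odot>\<^bsub>Q\<^esub> f p = \<zero>\<^bsub>Q\<^esub>" for a
    proof -
      have "f (a \<odot>\<^bsub>P\<^esub> p) = f \<zero>\<^bsub>P\<^esub>" using that gr_homD(4)[OF f pc] f0 by simp
      then have "a \<odot>\<^bsub>P\<^esub> p = \<zero>\<^bsub>P\<^esub>" using g(2) P.act_closed[OF pc] P.zero_closed by metis
      then show ?thesis by (rule vertex_generatorD(6)[OF P])
    qed
  qed
qed

lemma vertex_generator_iso:
  assumes P: "vertex_generator A P i n p" and Q: "vertex_generator A Q i n q"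
  shows "\<exists>f \<in> gr_hom P Q. f p = q \<and> bij_betw f (carrier P) (carrier Q)"
proof -
  note PM = vertex_generatorD(1)[OF P] and pc = vertex_generatorD(3)[OF P]
  note QM = vertex_generatorD(1)[OF Q] and qc = vertex_generatorD(3)[OF Q]
  obtain f where f: "f \<in> gr_hom P Q" "f p = q"
    using vertex_generator_hom[OF P QM vertex_generatorD(2)[OF Q]] by blast
  obtain g where g: "g \<in> gr_hom Q P" "g q = p"
    using vertex_generator_hom[OF Q PM vertex_generatorD(2)[OF P]] by blast
  have "g (f x) = x" if "x \<in> carrier P" for x
    using vertex_generatorD(4)[OF P that] gr_homD(4)[OF f(1) pc] gr_homD(4)[OF g(1) qc] f g by metis
  moreover have "f (g x) = x" if "x \<in> carrier Q" for x
    using vertex_generatorD(4)[OF Q that] gr_homD(4)[OF f(1) pc] gr_homD(4)[OF g(1) qc] f g by metis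
  ultimately have "bij_betw f (carrier P) (carrier Q)"
    using gr_homD(1)[OF f(1)] gr_homD(1)[OF g(1)] by (intro bij_betwI[of _ _ _ g]) auto
  with f show ?thesis by blast
qed

text \<open>The lowest component of \<open>A e\<^sub>i\<langle>n\<rangle>\<close> is a line, because \<open>e\<^sub>i\<close> is an eigenvector of \<open>A\<^sub>0\<close>. In
  particular the endomorphisms of \<open>A e\<^sub>i\<langle>n\<rangle>\<close> are the scalars.\<close>

lemma vertex_generator_vpart:
  assumes A: "elementary_graded_algebra A" and P: "vertex_generator A P i n p" and i: "i < rk A"
    and x: "x \<in> gpart P n"
  shows "\<exists>c. x = scal A c 1 \<odot>\<^bsub>P\<^esub> p"
proof -
  interpret A: elementary_graded_algebra A by fact
  interpret P: graded_module A P using vertex_generatorD(1)[OF P] .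
  note pc = vertex_generatorD(3)[OF P]
  obtain a where a: "a \<in> deg A 0" "x = a \<odot>\<^bsub>P\<^esub> p"
    using vertex_generatorD(5)[OF P x] P.act_zero_left[OF pc] A.deg_zero by fastforce
  obtain c where c: "a * idem A i = scal A c (idem A i)" using A.deg0_idem[OF a(1) i] by blast
  have p: "idem A i \<odot>\<^bsub>P\<^esub> p = p" using vertex_generatorD(2)[OF P] by (simp add: vpart_def)
  have "x = (a * idem A i) \<odot>\<^bsub>P\<^esub> p" using a p P.act_assoc[OF pc] by simp
  also have "\<dots> = (scal A c 1 * idem A i) \<odot>\<^bsub>P\<^esub> p" by (simp add: c A.scal_one_mult)
  also have "\<dots> = scal A c 1 \<odot>\<^bsub>P\<^esub> p" using p P.act_assoc[OF pc] by simp
  finally show ?thesis by blast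
qed

text \<open>The lowest degree of \<open>A e\<^sub>i\<langle>n\<rangle>\<close> is \<open>n\<close>, and it is a line on which only \<open>e\<^sub>i\<close> acts as the identity.\<close>

lemma vertex_generator_unique:
  assumes A: "elementary_graded_algebra A" and P: "vertex_generator A P i n p" and i: "i < rk A"
    and Q: "vertex_generator A P j m q" and j: "j < rk A"
  shows "i = j \<and> n = m"
proof -
  interpret A: elementary_graded_algebra A by fact
  interpret P: graded_module A P using vertex_generatorD(1)[OF P] .
  note pc = vertex_generatorD(3)[OF P] and qc = vertex_generatorD(3)[OF Q]
  note p0 = vertex_generator_nonzero[OF A P i] and q0 = vertex_generator_nonzero[OF A Q j]
  have "m \<le> n" using vertex_generatorD(5)[OF Q vpartD(1)[OF vertex_generatorD(2)[OF P]]] p0 by simp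
  moreover have "n \<le> m" using vertex_generatorD(5)[OF P vpartD(1)[OF vertex_generatorD(2)[OF Q]]] q0 by simp
  ultimately have nm: "n = m" by simp
  obtain c where c: "p = scal A c 1 \<odot>\<^bsub>P\<^esub> q"
    using vertex_generator_vpart[OF A Q j, of p] vertex_generatorD(2)[OF P] nm by (auto simp: vpart_def)
  have p: "idem A i \<odot>\<^bsub>P\<^esub> p = p" and q: "idem A j \<odot>\<^bsub>P\<^esub> q = q"
    using vertex_generatorD(2)[OF P] vertex_generatorD(2)[OF Q] by (simp_all add: vpart_def)
  have "p = (idem A i * scal A c 1 * idem A j) \<odot>\<^bsub>P\<^esub> q"
    using p c q P.act_assoc[OF qc] P.act_closed[OF qc] by simp
  also have "idem A i * scal A c 1 * idem A j = scal A c (idem A i * idem A j)"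
    by (simp add: A.mult_scal_one A.scal_mult_left)
  finally have "i = j" using p0 A.idem_mult[OF i j] P.act_zero_left[OF qc] by (auto split: if_splits)
  with nm show ?thesis by simp
qed

lemma finsum_vertex_projective:
  "finite K \<Longrightarrow> (\<And>k. k \<in> K \<Longrightarrow> f k \<in> carrier (vertex_projective A i)) \<Longrightarrow>
   abelian_group (vertex_projective A i) \<Longrightarrow>
    finsum (vertex_projective A i) f K = sum f K"
proof (induction K rule: finite_induct)
  case empty
  then interpret abelian_group "vertex_projective A i" by simp
  show ?case using finsum_empty[of f] by (simp add: vertex_projective_def)
next
  case (insert k K)
  then interpret abelian_group "vertex_projective A i" by simp
  have "finsum (vertex_projective A i) f (insert k K) = f k \<oplus>\<^bsub>vertex_projective A i\<^esub> finsum (vertex_projective A i) f K"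
    by (rule finsum_insert) (use insert in auto)
  then show ?case using insert by (simp add: vertex_projective_def)
qed

lemma (in elementary_graded_algebra) vertex_projective_generator:
  assumes i: "i < rk A"
  shows "vertex_generator A (vertex_projective A i) i 0 (idem A i)"
proof -
  let ?P = "vertex_projective A i" and ?e = "idem A i"
  have ee: "?e * ?e = ?e" by (rule idem_sq[OF i])
  have car: "carrier ?P = {x. x * ?e = x}"
    using ee by (auto simp: vertex_projective_def mult.assoc) metis
  have P: "\<zero>\<^bsub>?P\<^esub> = 0" "x \<oplus>\<^bsub>?P\<^esub> y = x + y" "a \<odot>\<^bsub>?P\<^esub> x = a * x" for x y a
    by (simp_all add: vertex_projective_def)
  have "{a * ?e |a. a \<in> deg A k} = {x \<in> deg A k. x * ?e = x}" for k
  proof -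
    have "a * ?e \<in> deg A k" if "a \<in> deg A k" for a using deg_mult[OF that idem_deg[OF i]] by simp
    then show ?thesis using ee by (auto simp: mult.assoc) metis
  qed
  then have gp: "gpart ?P n = (if n \<ge> 0 then {x \<in> deg A (nat n). x * ?e = x} else {0})" for n
    by (simp add: vertex_projective_def)
  interpret P: abelian_group ?P
    by (rule abelian_groupI) (auto simp: car P algebra_simps intro: exI[of _ "- x" for x])
  interpret P: left_module ?P by unfold_locales (auto simp: car P algebra_simps)
  have sub: "gpart ?P n \<subseteq> carrier ?P" for n by (auto simp: gp car)
  have "graded_module A ?P"
  proof (intro graded_module.intro graded_module_axioms.intro P.left_module_axioms)
    show "additive_subgroup (gpart ?P n) ?P" for n
    proof (rule additive_subgroup.intro, rule P.add.subgroupI)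
      fix x assume x: "x \<in> gpart ?P n"
      have "\<ominus>\<^bsub>?P\<^esub> x = - x"
        by (rule P.minus_equality) (use x in \<open>auto simp: P gp car split: if_splits\<close>)
      then show "\<ominus>\<^bsub>?P\<^esub> x \<in> gpart ?P n" using x deg_subspace subspace_neg by (auto simp: gp split: if_splits)
    next
      show "gpart ?P n \<noteq> {}" using deg_zero[of "nat n"] by (auto simp: gp intro!: exI[of _ 0])
      show "gpart ?P n \<subseteq> carrier ?P" by (rule sub)
      fix x y assume "x \<in> gpart ?P n" "y \<in> gpart ?P n"
      then show "x \<oplus>\<^bsub>?P\<^esub> y \<in> gpart ?P n"
        using deg_add by (auto simp: P gp algebra_simps split: if_splits)
    qed
    show "a \<odot>\<^bsub>?P\<^esub> x \<in> gpart ?P (int k + n)" if "a \<in> deg A k" "x \<in> gpart ?P n" for a k x n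
      using that deg_mult[of a k x "nat n"] deg_zero
      by (auto simp: P gp mult.assoc nat_add_distrib split: if_splits)
    fix x assume "x \<in> carrier ?P"
    then have x: "x * ?e = x" by (simp add: car)
    obtain f where f: "\<And>n. f n \<in> deg A n" "finite {n. f n \<noteq> 0}" "x = (\<Sum>n | f n \<noteq> 0. f n)"
      and uniq: "\<And>g. (\<And>n. g n \<in> deg A n) \<Longrightarrow> finite {n. g n \<noteq> 0} \<Longrightarrow> x = (\<Sum>n | g n \<noteq> 0. g n) \<Longrightarrow> g = f"
      using deg_direct_sum[of x] by (elim ex1E) blast
    \<comment> \<open>Right multiplication by \<open>e\<^sub>i\<close> preserves degrees, so the components of \<open>x = x e\<^sub>i\<close> lie in \<open>A e\<^sub>i\<close>, too.\<close>
    have fe: "f n * ?e = f n" for n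
    proof -
      have "(\<lambda>n. f n * ?e) = f"
      proof (rule uniq)
        show "f n * ?e \<in> deg A n" for n using deg_mult[OF f(1) idem_deg[OF i]] by simp
        show "finite {n. f n * ?e \<noteq> 0}" by (rule finite_subset[OF _ f(2)]) auto
        have "x = (\<Sum>n | f n \<noteq> 0. f n * ?e)" using x f(3) by (metis sum_distrib_right)
        also have "\<dots> = (\<Sum>n | f n * ?e \<noteq> 0. f n * ?e)"
          by (rule sum.mono_neutral_right) (use f(2) in auto)
        finally show "x = (\<Sum>n | f n * ?e \<noteq> 0. f n * ?e)" .
      qed
      then show ?thesis by (rule fun_cong)
    qed
    show "\<exists>!f. (\<forall>n. f n \<in> gpart ?P n) \<and> finite {n. f n \<noteq> \<zero>\<^bsub>?P\<^esub>} \<and>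
        x = (\<Oplus>\<^bsub>?P\<^esub>n\<in>{n. f n \<noteq> \<zero>\<^bsub>?P\<^esub>}. f n)"
    proof (rule ex1I[of _ "\<lambda>n. if n \<ge> 0 then f (nat n) else 0"], intro conjI allI)
      let ?g = "\<lambda>n::int. if n \<ge> 0 then f (nat n) else 0"
      show g: "?g n \<in> gpart ?P n" for n using f(1) fe by (simp add: gp)
      have eq: "{n. ?g n \<noteq> 0} = int ` {n. f n \<noteq> 0}"
        by (auto simp: image_iff split: if_splits) (metis nat_0_le)
      show fin: "finite {n. ?g n \<noteq> \<zero>\<^bsub>?P\<^esub>}" unfolding P eq using f(2) by simp
      have "(\<Oplus>\<^bsub>?P\<^esub>n\<in>{n. ?g n \<noteq> \<zero>\<^bsub>?P\<^esub>}. ?g n) = (\<Sum>n\<in>{n. ?g n \<noteq> \<zero>\<^bsub>?P\<^esub>}. ?g n)"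
        using finsum_vertex_projective[OF fin, of ?g A i] subsetD[OF sub g] P.abelian_group_axioms by blast
      also have "\<dots> = x" unfolding P eq by (subst sum.reindex) (use f(3) in \<open>auto simp: inj_on_def\<close>)
      finally show "x = (\<Oplus>\<^bsub>?P\<^esub>n\<in>{n. ?g n \<noteq> \<zero>\<^bsub>?P\<^esub>}. ?g n)" by simp
    next
      fix g assume g: "(\<forall>n. g n \<in> gpart ?P n) \<and> finite {n. g n \<noteq> \<zero>\<^bsub>?P\<^esub>} \<and>
        x = (\<Oplus>\<^bsub>?P\<^esub>n\<in>{n. g n \<noteq> \<zero>\<^bsub>?P\<^esub>}. g n)"
      then have fin: "finite {n. g n \<noteq> 0}" by (simp add: P)
      have neg: "g n = 0" if "n < 0" for n using g that by (auto simp: gp dest: spec[of _ n])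
      have eq: "{n. g n \<noteq> 0} = int ` {n. g (int n) \<noteq> 0}"
        by (auto simp: image_iff) (metis neg nat_0_le not_le)
      have "x = (\<Sum>n\<in>{n. g n \<noteq> 0}. g n)"
        using g finsum_vertex_projective[OF fin, of g A i] subsetD[OF sub, of "g n" n for n] P.abelian_group_axioms
        by (simp add: P)
      also have "\<dots> = (\<Sum>n | g (int n) \<noteq> 0. g (int n))"
        unfolding eq by (subst sum.reindex) (auto simp: inj_on_def)
      finally have x: "x = (\<Sum>n | g (int n) \<noteq> 0. g (int n))" .
      have "(\<lambda>n. g (int n)) = f"
      proof (rule uniq[OF _ _ x])
        show "g (int n) \<in> deg A n" for n using g by (auto simp: gp dest: spec[of _ "int n"])
        show "finite {n. g (int n) \<noteq> 0}" using fin unfolding eq by (simp add: finite_image_iff)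
      qed
      then show "g = (\<lambda>n. if n \<ge> 0 then f (nat n) else 0)" using neg
        by (intro ext) (metis nat_0_le not_le)
    qed
  qed
  then show ?thesis unfolding vertex_generator_def
    using ee idem_deg[OF i] by (auto simp: vpart_def gp car P) metis+
qed

section \<open>Equivalences carry vertex projectives to vertex projectives\<close>

lemma GrMod_functorD:
  assumes "is_functor (GrMod A) (GrMod B) F"
  shows "graded_module A M \<Longrightarrow> graded_module B (fob F M)"
    and "\<lbrakk>graded_module A M; graded_module A N; f \<in> gr_hom M N\<rbrakk> \<Longrightarrow> fmor F M N f \<in> gr_hom (fob F M) (fob F N)"
    and "graded_module A M \<Longrightarrow> fmor F M M (\<lambda>x\<in>carrier M. x) = (\<lambda>x\<in>carrier (fob F M). x)"
    and "\<lbrakk>graded_module A L; graded_module A M; graded_module A N; f \<in> gr_hom L M; g \<in> gr_hom M N\<rbrakk> \<Longrightarrow>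
      fmor F L N (compose (carrier L) g f) = compose (carrier (fob F L)) (fmor F M N g) (fmor F L M f)"
  using assms unfolding is_functor_def by simp_all

lemma GrMod_equivalenceD:
  assumes "is_equivalence (GrMod A) (GrMod B) F"
  shows GrMod_equivalence_functor: "is_functor (GrMod A) (GrMod B) F"
    and GrMod_equivalence_faithful: "\<lbrakk>graded_module A M; graded_module A N; f \<in> gr_hom M N; g \<in> gr_hom M N;
      fmor F M N f = fmor F M N g\<rbrakk> \<Longrightarrow> f = g"
    and GrMod_equivalence_full: "\<lbrakk>graded_module A M; graded_module A N; h \<in> gr_hom (fob F M) (fob F N)\<rbrakk> \<Longrightarrow>
      \<exists>f \<in> gr_hom M N. fmor F M N f = h"
proof -
  obtain G where F: "is_functor (GrMod A) (GrMod B) F" and G: "is_functor (GrMod B) (GrMod A) G"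
    and GF: "naturally_isomorphic (GrMod A) (GrMod A) (comp_functor G F) id_functor"
    and FG: "naturally_isomorphic (GrMod B) (GrMod B) (comp_functor F G) id_functor"
    using assms unfolding is_equivalence_def by blast
  show "is_functor (GrMod A) (GrMod B) F" by (rule F)
  show "f = g" if "graded_module A M" "graded_module A N" "f \<in> gr_hom M N" "g \<in> gr_hom M N"
      "fmor F M N f = fmor F M N g"
    using faithful_if_left_inverse[OF category_GrMod F G GF, of M N f g] that by simp
  show "\<exists>f \<in> gr_hom M N. fmor F M N f = h" if "graded_module A M" "graded_module A N"
      "h \<in> gr_hom (fob F M) (fob F N)"
    using full_if_equivalence[OF category_GrMod category_GrMod F G GF FG, of M N h] that by simp
qed

lemma naturally_isomorphic_GrMod_id:
  assumes "naturally_isomorphic (GrMod A) (GrMod A) (comp_functor G F) id_functor"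
  shows "\<exists>\<eta>. (\<forall>M. graded_module A M \<longrightarrow> is_iso_in (GrMod A) (fob G (fob F M)) M (\<eta> M)) \<and>
    (\<forall>M N f. graded_module A M \<longrightarrow> graded_module A N \<longrightarrow> f \<in> gr_hom M N \<longrightarrow>
      compose (carrier (fob G (fob F M))) (\<eta> N) (fmor G (fob F M) (fob F N) (fmor F M N f)) =
      compose (carrier (fob G (fob F M))) f (\<eta> M))"
  using assms unfolding naturally_isomorphic_def comp_functor_def id_functor_def by (simp add: Ball_def)

lemma ex_vertex_generator:
  assumes A: "elementary_graded_algebra A" and inj: "\<exists>\<iota> :: 'a \<Rightarrow> 'u. inj \<iota>" and i: "i < rk A"
  shows "\<exists>(P :: ('a :: {ring, monoid_mult}, 'u) gmodule) p. vertex_generator A P i n p"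
proof -
  obtain \<iota> :: "'a \<Rightarrow> 'u" where "inj \<iota>" using inj by blast
  then have \<iota>: "inj_on \<iota> (carrier (vertex_projective A i))" by (rule inj_on_subset) simp
  note P = elementary_graded_algebra.vertex_projective_generator[OF A i]
  note Q = graded_module_copy[OF vertex_generatorD(1)[OF P] \<iota>]
  show ?thesis
    using vertex_generator_shift[OF vertex_generator_transport[OF P Q], of n] unfolding add_0 by blast
qed

text \<open>A copy of the simple module \<open>S\<^sub>i\<langle>n\<rangle>\<close>: a line in degree \<open>n\<close>, supported at the vertex \<open>i\<close>.\<close>

definition vertex_line ::
  "('k :: field, 'a :: {ring, monoid_mult}) graded_algebra \<Rightarrow> ('a, 'm) gmodule \<Rightarrow> nat \<Rightarrow> int \<Rightarrow> 'm \<Rightarrow> bool"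
where
  "vertex_line A T i n t \<longleftrightarrow> graded_module A T \<and> t \<in> vpart A T i n \<and> t \<noteq> \<zero>\<^bsub>T\<^esub> \<and>
     (\<forall>x \<in> carrier T. \<exists>c. x = scal A c 1 \<odot>\<^bsub>T\<^esub> t)"

lemma vertex_lineD:
  assumes "vertex_line A T i n t"
  shows "graded_module A T" "t \<in> vpart A T i n" "t \<in> carrier T" "t \<noteq> \<zero>\<^bsub>T\<^esub>"
    "x \<in> carrier T \<Longrightarrow> \<exists>c. x = scal A c 1 \<odot>\<^bsub>T\<^esub> t"
  using assms vpartD(3)[of t A T i n] by (simp_all add: vertex_line_def)

lemma vertex_line_shift: "vertex_line A T i n t \<Longrightarrow> vertex_line A (shift m T) i (n + m) t"
  using graded_module_shift[of A T m] by (simp add: vertex_line_def)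

lemma vertex_line_bottom:
  assumes A: "elementary_graded_algebra A" and P: "vertex_generator A P i 0 p" and i: "i < rk A"
  shows "vertex_line A (bottom_module P) i 0 p"
proof -
  interpret P: graded_module A P using vertex_generatorD(1)[OF P] .
  have T: "graded_module A (bottom_module P)"
  proof (rule graded_module_bottom[OF A P.graded_module_axioms])
    show "gpart P n \<subseteq> {\<zero>\<^bsub>P\<^esub>}" if "n < 0" for n using vertex_generatorD(5)[OF P, of _ n] that by auto
  qed
  have p: "p \<in> gpart P 0" "idem A i \<odot>\<^bsub>P\<^esub> p = p"
    using vertex_generatorD(2)[OF P] by (simp_all add: vpart_def)
  have h: "P.hcomp x 0 = x" if "x \<in> gpart P 0" for x using P.hcomp_homogeneous[OF that] by simp
  have c: "P.hcomp (scal A c 1 \<odot>\<^bsub>P\<^esub> p) 0 = scal A c 1 \<odot>\<^bsub>P\<^esub> p" for c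
    using P.scal_vpart[OF A vertex_generatorD(2)[OF P]] by (intro h) (simp add: vpart_def)
  show ?thesis unfolding vertex_line_def
  proof (intro conjI ballI T)
    show "p \<in> vpart A (bottom_module P) i 0" using p h by (simp add: vpart_def bottom_module_def)
    show "p \<noteq> \<zero>\<^bsub>bottom_module P\<^esub>"
      using vertex_generator_nonzero[OF A P i] by (simp add: bottom_module_def)
    fix x assume "x \<in> carrier (bottom_module P)"
    then have "x \<in> gpart P 0" by (simp add: bottom_module_def)
    from vertex_generator_vpart[OF A P i this]
    show "\<exists>c. x = scal A c 1 \<odot>\<^bsub>bottom_module P\<^esub> p" by (auto simp: bottom_module_def c)
  qed
qed

lemma ex_vertex_line:
  fixes P :: "('a :: {ring, monoid_mult}, 'm) gmodule"
  assumes A: "elementary_graded_algebra A" and P: "vertex_generator A P i n p" and i: "i < rk A"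
  shows "\<exists>T :: ('a, 'm) gmodule. vertex_line A T i n p"
  using vertex_line_shift[OF vertex_line_bottom[OF A _ i], of "shift (- n) P" p n]
    vertex_generator_shift[OF P, of "- n"] by auto

text \<open>Write \<open>G\<close> for the inverse of \<open>F\<close> and \<open>S\<close> for the simple quotient of \<open>P = A e\<^sub>i\<langle>n\<rangle>\<close>. The image
  under \<open>F\<close> of the nonzero map \<open>P \<rightarrow> S\<close> is nonzero on the image of some \<open>Q = B f\<^sub>j\<langle>m\<rangle>\<close>, because
  these generate \<open>GrMod B\<close>. The corresponding map \<open>G(Q) \<rightarrow> P\<close> is then not zero modulo the radical,
  so it hits the generator of \<open>P\<close> and splits. This exhibits \<open>P\<close> as the image of a nonzero idempotent
  endomorphism of \<open>G(Q)\<close>; but \<open>End(G(Q)) = End(Q)\<close> is the field of scalars, so \<open>P \<cong> G(Q)\<close> and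
  \<open>F(P) \<cong> Q\<close>. The argument is phrased in terms of composition alone, the idempotents \<open>0\<close> and \<open>1\<close> being
  told apart by multiplication, so that it applies to the inverse \<open>G\<close> as well.\<close>

lemma equivalence_vertex_generator:
  fixes F :: "(('a :: {ring, monoid_mult}, 'u) gmodule, 'u \<Rightarrow> 'u, ('b :: {ring, monoid_mult}, 'u) gmodule, 'u \<Rightarrow> 'u) cfunctor"
  assumes A: "elementary_graded_algebra A" and B: "elementary_graded_algebra B"
    and inj: "\<exists>\<iota> :: 'b \<Rightarrow> 'u. inj \<iota>"
    and equiv: "is_equivalence (GrMod A) (GrMod B) F"
    and P: "vertex_generator A P i n p" and i: "i < rk A"
  shows "\<exists>j < rk B. \<exists>m q. vertex_generator B (fob F P) j m q"
proof -
  interpret A: elementary_graded_algebra A by fact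
  interpret B: elementary_graded_algebra B by fact
  obtain G where equivG: "is_equivalence (GrMod B) (GrMod A) G"
    and GF: "naturally_isomorphic (GrMod A) (GrMod A) (comp_functor G F) id_functor"
    and FG: "naturally_isomorphic (GrMod B) (GrMod B) (comp_functor F G) id_functor"
    using equivalence_inverse[OF equiv] by blast
  note F = GrMod_functorD[OF GrMod_equivalence_functor[OF equiv]]
  note G = GrMod_functorD[OF GrMod_equivalence_functor[OF equivG]]
  obtain \<eta> where \<eta>: "\<forall>M. graded_module A M \<longrightarrow> is_iso_in (GrMod A) (fob G (fob F M)) M (\<eta> M)"
    and \<eta>_nat: "\<forall>M N f. graded_module A M \<longrightarrow> graded_module A N \<longrightarrow> f \<in> gr_hom M N \<longrightarrow>
      compose (carrier (fob G (fob F M))) (\<eta> N) (fmor G (fob F M) (fob F N) (fmor F M N f)) =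
      compose (carrier (fob G (fob F M))) f (\<eta> M)"
    using naturally_isomorphic_GrMod_id[OF GF] by blast
  obtain \<theta> where \<theta>: "\<forall>M. graded_module B M \<longrightarrow> is_iso_in (GrMod B) (fob F (fob G M)) M (\<theta> M)"
    using naturally_isomorphic_GrMod_id[OF FG] by blast
  note PM = vertex_generatorD(1)[OF P] and pc = vertex_generatorD(3)[OF P]
  interpret P: graded_module A P by (rule PM)
  obtain T :: "('a, 'u) gmodule" where T: "vertex_line A T i n p" using ex_vertex_line[OF A P i] by blast
  note TM = vertex_lineD(1)[OF T]
  interpret T: graded_module A T by (rule TM)
  obtain \<pi> where \<pi>: "\<pi> \<in> gr_hom P T" "\<pi> p = p"
    using vertex_generator_hom[OF P TM vertex_lineD(2)[OF T]] by blast
  let ?z = "zero_map P T"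
  have z: "?z \<in> gr_hom P T" by (rule zero_map[OF PM TM])
  have "\<pi> \<noteq> ?z" using \<pi>(2) vertex_lineD(4)[OF T] pc by (auto simp: zero_map_def)
  then have ne: "fmor F P T \<pi> \<noteq> fmor F P T ?z"
    using GrMod_equivalence_faithful[OF equiv PM TM \<pi>(1) z] by blast
  note FP = F(1)[OF PM] and FT = F(1)[OF TM]
  note F\<pi> = F(2)[OF PM TM \<pi>(1)] and Fz = F(2)[OF PM TM z]
  have "\<exists>j m x. j < rk B \<and> x \<in> vpart B (fob F P) j m \<and> fmor F P T \<pi> x \<noteq> fmor F P T ?z x"
  proof (rule ccontr)
    assume *: "\<not> ?thesis"
    have "fmor F P T \<pi> x = fmor F P T ?z x" if "x \<in> carrier (fob F P)" for x
      using B FP that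
    proof (induction x rule: vpart_induct)
      case zero
      show ?case using gr_hom_zero[OF FP FT F\<pi>] gr_hom_zero[OF FP FT Fz] by simp
    next
      case (add x y)
      then show ?case using gr_homD(3)[OF F\<pi>] gr_homD(3)[OF Fz] by simp
    qed (use * in blast)
    then show False using ne gr_hom_eqI[OF F\<pi> Fz] by blast
  qed
  then obtain j m x where j: "j < rk B" and x: "x \<in> vpart B (fob F P) j m"
    and x_ne: "fmor F P T \<pi> x \<noteq> fmor F P T ?z x" by blast
  obtain Q :: "('b, 'u) gmodule" and q where Q: "vertex_generator B Q j m q"
    using ex_vertex_generator[OF B inj j] by blast
  note QM = vertex_generatorD(1)[OF Q] and qc = vertex_generatorD(3)[OF Q]
  interpret Q: graded_module B Q by (rule QM)
  obtain g where g: "g \<in> gr_hom Q (fob F P)" "g q = x" using vertex_generator_hom[OF Q FP x] by blast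
  define R where "R = fob G Q"
  have RM: "graded_module A R" unfolding R_def by (rule G(1)[OF QM])
  interpret R: graded_module A R by (rule RM)
  note GFP = G(1)[OF FP] and GFT = G(1)[OF FT]
  have \<eta>P: "\<eta> P \<in> gr_hom (fob G (fob F P)) P" and \<eta>T: "\<eta> T \<in> gr_hom (fob G (fob F T)) T"
    and \<eta>T_inj: "inj_on (\<eta> T) (carrier (fob G (fob F T)))"
    using \<eta>[rule_format, of P] \<eta>[rule_format, of T] is_iso_in_GrMod[OF GFP PM] is_iso_in_GrMod[OF GFT TM] PM TM
    by (auto simp: bij_betw_def)
  have Gg: "fmor G Q (fob F P) g \<in> gr_hom R (fob G (fob F P))" unfolding R_def by (rule G(2)[OF QM FP g(1)])
  define \<rho> where "\<rho> = compose (carrier R) (\<eta> P) (fmor G Q (fob F P) g)"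
  have \<rho>: "\<rho> \<in> gr_hom R P" unfolding \<rho>_def by (rule gr_hom_compose[OF RM Gg \<eta>P])
  \<comment> \<open>By naturality of \<open>\<eta>\<close>, composition with \<open>\<rho>\<close> on one side is composition with \<open>g\<close> on the other.\<close>
  have via: "h (\<rho> y) = \<eta> T (fmor G Q (fob F T) (compose (carrier Q) (fmor F P T h) g) y)"
    if h: "h \<in> gr_hom P T" and y: "y \<in> carrier R" for h y
  proof -
    have Gy: "fmor G Q (fob F P) g y \<in> carrier (fob G (fob F P))" using gr_homD(1)[OF Gg y] .
    have "h (\<eta> P v) = \<eta> T (fmor G (fob F P) (fob F T) (fmor F P T h) v)" if "v \<in> carrier (fob G (fob F P))" for v
      using fun_cong[OF \<eta>_nat[rule_format, of P T h], of v] h PM TM that by (simp add: compose_def)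
    then show ?thesis using Gy y G(4)[OF QM FP FT g(1) F(2)[OF PM TM h]]
      by (simp add: \<rho>_def compose_def R_def)
  qed
  have "\<exists>y \<in> carrier R. \<pi> (\<rho> y) \<noteq> ?z (\<rho> y)"
  proof (rule ccontr)
    assume *: "\<not> ?thesis"
    let ?c = "\<lambda>h. compose (carrier Q) (fmor F P T h) g"
    have c: "?c h \<in> gr_hom Q (fob F T)" if "h \<in> gr_hom P T" for h
      by (rule gr_hom_compose[OF QM g(1) F(2)[OF PM TM that]])
    note Gc = G(2)[OF QM FT c]
    have "fmor G Q (fob F T) (?c \<pi>) = fmor G Q (fob F T) (?c ?z)"
    proof (rule gr_hom_eqI[OF Gc[OF \<pi>(1)] Gc[OF z]])
      fix y assume y: "y \<in> carrier (fob G Q)"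
      then show "fmor G Q (fob F T) (?c \<pi>) y = fmor G Q (fob F T) (?c ?z) y"
        using via[OF \<pi>(1), of y] via[OF z, of y] * gr_homD(1)[OF Gc[OF \<pi>(1)] y] gr_homD(1)[OF Gc[OF z] y]
          inj_onD[OF \<eta>T_inj] by (simp add: R_def)
    qed
    from GrMod_equivalence_faithful[OF equivG QM FT c[OF \<pi>(1)] c[OF z] this]
    have "?c \<pi> q = ?c ?z q" by simp
    then show False using x_ne qc g(2) by (simp add: compose_def)
  qed
  then obtain y where y: "y \<in> carrier R" "\<pi> (\<rho> y) \<noteq> \<zero>\<^bsub>T\<^esub>"
    using gr_homD(1)[OF \<rho>] by (auto simp: zero_map_def)
  \<comment> \<open>The map \<open>\<rho>\<close> hits the generator.\<close>
  have \<pi>\<rho>: "compose (carrier R) \<pi> \<rho> \<in> gr_hom R T" by (rule gr_hom_compose[OF RM \<rho> \<pi>(1)])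
  have scal\<pi>: "\<pi> (scal A c 1 \<odot>\<^bsub>P\<^esub> p) = scal A c 1 \<odot>\<^bsub>T\<^esub> p" for c using gr_homD(4)[OF \<pi>(1) pc] \<pi>(2) by simp
  obtain c where c: "\<pi> (\<rho> y) = scal A c 1 \<odot>\<^bsub>T\<^esub> p"
    using vertex_lineD(5)[OF T gr_homD(1)[OF \<pi>(1) gr_homD(1)[OF \<rho> y(1)]]] by blast
  have "compose (carrier R) \<pi> \<rho> y \<in> vpart A T i n"
    using c T.scal_vpart[OF A vertex_lineD(2)[OF T]] y(1) by (simp add: compose_def)
  from gr_hom_lift_vpart[OF A RM TM \<pi>\<rho> y(1) i this]
  obtain y' where y': "y' \<in> vpart A R i n" "\<pi> (\<rho> y') = \<pi> (\<rho> y)"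
    using vpartD(3)[OF _ RM] y(1) by (auto simp: compose_def)
  have y'c: "y' \<in> carrier R" by (rule vpartD(3)[OF y'(1) RM])
  obtain d where d: "\<rho> y' = scal A d 1 \<odot>\<^bsub>P\<^esub> p"
    using vertex_generator_vpart[OF A P i gr_homD(5)[OF \<rho> vpartD(1)[OF y'(1)]]] by blast
  have "d \<noteq> 0"
  proof
    assume "d = 0"
    then have "\<pi> (\<rho> y) = \<zero>\<^bsub>T\<^esub>"
      using y'(2) d scal\<pi>[of d] T.act_zero_left[OF vertex_lineD(3)[OF T]] by simp
    then show False using y(2) by simp
  qed
  define x0 where "x0 = scal A (inverse d) 1 \<odot>\<^bsub>R\<^esub> y'"
  have x0: "x0 \<in> vpart A R i n" unfolding x0_def by (rule R.scal_vpart[OF A y'(1)])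
  have "\<rho> x0 = (scal A (inverse d) 1 * scal A d 1) \<odot>\<^bsub>P\<^esub> p"
    unfolding x0_def using gr_homD(4)[OF \<rho> y'c] d P.act_assoc[OF pc] by simp
  also have "scal A (inverse d) 1 * scal A d 1 = 1" using \<open>d \<noteq> 0\<close> by (simp add: A.scal_one_mult)
  finally have \<rho>x0: "\<rho> x0 = p" using P.act_one[OF pc] by simp
  obtain s where s: "s \<in> gr_hom P R" "s p = x0" using vertex_generator_hom[OF P RM x0] by blast
  have \<rho>s_id: "compose (carrier P) \<rho> s = (\<lambda>x\<in>carrier P. x)"
    by (rule vertex_generator_hom_unique[OF P gr_hom_compose[OF PM s(1) \<rho>] gr_hom_id[OF PM]])
      (use s \<rho>x0 pc in \<open>simp add: compose_def\<close>)
  have \<rho>s: "\<rho> (s x) = x" if "x \<in> carrier P" for x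
    using fun_cong[OF \<rho>s_id, of x] that by (simp add: compose_def)
  \<comment> \<open>The idempotent \<open>s \<circ> \<rho>\<close> of \<open>G(Q)\<close> comes from a scalar \<open>e\<close> with \<open>e\<^sup>2 = e\<close>.\<close>
  let ?u = "compose (carrier R) s \<rho>"
  have u: "?u \<in> gr_hom R R" by (rule gr_hom_compose[OF RM \<rho> s(1)])
  then obtain w where w: "w \<in> gr_hom Q Q" "fmor G Q Q w = ?u"
    using GrMod_equivalence_full[OF equivG QM QM, of ?u] unfolding R_def by blast
  have ev: "\<exists>e. h q = scal B e 1 \<odot>\<^bsub>Q\<^esub> q" if "h \<in> gr_hom Q Q" for h
    using vertex_generator_vpart[OF B Q j gr_homD(5)[OF that vpartD(1)[OF vertex_generatorD(2)[OF Q]]]] .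
  obtain e where e: "w q = scal B e 1 \<odot>\<^bsub>Q\<^esub> q" using ev[OF w(1)] by blast
  have ww: "compose (carrier Q) w w \<in> gr_hom Q Q" by (rule gr_hom_compose[OF QM w(1) w(1)])
  have "fmor G Q Q (compose (carrier Q) w w) = compose (carrier R) ?u ?u"
    using G(4)[OF QM QM QM w(1) w(1)] w(2) by (simp add: R_def)
  also have "\<dots> = ?u"
    by (rule gr_hom_eqI[OF gr_hom_compose[OF RM u u] u])
      (use \<rho>s gr_homD(1)[OF \<rho>] gr_homD(1)[OF u] in \<open>simp add: compose_def\<close>)
  finally have "compose (carrier Q) w w = w"
    using GrMod_equivalence_faithful[OF equivG QM QM ww w(1)] w(2) by simp
  then have "w (w q) = w q" using qc by (metis compose_eq)
  then have "(scal B e 1 * scal B e 1) \<odot>\<^bsub>Q\<^esub> q = scal B e 1 \<odot>\<^bsub>Q\<^esub> q"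
    using e gr_homD(4)[OF w(1) qc] Q.act_assoc[OF qc] by simp
  from vertex_generatorD(6)[OF Q Q.act_diff_eq_zero[OF qc this]]
  have "scal B (e * e - e) (idem B j) = 0" by (simp add: B.scal_one_mult B.scale_left_diff_distrib left_diff_distrib)
  then have "e * e - e = 0" using B.idem_nonzero[OF j] by (simp add: B.scale_eq_0_iff)
  then have "e * (e - 1) = 0" by (simp add: algebra_simps)
  then consider "e = 0" | "e = 1" by auto
  then show ?thesis
  proof cases
    case 1
    \<comment> \<open>If \<open>w q = 0\<close>, then \<open>w \<circ> v = w\<close> for the endomorphism \<open>v\<close> of \<open>Q\<close> with \<open>G v = 0\<close>; hence \<open>s \<circ> \<rho> = 0\<close>.\<close>
    let ?o = "zero_map R R"
    have o: "?o \<in> gr_hom R R" by (rule zero_map[OF RM RM])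
    then obtain v where v: "v \<in> gr_hom Q Q" "fmor G Q Q v = ?o"
      using GrMod_equivalence_full[OF equivG QM QM, of ?o] unfolding R_def by blast
    obtain e' where e': "v q = scal B e' 1 \<odot>\<^bsub>Q\<^esub> q" using ev[OF v(1)] by blast
    have wq: "w q = \<zero>\<^bsub>Q\<^esub>" using e 1 Q.act_zero_left[OF qc] by simp
    have "compose (carrier Q) w v = w"
      by (rule vertex_generator_hom_unique[OF Q gr_hom_compose[OF QM v(1) w(1)] w(1)])
        (use qc e' gr_homD(4)[OF w(1) qc] wq Q.act_zero_right in \<open>simp add: compose_def\<close>)
    then have "compose (carrier R) ?u ?o = ?u"
      using G(4)[OF QM QM QM v(1) w(1)] w(2) v(2) by (simp add: R_def)
    then have "?u (?o x0) = ?u x0" using vpartD(3)[OF x0 RM] by (metis compose_eq)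
    then have "?u \<zero>\<^bsub>R\<^esub> = x0" using vpartD(3)[OF x0 RM] s(2) \<rho>x0 by (simp add: zero_map_def compose_def)
    then have "x0 = \<zero>\<^bsub>R\<^esub>" using gr_hom_zero[OF RM RM u] by simp
    then have "p = \<zero>\<^bsub>P\<^esub>" using \<rho>x0 gr_hom_zero[OF RM PM \<rho>] by simp
    then show ?thesis using vertex_generator_nonzero[OF A P i] by simp
  next
    case 2
    have "w = (\<lambda>x\<in>carrier Q. x)"
      by (rule vertex_generator_hom_unique[OF Q w(1) gr_hom_id[OF QM]])
        (use e 2 qc Q.act_one in simp)
    then have uid: "?u = (\<lambda>x\<in>carrier R. x)" using G(3)[OF QM] w(2) by (simp add: R_def)
    have "s (\<rho> x) = x" if "x \<in> carrier R" for x
      using fun_cong[OF uid, of x] that by (simp add: compose_def)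
    then have "bij_betw s (carrier P) (carrier R)"
      using \<rho>s gr_homD(1)[OF \<rho>] gr_homD(1)[OF s(1)] by (intro bij_betwI[of _ _ _ \<rho>]) auto
    then have "is_iso_in (GrMod A) P R s" using is_iso_in_GrMod[OF PM RM] s(1) by simp
    then have "is_iso_in (GrMod B) (fob F P) (fob F R) (fmor F P R s)"
      using functor_iso[OF GrMod_equivalence_functor[OF equiv]] PM RM by simp
    moreover have "is_iso_in (GrMod B) (fob F R) Q (\<theta> Q)" unfolding R_def using \<theta> QM by simp
    ultimately obtain h where "is_iso_in (GrMod B) (fob F P) Q h"
      using category.iso_in_trans[OF category_GrMod, of "fob F P" B "fob F R" Q] FP F(1)[OF RM] QM by auto
    then obtain k where "is_iso_in (GrMod B) Q (fob F P) k" using iso_in_sym by metis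
    then have "vertex_generator B (fob F P) j m (k q)"
      using is_iso_in_GrMod[OF QM FP] vertex_generator_transport[OF Q FP] by blast
    with j show ?thesis by blast
  qed
qed

section \<open>Transfer of vertex components along a graded Morita equivalence\<close>

lemma hom_add_gr_hom:
  assumes M: "graded_module A M" and N: "graded_module A N" and f: "f \<in> gr_hom M N" and g: "g \<in> gr_hom M N"
  shows "hom_add M N f g \<in> gr_hom M N"
proof -
  interpret M: graded_module A M by fact
  interpret N: graded_module A N by fact
  note fD = gr_homD[OF f] and gD = gr_homD[OF g]
  show ?thesis
  proof (rule gr_homI)
    show "hom_add M N f g \<in> extensional (carrier M)" by (simp add: hom_add_def)
    fix x assume x: "x \<in> carrier M"
    show "hom_add M N f g x \<in> carrier N" using x fD(1) gD(1) by (simp add: hom_add_def)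
    show "hom_add M N f g (a \<odot>\<^bsub>M\<^esub> x) = a \<odot>\<^bsub>N\<^esub> hom_add M N f g x" for a
      using x fD(1,4) gD(1,4) by (simp add: hom_add_def M.act_closed N.act_add_right)
    fix y assume y: "y \<in> carrier M"
    show "hom_add M N f g (x \<oplus>\<^bsub>M\<^esub> y) = hom_add M N f g x \<oplus>\<^bsub>N\<^esub> hom_add M N f g y"
      using x y fD(1,3) gD(1,3) by (simp add: hom_add_def N.a_ac)
  next
    fix n x assume x: "x \<in> gpart M n"
    then show "hom_add M N f g x \<in> gpart N n"
      using M.gpart_carrier[OF x] fD(5) gD(5) N.gpart_add by (simp add: hom_add_def)
  qed
qed

lemma hom_scale_gr_hom:
  assumes A: "elementary_graded_algebra A" and M: "graded_module A M" and N: "graded_module A N"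
    and f: "f \<in> gr_hom M N"
  shows "hom_scale A M N c f \<in> gr_hom M N"
proof -
  interpret A: elementary_graded_algebra A by fact
  interpret M: graded_module A M by fact
  interpret N: graded_module A N by fact
  note fD = gr_homD[OF f]
  show ?thesis
  proof (rule gr_homI)
    show "hom_scale A M N c f \<in> extensional (carrier M)" by (simp add: hom_scale_def)
    fix x assume x: "x \<in> carrier M"
    show "hom_scale A M N c f x \<in> carrier N" using x fD(1) by (simp add: hom_scale_def N.act_closed)
    show "hom_scale A M N c f (a \<odot>\<^bsub>M\<^esub> x) = a \<odot>\<^bsub>N\<^esub> hom_scale A M N c f x" for a
      using x fD(1)[OF x] fD(4)[OF x]
      by (simp add: hom_scale_def M.act_closed N.act_assoc[symmetric] A.scal_one_mult A.mult_scal_one)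
    fix y assume y: "y \<in> carrier M"
    show "hom_scale A M N c f (x \<oplus>\<^bsub>M\<^esub> y) = hom_scale A M N c f x \<oplus>\<^bsub>N\<^esub> hom_scale A M N c f y"
      using x y fD(1,3) by (simp add: hom_scale_def N.act_add_right)
  next
    fix n x assume x: "x \<in> gpart M n"
    then show "hom_scale A M N c f x \<in> gpart N n"
      using M.gpart_carrier[OF x] N.gpart_act[OF A.scal_one_deg fD(5)[OF x]] by (simp add: hom_scale_def)
  qed
qed

text \<open>An equivalence with \<open>F(A e\<^sub>i\<langle>n\<rangle>) \<cong> B f\<^bsub>\<sigma> i\<^esub>\<langle>n + m i\<rangle>\<close>. Asking this for all \<open>n\<close> takes the place
  of the commutation of \<open>F\<close> with shifts.\<close>

locale vertex_matching =
  A: elementary_graded_algebra A + B: elementary_graded_algebra B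
  for A :: "('k :: field, 'a :: {ring, monoid_mult}) graded_algebra"
    and B :: "('k, 'b :: {ring, monoid_mult}) graded_algebra" +
  fixes F :: "(('a, 'u) gmodule, 'u \<Rightarrow> 'u, ('b, 'u) gmodule, 'u \<Rightarrow> 'u) cfunctor"
    and \<sigma> :: "nat \<Rightarrow> nat" and m :: "nat \<Rightarrow> int"
  assumes embeds: "\<exists>\<iota> :: 'a \<Rightarrow> 'u. inj \<iota>"
    and equiv: "is_equivalence (GrMod A) (GrMod B) F" and linear: "linear_functor A B F"
    and \<sigma>: "bij_betw \<sigma> {..<rk A} {..<rk B}"
    and ex_gen: "\<And>P i n p. vertex_generator A P i n p \<Longrightarrow> i < rk A \<Longrightarrow>
        \<exists>q. vertex_generator B (fob F P) (\<sigma> i) (n + m i) q"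
begin

lemmas F = GrMod_functorD[OF GrMod_equivalence_functor[OF equiv]]
lemmas faithful = GrMod_equivalence_faithful[OF equiv]
lemmas full = GrMod_equivalence_full[OF equiv]

lemma \<sigma>_less: "i < rk A \<Longrightarrow> \<sigma> i < rk B"
  using bij_betw_apply[OF \<sigma>] by simp

lemma \<sigma>_surj: "j < rk B \<Longrightarrow> \<exists>i < rk A. j = \<sigma> i"
  using bij_betw_imp_surj_on[OF \<sigma>] by (metis imageE lessThan_iff)

lemma F_add: "\<lbrakk>graded_module A M; graded_module A N; f \<in> gr_hom M N; g \<in> gr_hom M N\<rbrakk> \<Longrightarrow>
    fmor F M N (hom_add M N f g) = hom_add (fob F M) (fob F N) (fmor F M N f) (fmor F M N g)"
  and F_scale: "\<lbrakk>graded_module A M; graded_module A N; f \<in> gr_hom M N\<rbrakk> \<Longrightarrow>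
    fmor F M N (hom_scale A M N c f) = hom_scale B (fob F M) (fob F N) c (fmor F M N f)"
  using linear unfolding linear_functor_def by simp_all

lemma F_zero:
  assumes M: "graded_module A M" and N: "graded_module A N"
  shows "fmor F M N (zero_map M N) = zero_map (fob F M) (fob F N)"
proof -
  interpret N: graded_module A N by fact
  interpret FN: graded_module B "fob F N" by (rule F(1)[OF N])
  note z = zero_map[OF M N]
  have "hom_scale A M N 0 (zero_map M N) = zero_map M N"
    by (auto simp: hom_scale_def zero_map_def N.act_zero_right fun_eq_iff)
  then have "fmor F M N (zero_map M N) = hom_scale B (fob F M) (fob F N) 0 (fmor F M N (zero_map M N))"
    using F_scale[OF M N z, of 0] by simp
  also have "\<dots> = zero_map (fob F M) (fob F N)"
    using gr_homD(1)[OF F(2)[OF M N z]] by (auto simp: hom_scale_def zero_map_def FN.act_zero_left fun_eq_iff)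
  finally show ?thesis .
qed

text \<open>Fixed copies of the \<open>A e\<^sub>i\<langle>n\<rangle>\<close> in the universe, and generators of their images.\<close>

definition proj :: "nat \<Rightarrow> int \<Rightarrow> ('a, 'u) gmodule" where
  "proj i n = (SOME P. \<exists>p. vertex_generator A P i n p)"
definition gen :: "nat \<Rightarrow> int \<Rightarrow> 'u" where
  "gen i n = (SOME p. vertex_generator A (proj i n) i n p)"
definition img :: "nat \<Rightarrow> int \<Rightarrow> 'u" where
  "img i n = (SOME q. vertex_generator B (fob F (proj i n)) (\<sigma> i) (n + m i) q)"

lemma gen: "i < rk A \<Longrightarrow> vertex_generator A (proj i n) i n (gen i n)"
  unfolding gen_def proj_def
  by (rule someI_ex, rule someI_ex, rule ex_vertex_generator[OF A.elementary_graded_algebra_axioms embeds])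

lemma img: "i < rk A \<Longrightarrow> vertex_generator B (fob F (proj i n)) (\<sigma> i) (n + m i) (img i n)"
  unfolding img_def by (rule someI_ex, rule ex_gen[OF gen])

definition yoneda :: "('a, 'u) gmodule \<Rightarrow> nat \<Rightarrow> int \<Rightarrow> 'u \<Rightarrow> 'u \<Rightarrow> 'u" where
  "yoneda M i n x = (SOME \<phi>. \<phi> \<in> gr_hom (proj i n) M \<and> \<phi> (gen i n) = x)"

lemma yoneda:
  assumes "graded_module A M" "i < rk A" "x \<in> vpart A M i n"
  shows "yoneda M i n x \<in> gr_hom (proj i n) M" "yoneda M i n x (gen i n) = x"
proof -
  have "\<exists>\<phi>. \<phi> \<in> gr_hom (proj i n) M \<and> \<phi> (gen i n) = x"
    using vertex_generator_hom[OF gen[OF assms(2)] assms(1,3)] by blast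
  from someI_ex[OF this]
  have "yoneda M i n x \<in> gr_hom (proj i n) M \<and> yoneda M i n x (gen i n) = x"
    unfolding yoneda_def .
  then show "yoneda M i n x \<in> gr_hom (proj i n) M" "yoneda M i n x (gen i n) = x" by blast+
qed

lemma yoneda_eqI:
  assumes "graded_module A M" "i < rk A" "\<phi> \<in> gr_hom (proj i n) M"
  shows "yoneda M i n (\<phi> (gen i n)) = \<phi>"
proof -
  note g = gen[OF assms(2), of n]
  note x = gr_hom_vpart[OF vertex_generatorD(1)[OF g] assms(3) vertex_generatorD(2)[OF g]]
  show ?thesis
    by (rule vertex_generator_hom_unique[OF g yoneda(1)[OF assms(1,2) x] assms(3) yoneda(2)[OF assms(1,2) x]])
qed

text \<open>The transfer map \<open>e\<^sub>i M\<^sub>n = Hom(A e\<^sub>i\<langle>n\<rangle>, M) \<rightarrow> Hom(F(A e\<^sub>i\<langle>n\<rangle>), F M) = f\<^bsub>\<sigma> i\<^esub> (F M)\<^bsub>n + m i\<^esub>\<close>.\<close>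

definition \<tau> :: "('a, 'u) gmodule \<Rightarrow> nat \<Rightarrow> int \<Rightarrow> 'u \<Rightarrow> 'u" where
  "\<tau> M i n x = fmor F (proj i n) M (yoneda M i n x) (img i n)"

context
  fixes i :: nat and n :: int
  assumes i: "i < rk A"
begin

lemmas genD = vertex_generatorD[OF gen[OF i, of n]]
lemmas imgD = vertex_generatorD[OF img[OF i, of n]]

lemma \<tau>_eqI:
  assumes "graded_module A M" "\<phi> \<in> gr_hom (proj i n) M"
  shows "\<tau> M i n (\<phi> (gen i n)) = fmor F (proj i n) M \<phi> (img i n)"
  unfolding \<tau>_def yoneda_eqI[OF assms(1) i assms(2)] ..

lemma \<tau>_bij:
  assumes M: "graded_module A M"
  shows "bij_betw (\<tau> M i n) (vpart A M i n) (vpart B (fob F M) (\<sigma> i) (n + m i))"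
  unfolding bij_betw_def
proof (intro conjI inj_onI equalityI subsetI)
  note y = yoneda[OF M i]
  note Fy = F(2)[OF genD(1) M y(1)]
  show "x = x'" if x: "x \<in> vpart A M i n" and x': "x' \<in> vpart A M i n" and eq: "\<tau> M i n x = \<tau> M i n x'" for x x'
  proof -
    have "fmor F (proj i n) M (yoneda M i n x) = fmor F (proj i n) M (yoneda M i n x')"
      by (rule vertex_generator_hom_unique[OF img[OF i] Fy[OF x] Fy[OF x']]) (use eq in \<open>simp add: \<tau>_def\<close>)
    from faithful[OF genD(1) M y(1)[OF x] y(1)[OF x'] this] have "yoneda M i n x (gen i n) = yoneda M i n x' (gen i n)" by (rule fun_cong)
    then show ?thesis unfolding y(2)[OF x] y(2)[OF x'] .
  qed
  show "z \<in> vpart B (fob F M) (\<sigma> i) (n + m i)" if z: "z \<in> \<tau> M i n ` vpart A M i n" for z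
  proof -
    obtain x where x: "x \<in> vpart A M i n" "z = \<tau> M i n x" using z by blast
    show ?thesis unfolding x(2) \<tau>_def by (rule gr_hom_vpart[OF imgD(1) Fy[OF x(1)] imgD(2)])
  qed
  show "z \<in> \<tau> M i n ` vpart A M i n" if z: "z \<in> vpart B (fob F M) (\<sigma> i) (n + m i)" for z
  proof -
    obtain \<psi> where \<psi>: "\<psi> \<in> gr_hom (fob F (proj i n)) (fob F M)" "\<psi> (img i n) = z"
      using vertex_generator_hom[OF img[OF i] F(1)[OF M] z] by blast
    obtain \<phi> where \<phi>: "\<phi> \<in> gr_hom (proj i n) M" "fmor F (proj i n) M \<phi> = \<psi>"
      using full[OF genD(1) M \<psi>(1)] by blast
    have "\<tau> M i n (\<phi> (gen i n)) = z" using \<tau>_eqI[OF M \<phi>(1)] \<phi>(2) \<psi>(2) by simp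
    then show ?thesis using gr_hom_vpart[OF genD(1) \<phi>(1) genD(2)] by blast
  qed
qed

lemma \<tau>_natural:
  assumes M: "graded_module A M" and N: "graded_module A N" and f: "f \<in> gr_hom M N" and x: "x \<in> vpart A M i n"
  shows "\<tau> N i n (f x) = fmor F M N f (\<tau> M i n x)"
proof -
  note y = yoneda[OF M i x]
  have "\<tau> N i n (compose (carrier (proj i n)) f (yoneda M i n x) (gen i n)) =
      compose (carrier (fob F (proj i n))) (fmor F M N f) (fmor F (proj i n) M (yoneda M i n x)) (img i n)"
    using \<tau>_eqI[OF N gr_hom_compose[OF genD(1) y(1) f]] F(4)[OF genD(1) M N y(1) f] by simp
  then show ?thesis using genD(3) imgD(3) y(2) by (simp add: compose_def \<tau>_def)
qed

lemma \<tau>_add: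
  assumes M: "graded_module A M" and x: "x \<in> vpart A M i n" and y: "y \<in> vpart A M i n"
  shows "\<tau> M i n (x \<oplus>\<^bsub>M\<^esub> y) = \<tau> M i n x \<oplus>\<^bsub>fob F M\<^esub> \<tau> M i n y"
  using \<tau>_eqI[OF M hom_add_gr_hom[OF genD(1) M yoneda(1)[OF M i x] yoneda(1)[OF M i y]]]
    F_add[OF genD(1) M yoneda(1)[OF M i x] yoneda(1)[OF M i y]] genD(3) imgD(3)
    yoneda(2)[OF M i x] yoneda(2)[OF M i y]
  by (simp add: hom_add_def \<tau>_def)

lemma \<tau>_scal:
  assumes M: "graded_module A M" and x: "x \<in> vpart A M i n"
  shows "\<tau> M i n (scal A c 1 \<odot>\<^bsub>M\<^esub> x) = scal B c 1 \<odot>\<^bsub>fob F M\<^esub> \<tau> M i n x"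
  using \<tau>_eqI[OF M hom_scale_gr_hom[OF A.elementary_graded_algebra_axioms genD(1) M yoneda(1)[OF M i x]]]
    F_scale[OF genD(1) M yoneda(1)[OF M i x]] genD(3) imgD(3) yoneda(2)[OF M i x]
  by (simp add: hom_scale_def \<tau>_def)

lemma \<tau>_zero:
  assumes M: "graded_module A M"
  shows "\<tau> M i n \<zero>\<^bsub>M\<^esub> = \<zero>\<^bsub>fob F M\<^esub>"
  using \<tau>_eqI[OF M zero_map[OF genD(1) M]] F_zero[OF genD(1) M] genD(3) imgD(3)
  by (simp add: zero_map_def)

end

text \<open>Transfer turns multiplication by \<open>a\<close> into multiplication by the element of \<open>B\<close> which
  describes the image of the corresponding map between vertex projectives.\<close>

lemma \<tau>_act:
  assumes M: "graded_module A M" and i: "i < rk A" and l: "l < rk A"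
    and a: "a \<in> deg A k" "idem A l * a = a" and x: "x \<in> vpart A M i n"
  shows "\<exists>b. \<tau> M l (int k + n) (a \<odot>\<^bsub>M\<^esub> x) = b \<odot>\<^bsub>fob F M\<^esub> \<tau> M i n x"
proof -
  let ?P = "proj i n" and ?Q = "proj l (int k + n)"
  note PD = genD[where n = n, OF i] and QD = genD[where n = "int k + n", OF l]
  interpret P: graded_module A ?P by (rule PD(1))
  note y = yoneda[OF M i x]
  have ap: "a \<odot>\<^bsub>?P\<^esub> gen i n \<in> vpart A ?P l (int k + n)"
    by (rule P.act_vpart[OF A.elementary_graded_algebra_axioms l a vpartD(1)[OF PD(2)]])
  note z = yoneda[OF PD(1) l ap]
  let ?\<psi> = "yoneda ?P l (int k + n) (a \<odot>\<^bsub>?P\<^esub> gen i n)"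
  have "\<tau> M l (int k + n) (a \<odot>\<^bsub>M\<^esub> x) = \<tau> M l (int k + n) (compose (carrier ?Q) (yoneda M i n x) ?\<psi> (gen l (int k + n)))"
    using QD(3) z(2) gr_homD(4)[OF y(1) PD(3), of a] y(2) by (simp add: compose_def)
  also have "\<dots> = fmor F ?P M (yoneda M i n x) (fmor F ?Q ?P ?\<psi> (img l (int k + n)))"
    using \<tau>_eqI[OF l M gr_hom_compose[OF QD(1) z(1) y(1)]] F(4)[OF QD(1) PD(1) M z(1) y(1)]
      imgD(3)[where n = "int k + n", OF l] by (simp add: compose_def)
  also obtain b where "fmor F ?Q ?P ?\<psi> (img l (int k + n)) = b \<odot>\<^bsub>fob F ?P\<^esub> img i n"
    using imgD(4)[OF i gr_homD(1)[OF F(2)[OF QD(1) PD(1) z(1)] imgD(3)[OF l]]] by blast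
  also have "fmor F ?P M (yoneda M i n x) (b \<odot>\<^bsub>fob F ?P\<^esub> img i n) = b \<odot>\<^bsub>fob F M\<^esub> \<tau> M i n x"
    using gr_homD(4)[OF F(2)[OF PD(1) M y(1)] imgD(3)[OF i]] by (simp add: \<tau>_def)
  finally show ?thesis by blast
qed

lemma vpart_imageE:
  assumes M: "graded_module A M" and j: "j < rk B" and y: "y \<in> vpart B (fob F M) j k"
  obtains i n x where "i < rk A" "j = \<sigma> i" "k = n + m i" "x \<in> vpart A M i n" "y = \<tau> M i n x"
proof -
  obtain i where i: "i < rk A" "j = \<sigma> i" using \<sigma>_surj[OF j] by blast
  have "y \<in> \<tau> M i (k - m i) ` vpart A M i (k - m i)"
    using bij_betw_imp_surj_on[OF \<tau>_bij[OF i(1) M, of "k - m i"]] y i(2) by simp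
  then show thesis using that[of i "k - m i"] i by auto
qed

text \<open>By naturality, the transfer maps carry the exactness of \<open>L \<rightarrow> M \<rightarrow> N\<close> at the vertex components
  of \<open>M\<close> to exactness at those of \<open>F M\<close>, and the kernel of \<open>F g\<close> is the sum of its vertex
  components.\<close>

lemma F_exact:
  assumes L: "graded_module A L" and M: "graded_module A M" and N: "graded_module A N"
    and f: "f \<in> gr_hom L M" and g: "g \<in> gr_hom M N"
    and exact: "f ` carrier L = {x \<in> carrier M. g x = \<zero>\<^bsub>N\<^esub>}"
  shows "fmor F L M f ` carrier (fob F L) = {x \<in> carrier (fob F M). fmor F M N g x = \<zero>\<^bsub>fob F N\<^esub>}"
proof (intro equalityI subsetI)
  note FL = F(1)[OF L] and FM = F(1)[OF M] and FN = F(1)[OF N]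
  note Ff = F(2)[OF L M f] and Fg = F(2)[OF M N g]
  interpret FL: graded_module B "fob F L" by (rule FL)
  have "compose (carrier L) g f = zero_map L N"
    by (rule gr_hom_eqI[OF gr_hom_compose[OF L f g] zero_map[OF L N]])
      (use exact in \<open>auto simp: compose_def zero_map_def\<close>)
  then have gf: "compose (carrier (fob F L)) (fmor F M N g) (fmor F L M f) = zero_map (fob F L) (fob F N)"
    using F(4)[OF L M N f g] F_zero[OF L N] by simp
  show "y \<in> {x \<in> carrier (fob F M). fmor F M N g x = \<zero>\<^bsub>fob F N\<^esub>}" if y: "y \<in> fmor F L M f ` carrier (fob F L)" for y
  proof -
    obtain x where x: "x \<in> carrier (fob F L)" "y = fmor F L M f x" using y by blast
    then show ?thesis using fun_cong[OF gf, of x] gr_homD(1)[OF Ff] by (simp add: compose_def zero_map_def)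
  qed
  show "y \<in> fmor F L M f ` carrier (fob F L)" if "y \<in> {x \<in> carrier (fob F M). fmor F M N g x = \<zero>\<^bsub>fob F N\<^esub>}" for y
  proof -
    have y: "y \<in> carrier (fob F M)" "fmor F M N g y = \<zero>\<^bsub>fob F N\<^esub>" using that by auto
    show ?thesis
      using B.elementary_graded_algebra_axioms FM FN Fg y
    proof (induction y rule: kernel_induct)
      case zero
      show ?case using gr_hom_zero[OF FL FM Ff] FL.zero_closed by (metis imageI)
    next
      case (add x y)
      then obtain u v where uv: "u \<in> carrier (fob F L)" "v \<in> carrier (fob F L)" "x = fmor F L M f u" "y = fmor F L M f v"
        by blast
      then have "x \<oplus>\<^bsub>fob F M\<^esub> y = fmor F L M f (u \<oplus>\<^bsub>fob F L\<^esub> v)" using gr_homD(3)[OF Ff] by simp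
      then show ?case using uv by blast
    next
      case (vpart j k y)
      obtain i n x where i: "i < rk A" and "j = \<sigma> i" "k = n + m i"
        and x: "x \<in> vpart A M i n" and y: "y = \<tau> M i n x" by (rule vpart_imageE[OF M vpart(1,2)])
      have gx: "g x \<in> vpart A N i n" by (rule gr_hom_vpart[OF M g x])
      have "\<tau> N i n (g x) = \<tau> N i n \<zero>\<^bsub>N\<^esub>"
        using \<tau>_natural[OF i M N g x] \<tau>_zero[OF i N] vpart(3) y by simp
      then have "g x = \<zero>\<^bsub>N\<^esub>"
        by (rule inj_onD[OF bij_betw_imp_inj_on[OF \<tau>_bij[OF i N]] _ gx graded_module.zero_vpart[OF N]])
      then have "x \<in> f ` carrier L" unfolding exact using vpartD(3)[OF x M] by simp
      then obtain z where z: "z \<in> carrier L" "f z = x" by blast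
      then obtain w where w: "w \<in> vpart A L i n" "f w = x"
        using gr_hom_lift_vpart[OF A.elementary_graded_algebra_axioms L M f z(1) i] x by auto
      have "y = fmor F L M f (\<tau> L i n w)" using \<tau>_natural[OF i L M f w(1)] w(2) y by simp
      moreover have "\<tau> L i n w \<in> carrier (fob F L)"
        using bij_betw_apply[OF \<tau>_bij[OF i L] w(1)] vpartD(3)[OF _ FL] by blast
      ultimately show ?case by blast
    qed
  qed
qed

lemma F_surj:
  assumes M: "graded_module A M" and N: "graded_module A N" and f: "f \<in> gr_hom M N"
    and surj: "f ` carrier M = carrier N"
  shows "fmor F M N f ` carrier (fob F M) = carrier (fob F N)"
  using F_exact[OF M N N f zero_map[OF N N]] surj F_zero[OF N N] by (simp add: zero_map_def)

text \<open>Surjectivity, too, can be tested on vertex components; this direction turns lifting problems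
  over \<open>B\<close> into lifting problems over \<open>A\<close>.\<close>

lemma F_reflects_surj:
  assumes M: "graded_module A M" and N: "graded_module A N" and f: "f \<in> gr_hom M N"
    and surj: "fmor F M N f ` carrier (fob F M) = carrier (fob F N)"
  shows "f ` carrier M = carrier N"
proof
  show "f ` carrier M \<subseteq> carrier N" using gr_homD(1)[OF f] by blast
  show "carrier N \<subseteq> f ` carrier M"
  proof
    interpret M: graded_module A M by fact
    fix y assume "y \<in> carrier N"
    with A.elementary_graded_algebra_axioms N show "y \<in> f ` carrier M"
    proof (induction y rule: vpart_induct)
      case zero
      show ?case using gr_hom_zero[OF M N f] M.zero_closed by (metis imageI)
    next
      case (add x y)
      then obtain u v where uv: "u \<in> carrier M" "v \<in> carrier M" "x = f u" "y = f v" by blast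
      then have "x \<oplus>\<^bsub>N\<^esub> y = f (u \<oplus>\<^bsub>M\<^esub> v)" using gr_homD(3)[OF f] by simp
      then show ?case using uv by blast
    next
      case (vpart i n y)
      note FM = F(1)[OF M] and FN = F(1)[OF N] and Ff = F(2)[OF M N f]
      have \<tau>y: "\<tau> N i n y \<in> vpart B (fob F N) (\<sigma> i) (n + m i)"
        by (rule bij_betw_apply[OF \<tau>_bij[OF vpart(1) N] vpart(2)])
      have "\<tau> N i n y \<in> fmor F M N f ` carrier (fob F M)" unfolding surj by (rule vpartD(3)[OF \<tau>y FN])
      then obtain z where z: "\<tau> N i n y = fmor F M N f z" "z \<in> carrier (fob F M)" by (rule imageE)
      obtain w where w: "w \<in> vpart B (fob F M) (\<sigma> i) (n + m i)" "fmor F M N f w = \<tau> N i n y"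
        using gr_hom_lift_vpart[OF B.elementary_graded_algebra_axioms FM FN Ff z(2) \<sigma>_less[OF vpart(1)] \<tau>y[unfolded z(1)]]
        unfolding z(1) by blast
      obtain x where x: "x \<in> vpart A M i n" "w = \<tau> M i n x"
        using bij_betw_imp_surj_on[OF \<tau>_bij[OF vpart(1) M]] w(1) by blast
      have "\<tau> N i n (f x) = \<tau> N i n y" using \<tau>_natural[OF vpart(1) M N f x(1)] w(2) x(2) by simp
      then have "f x = y"
        by (rule inj_onD[OF bij_betw_imp_inj_on[OF \<tau>_bij[OF vpart(1) N]] _ gr_hom_vpart[OF M f x(1)] vpart(2)])
      then show ?case using vpartD(3)[OF x(1) M] by blast
    qed
  qed
qed

text \<open>The vertex components of \<open>F T\<close> are the transfers of those of \<open>T\<close>, of which only the one at \<open>i\<close>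
  in degree \<open>n\<close> is nonzero.\<close>

lemma F_vertex_line:
  assumes T: "vertex_line A T i n t" and i: "i < rk A"
  shows "vertex_line B (fob F T) (\<sigma> i) (n + m i) (\<tau> T i n t)"
  unfolding vertex_line_def
proof (intro conjI ballI)
  note TM = vertex_lineD(1)[OF T] and tv = vertex_lineD(2)[OF T] and tc = vertex_lineD(3)[OF T]
  interpret T: graded_module A T by (rule TM)
  show FT: "graded_module B (fob F T)" by (rule F(1)[OF TM])
  interpret FT: graded_module B "fob F T" by (rule FT)
  show \<tau>t: "\<tau> T i n t \<in> vpart B (fob F T) (\<sigma> i) (n + m i)" by (rule bij_betw_apply[OF \<tau>_bij[OF i TM] tv])
  note \<tau>tc = vpartD(3)[OF \<tau>t FT]
  show "\<tau> T i n t \<noteq> \<zero>\<^bsub>fob F T\<^esub>"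
    using inj_onD[OF bij_betw_imp_inj_on[OF \<tau>_bij[OF i TM]] _ tv T.zero_vpart] \<tau>_zero[OF i TM]
      vertex_lineD(4)[OF T] by metis
  fix x assume "x \<in> carrier (fob F T)"
  with B.elementary_graded_algebra_axioms FT show "\<exists>c. x = scal B c 1 \<odot>\<^bsub>fob F T\<^esub> \<tau> T i n t"
  proof (induction x rule: vpart_induct)
    case zero
    show ?case by (rule exI[of _ 0]) (simp add: FT.act_zero_left[OF \<tau>tc])
  next
    case (add x y)
    then obtain c d where "x = scal B c 1 \<odot>\<^bsub>fob F T\<^esub> \<tau> T i n t" "y = scal B d 1 \<odot>\<^bsub>fob F T\<^esub> \<tau> T i n t" by blast
    then have "x \<oplus>\<^bsub>fob F T\<^esub> y = scal B (c + d) 1 \<odot>\<^bsub>fob F T\<^esub> \<tau> T i n t"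
      using FT.act_add_left[OF \<tau>tc] by (simp add: B.scale_left_distrib)
    then show ?case by blast
  next
    case (vpart j k y)
    obtain l n' x where l: "l < rk A" and "j = \<sigma> l" "k = n' + m l"
      and x: "x \<in> vpart A T l n'" and y: "y = \<tau> T l n' x" by (rule vpart_imageE[OF TM vpart(1,2)])
    obtain c where c: "x = scal A c 1 \<odot>\<^bsub>T\<^esub> t" using vertex_lineD(5)[OF T vpartD(3)[OF x TM]] by blast
    show ?case
    proof (cases "x = \<zero>\<^bsub>T\<^esub>")
      case True
      then show ?thesis using y \<tau>_zero[OF l TM] FT.act_zero_left[OF \<tau>tc] by (intro exI[of _ 0]) simp
    next
      case False
      have xi: "x \<in> vpart A T i n" unfolding c by (rule T.scal_vpart[OF A.elementary_graded_algebra_axioms tv])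
      have "n' = n" using False T.gpart_disjoint[OF vpartD(1)[OF x] vpartD(1)[OF xi]] by blast
      moreover have "l = i"
      proof (rule ccontr)
        assume "l \<noteq> i"
        then have "x = (idem A l * idem A i) \<odot>\<^bsub>T\<^esub> x" "idem A l * idem A i = 0"
          using vpartD(2)[OF x] vpartD(2)[OF xi] T.act_assoc[OF vpartD(3)[OF x TM], of "idem A l" "idem A i"]
            A.idem_orthogonal[OF l i] by simp_all
        then show False using False T.act_zero_left[OF vpartD(3)[OF x TM]] by simp
      qed
      ultimately show ?thesis using y c \<tau>_scal[OF i TM tv] by blast
    qed
  qed
qed

end

section \<open>Finite generation, projectivity and resolutions\<close>

text \<open>The submodule generated by \<open>X\<close>. Building it up inductively allows combinations to be
  transferred one term at a time.\<close>

inductive_set mspan :: "('a, 'm) gmodule \<Rightarrow> 'm set \<Rightarrow> 'm set" for M X where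
  zero: "\<zero>\<^bsub>M\<^esub> \<in> mspan M X"
| act: "x \<in> X \<Longrightarrow> a \<odot>\<^bsub>M\<^esub> x \<in> mspan M X"
| add: "x \<in> mspan M X \<Longrightarrow> y \<in> mspan M X \<Longrightarrow> x \<oplus>\<^bsub>M\<^esub> y \<in> mspan M X"

context graded_module
begin

lemma mspan_carrier: "y \<in> mspan M X \<Longrightarrow> X \<subseteq> carrier M \<Longrightarrow> y \<in> carrier M"
  by (induction rule: mspan.induct) (auto simp: act_closed)

lemma mspan_act: "y \<in> mspan M X \<Longrightarrow> X \<subseteq> carrier M \<Longrightarrow> a \<odot> y \<in> mspan M X"
proof (induction rule: mspan.induct)
  case zero
  show ?case using mspan.zero by (simp add: act_zero_right)
next
  case (act x b)
  then show ?case using mspan.act[of x X M "a * b"] by (simp add: act_assoc subsetD)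
next
  case (add x y)
  then show ?case using mspan_carrier by (simp add: act_add_right mspan.add)
qed

lemma mspan_trans: "y \<in> mspan M X \<Longrightarrow> X \<subseteq> mspan M Y \<Longrightarrow> Y \<subseteq> carrier M \<Longrightarrow> y \<in> mspan M Y"
  by (induction rule: mspan.induct) (auto intro: mspan.zero mspan.add mspan_act)

lemma mspan_finite:
  assumes X: "finite X" "X \<subseteq> carrier M"
  shows "y \<in> mspan M X \<longleftrightarrow> (\<exists>c. y = (\<Oplus>x\<in>X. c x \<odot> x))"
proof
  have Xc: "x \<in> carrier M" if "x \<in> X" for x using that X by blast
  show "\<exists>c. y = (\<Oplus>x\<in>X. c x \<odot> x)" if "y \<in> mspan M X"
    using that
  proof (induction rule: mspan.induct)
    case zero
    have "(\<Oplus>x\<in>X. 0 \<odot> x) = (\<Oplus>x\<in>X. \<zero>)" by (rule finsum_cong') (auto simp: act_zero_left Xc)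
    then show ?case by (intro exI[of _ "\<lambda>_. 0"]) simp
  next
    case (act x a)
    have "(\<Oplus>z\<in>X. (if x = z then a else 0) \<odot> z) = (\<Oplus>z\<in>X. if x = z then a \<odot> z else \<zero>)"
      by (rule finsum_cong') (auto simp: act_zero_left act_closed Xc)
    also have "\<dots> = a \<odot> x"
      using add.finprod_singleton[of x X "\<lambda>z. a \<odot> z"] act X Xc by (auto simp: act_closed)
    finally show ?case by metis
  next
    case (add x y)
    then obtain c d where "x = (\<Oplus>z\<in>X. c z \<odot> z)" "y = (\<Oplus>z\<in>X. d z \<odot> z)" by blast
    moreover have "(\<Oplus>z\<in>X. (c z + d z) \<odot> z) = (\<Oplus>z\<in>X. c z \<odot> z \<oplus> d z \<odot> z)"
      by (rule finsum_cong') (auto simp: act_add_left act_closed Xc)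
    moreover have "(\<Oplus>z\<in>X. c z \<odot> z \<oplus> d z \<odot> z) = (\<Oplus>z\<in>X. c z \<odot> z) \<oplus> (\<Oplus>z\<in>X. d z \<odot> z)"
      by (rule finsum_addf) (auto simp: act_closed Xc)
    ultimately show ?case by (intro exI[of _ "\<lambda>z. c z + d z"]) simp
  qed
  assume "\<exists>c. y = (\<Oplus>x\<in>X. c x \<odot> x)"
  then obtain c where y: "y = (\<Oplus>x\<in>X. c x \<odot> x)" by blast
  show "y \<in> mspan M X" unfolding y
    by (rule finsum_induct) (use X Xc in \<open>auto intro: mspan.intros simp: act_closed\<close>)
qed

lemma finitely_generated_mspan:
  "finitely_generated M \<longleftrightarrow> (\<exists>X. finite X \<and> X \<subseteq> carrier M \<and> carrier M \<subseteq> mspan M X)"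
  unfolding finitely_generated_def
  by (intro ex_cong1 conj_cong refl) (simp add: mspan_finite subset_eq[of "carrier M"])

end

text \<open>Each of finitely many generators is the sum of finitely many vertex components, and these
  generate as well.\<close>

lemma finitely_generated_vertex:
  assumes A: "elementary_graded_algebra A" and M: "graded_module A M" and fg: "finitely_generated M"
  shows "\<exists>X v d. finite X \<and> (\<forall>x\<in>X. v x < rk A \<and> x \<in> vpart A M (v x) (d x)) \<and> carrier M \<subseteq> mspan M X"
proof -
  interpret M: graded_module A M by fact
  let ?V = "\<lambda>Y. finite Y \<and> (\<forall>y\<in>Y. \<exists>i n. i < rk A \<and> y \<in> vpart A M i n)"
  have V: "Y \<subseteq> carrier M" if "?V Y" for Y using that vpartD(3)[OF _ M] by blast
  obtain X where X: "finite X" "X \<subseteq> carrier M" "carrier M \<subseteq> mspan M X"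
    using fg M.finitely_generated_mspan by blast
  have ex: "\<exists>Y. ?V Y \<and> x \<in> mspan M Y" if "x \<in> carrier M" for x
    using A M that
  proof (induction x rule: vpart_induct)
    case zero
    show ?case by (rule exI[of _ "{}"]) (simp add: mspan.zero)
  next
    case (add x y)
    then obtain Y Z where YZ: "?V Y" "x \<in> mspan M Y" "?V Z" "y \<in> mspan M Z" by blast
    then have VU: "?V (Y \<union> Z)" by blast
    have gen: "W \<subseteq> mspan M (Y \<union> Z)" if "W \<subseteq> Y \<union> Z" for W
    proof
      fix w assume "w \<in> W"
      then have "w \<in> Y \<union> Z" using that by blast
      then show "w \<in> mspan M (Y \<union> Z)"
        using mspan.act[of w "Y \<union> Z" M 1] V[OF VU] M.act_one[of w] by auto
    qed
    have "x \<oplus>\<^bsub>M\<^esub> y \<in> mspan M (Y \<union> Z)"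
      using M.mspan_trans[OF YZ(2) gen V[OF VU]] M.mspan_trans[OF YZ(4) gen V[OF VU]] mspan.add by simp
    with VU show ?case by blast
  next
    case (vpart i n x)
    have "x \<in> mspan M {x}" using mspan.act[of x "{x}" M 1] M.act_one vpartD(3)[OF vpart(2) M] by simp
    then show ?case using vpart by blast
  qed
  then have "\<forall>x\<in>X. \<exists>Y. ?V Y \<and> x \<in> mspan M Y" using X by blast
  then obtain Y where Y: "\<And>x. x \<in> X \<Longrightarrow> ?V (Y x) \<and> x \<in> mspan M (Y x)" by metis
  let ?Z = "\<Union>x\<in>X. Y x"
  have VZ: "?V ?Z" using Y X(1) by auto
  have "Y x \<subseteq> mspan M ?Z" if "x \<in> X" for x
  proof
    fix y assume "y \<in> Y x"
    then have "y \<in> ?Z" using that by blast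
    then show "y \<in> mspan M ?Z" using mspan.act[of y ?Z M 1] M.act_one[of y] V[OF VZ] by auto
  qed
  then have "X \<subseteq> mspan M ?Z" using Y M.mspan_trans[OF _ _ V[OF VZ]] by blast
  then have "carrier M \<subseteq> mspan M ?Z" using X(3) M.mspan_trans[OF _ _ V[OF VZ]] by blast
  moreover obtain v d where "\<forall>x\<in>?Z. v x < rk A \<and> x \<in> vpart A M (v x) (d x)" using VZ by metis
  ultimately show ?thesis using VZ by blast
qed

text \<open>The elements of \<open>e\<^sub>l M\<^sub>n\<close> which are combinations of the generators \<open>x \<in> X\<close>, of vertex \<open>v x\<close>
  and degree \<open>d x\<close>, through homogeneous coefficients in \<open>e\<^sub>l A\<close>; this is what transfers.\<close>

inductive vspan :: "('k, 'a :: {ring, monoid_mult}) graded_algebra \<Rightarrow> ('a, 'm) gmodule \<Rightarrow> 'm set \<Rightarrow> ('m \<Rightarrow> int) \<Rightarrow>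
    nat \<Rightarrow> int \<Rightarrow> 'm \<Rightarrow> bool" for A M X d l where
  zero: "vspan A M X d l n \<zero>\<^bsub>M\<^esub>"
| act: "x \<in> X \<Longrightarrow> a \<in> deg A k \<Longrightarrow> idem A l * a = a \<Longrightarrow> vspan A M X d l (int k + d x) (a \<odot>\<^bsub>M\<^esub> x)"
| add: "vspan A M X d l n x \<Longrightarrow> vspan A M X d l n y \<Longrightarrow> vspan A M X d l n (x \<oplus>\<^bsub>M\<^esub> y)"

text \<open>Passing to the component of degree \<open>n\<close> and multiplying by \<open>e\<^sub>l\<close> turns a combination with
  arbitrary coefficients into one with homogeneous coefficients in \<open>e\<^sub>l A\<close>.\<close>

lemma vspan_component:
  assumes A: "elementary_graded_algebra A" and M: "graded_module A M"
    and X: "\<And>x. x \<in> X \<Longrightarrow> x \<in> gpart M (d x)" and y: "y \<in> mspan M X" and l: "l < rk A"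
  shows "vspan A M X d l n (idem A l \<odot>\<^bsub>M\<^esub> graded_module.hcomp M y n)"
  using y
proof (induction arbitrary: n rule: mspan.induct)
  interpret A: elementary_graded_algebra A by fact
  interpret M: graded_module A M by fact
  have Xc: "X \<subseteq> carrier M" using X M.gpart_carrier by blast
  have h0: "M.hcomp \<zero>\<^bsub>M\<^esub> n = \<zero>\<^bsub>M\<^esub>" for n using fun_cong[OF M.hcomp_homogeneous[OF M.gpart_zero, of 0], of n] by simp
  have hc: "M.hcomp x n \<in> carrier M" if "x \<in> carrier M" for x n
    using M.gpart_carrier[OF M.hcomp_gpart[OF that]] .
  {
    case zero
    show ?case by (simp add: vspan.zero h0 M.act_zero_right)
  next
    case (act x a)
    note xc = subsetD[OF Xc act]
    show ?case
    proof (induction a arbitrary: n rule: A.homogeneous_induct)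
      case zero
      show ?case by (simp add: vspan.zero h0 M.act_zero_right M.act_zero_left xc)
    next
      case (add a b)
      then show ?case
        by (simp add: M.act_add_left M.hcomp_add M.act_add_right M.act_closed xc hc vspan.add)
    next
      case (homogeneous k a)
      have "M.hcomp (a \<odot>\<^bsub>M\<^esub> x) n = (if n = int k + d x then a \<odot>\<^bsub>M\<^esub> x else \<zero>\<^bsub>M\<^esub>)"
        using fun_cong[OF M.hcomp_homogeneous[OF M.gpart_act[OF homogeneous X[OF act]]], of n] .
      moreover have "vspan A M X d l (int k + d x) ((idem A l * a) \<odot>\<^bsub>M\<^esub> x)"
        using A.deg_mult[OF A.idem_deg[OF l] homogeneous] A.idem_sq[OF l]
        by (intro vspan.act act) (simp_all add: mult.assoc[symmetric])
      ultimately show ?case by (simp add: vspan.zero M.act_zero_right M.act_assoc xc)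
    qed
  next
    case (add x y)
    then show ?case
      using M.mspan_carrier[OF _ Xc] by (simp add: M.hcomp_add M.act_add_right hc vspan.add)
  }
qed

lemma gr_FP_infinityE:
  assumes "gr_FP_infinity TYPE('u) A N"
  obtains P :: "nat \<Rightarrow> ('a :: {ring, monoid_mult}, 'u) gmodule" and d \<epsilon> where
    "\<forall>n. gr_projective A (P n) \<and> finitely_generated (P n)"
    "\<forall>n. d n \<in> gr_hom (P (Suc n)) (P n)" "\<epsilon> \<in> gr_hom (P 0) N"
    "\<epsilon> ` carrier (P 0) = carrier N"
    "d 0 ` carrier (P 1) = {x \<in> carrier (P 0). \<epsilon> x = \<zero>\<^bsub>N\<^esub>}"
    "\<forall>n. d (Suc n) ` carrier (P (Suc (Suc n))) = {x \<in> carrier (P (Suc n)). d n x = \<zero>\<^bsub>P n\<^esub>}"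
  using assms unfolding gr_FP_infinity_def by (elim exE conjE) (rule that; assumption)

context vertex_matching
begin

text \<open>The transfers of homogeneous generators at vertices generate \<open>F M\<close>, as \<open>\<tau>_act\<close> provides
  coefficients in \<open>B\<close> for the transfer of a combination.\<close>

lemma F_finitely_generated:
  assumes M: "graded_module A M" and fg: "finitely_generated M"
  shows "finitely_generated (fob F M)"
proof -
  interpret M: graded_module A M by (rule M)
  note FM = F(1)[OF M]
  interpret FM: graded_module B "fob F M" by (rule FM)
  obtain X v d where X: "finite X" "carrier M \<subseteq> mspan M X"
    and vd: "\<And>x. x \<in> X \<Longrightarrow> v x < rk A" "\<And>x. x \<in> X \<Longrightarrow> x \<in> vpart A M (v x) (d x)"
    using finitely_generated_vertex[OF A.elementary_graded_algebra_axioms M fg] by metis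
  let ?X = "(\<lambda>x. \<tau> M (v x) (d x) x) ` X"
  have Xv: "\<tau> M (v x) (d x) x \<in> carrier (fob F M)" if "x \<in> X" for x
    using vpartD(3)[OF bij_betw_apply[OF \<tau>_bij[OF vd(1)[OF that] M] vd(2)[OF that]] FM] .
  have step: "y \<in> vpart A M l n \<and> \<tau> M l n y \<in> mspan (fob F M) ?X"
    if "vspan A M X d l n y" and l: "l < rk A" for l n y
    using that(1)
  proof (induction rule: vspan.induct)
    case (zero n)
    show ?case by (simp add: M.zero_vpart \<tau>_zero[OF l M] mspan.zero)
  next
    case (act x a k)
    have "a \<odot>\<^bsub>M\<^esub> x \<in> vpart A M l (int k + d x)"
      by (rule M.act_vpart[OF A.elementary_graded_algebra_axioms l act(2,3) vpartD(1)[OF vd(2)[OF act(1)]]])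
    moreover obtain b where "\<tau> M l (int k + d x) (a \<odot>\<^bsub>M\<^esub> x) = b \<odot>\<^bsub>fob F M\<^esub> \<tau> M (v x) (d x) x"
      using \<tau>_act[OF M vd(1)[OF act(1)] l act(2,3) vd(2)[OF act(1)]] by blast
    ultimately show ?case using mspan.act[OF imageI[OF act(1)]] by simp
  next
    case (add n x y)
    then show ?case by (simp add: M.add_vpart \<tau>_add[OF l M] mspan.add)
  qed
  have "y \<in> mspan (fob F M) ?X" if "y \<in> carrier (fob F M)" for y
    using B.elementary_graded_algebra_axioms FM that
  proof (induction y rule: vpart_induct)
    case (vpart j k y)
    obtain i n x where i: "i < rk A" and "j = \<sigma> i" "k = n + m i"
      and x: "x \<in> vpart A M i n" and y: "y = \<tau> M i n x" by (rule vpart_imageE[OF M vpart])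
    have "x \<in> mspan M X" using X(2) vpartD(3)[OF x M] by blast
    from vspan_component[OF A.elementary_graded_algebra_axioms M vpartD(1)[OF vd(2)] this i, of n]
    have "vspan A M X d i n x"
      using fun_cong[OF M.hcomp_homogeneous[OF vpartD(1)[OF x]], of n] vpartD(2)[OF x] by simp
    from step[OF this i] show ?case using y by simp
  qed (auto intro: mspan.intros)
  then show ?thesis using X(1) Xv unfolding FM.finitely_generated_mspan by (intro exI[of _ ?X]) auto
qed

lemma F_essentially_surjective:
  fixes N :: "('b, 'u) gmodule"
  assumes N: "graded_module B N"
  shows "\<exists>N' u u'. graded_module A N' \<and> u \<in> gr_hom (fob F N') N \<and> u' \<in> gr_hom N (fob F N') \<and>
    (\<forall>x \<in> carrier (fob F N'). u' (u x) = x) \<and> (\<forall>y \<in> carrier N. u (u' y) = y)"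
proof -
  obtain G where equivG: "is_equivalence (GrMod B) (GrMod A) G"
    and FG: "naturally_isomorphic (GrMod B) (GrMod B) (comp_functor F G) id_functor"
    using equivalence_inverse[OF equiv] by blast
  have GN: "graded_module A (fob G N)"
    by (rule GrMod_functorD(1)[OF GrMod_equivalence_functor[OF equivG] N])
  obtain u where "is_iso_in (GrMod B) (fob F (fob G N)) N u"
    using naturally_isomorphic_GrMod_id[OF FG] N by blast
  then have u: "u \<in> gr_hom (fob F (fob G N)) N" "bij_betw u (carrier (fob F (fob G N))) (carrier N)"
    using is_iso_in_GrMod[OF F(1)[OF GN] N] by blast+
  from gr_hom_inv(1-3)[OF F(1)[OF GN] N u] show ?thesis using GN u(1) by metis
qed

text \<open>Since \<open>F\<close> is full and essentially surjective, a lifting problem for \<open>F P\<close> is isomorphic to the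
  image of a lifting problem for \<open>P\<close>.\<close>

lemma F_projective:
  assumes proj: "gr_projective A P"
  shows "gr_projective B (fob F P)"
  unfolding gr_projective_def
proof (intro conjI allI impI)
  have P: "graded_module A P" using proj by (simp add: gr_projective_def)
  show FP: "graded_module B (fob F P)" by (rule F(1)[OF P])
  fix M N :: "('b, 'u) gmodule" and g f
  assume "graded_module B M \<and> graded_module B N \<and> g \<in> gr_hom M N \<and> g ` carrier M = carrier N \<and> f \<in> gr_hom (fob F P) N"
  then have M: "graded_module B M" and N: "graded_module B N" and g: "g \<in> gr_hom M N"
    and surj: "g ` carrier M = carrier N" and f: "f \<in> gr_hom (fob F P) N" by auto
  obtain M' u u' where M': "graded_module A M'" and u: "u \<in> gr_hom (fob F M') M" and u': "u' \<in> gr_hom M (fob F M')"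
    and uu: "\<And>x. x \<in> carrier (fob F M') \<Longrightarrow> u' (u x) = x" "\<And>y. y \<in> carrier M \<Longrightarrow> u (u' y) = y"
    using F_essentially_surjective[OF M] by metis
  obtain N' v v' where N': "graded_module A N'" and v: "v \<in> gr_hom (fob F N') N" and v': "v' \<in> gr_hom N (fob F N')"
    and vv: "\<And>x. x \<in> carrier (fob F N') \<Longrightarrow> v' (v x) = x" "\<And>y. y \<in> carrier N \<Longrightarrow> v (v' y) = y"
    using F_essentially_surjective[OF N] by metis
  note FM' = F(1)[OF M'] and FN' = F(1)[OF N']
  let ?g = "compose (carrier (fob F M')) v' (compose (carrier (fob F M')) g u)"
  have "?g \<in> gr_hom (fob F M') (fob F N')"
    by (rule gr_hom_compose[OF FM' gr_hom_compose[OF FM' u g] v'])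
  then obtain g' where g': "g' \<in> gr_hom M' N'" "fmor F M' N' g' = ?g" using full[OF M' N'] by blast
  have "compose (carrier (fob F P)) v' f \<in> gr_hom (fob F P) (fob F N')" by (rule gr_hom_compose[OF FP f v'])
  then obtain f' where f': "f' \<in> gr_hom P N'" "fmor F P N' f' = compose (carrier (fob F P)) v' f"
    using full[OF P N'] by blast
  have "?g ` carrier (fob F M') = carrier (fob F N')"
  proof
    show "?g ` carrier (fob F M') \<subseteq> carrier (fob F N')"
      using gr_homD(1)[OF u] gr_homD(1)[OF g] gr_homD(1)[OF v'] by (auto simp: compose_def)
    show "carrier (fob F N') \<subseteq> ?g ` carrier (fob F M')"
    proof
      fix y assume y: "y \<in> carrier (fob F N')"
      have "v y \<in> g ` carrier M" unfolding surj by (rule gr_homD(1)[OF v y])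
      then obtain x where x: "x \<in> carrier M" "g x = v y" by (metis imageE)
      have "?g (u' x) = y" using gr_homD(1)[OF u' x(1)] uu(2)[OF x(1)] x(2) vv(1)[OF y] by (simp add: compose_def)
      then show "y \<in> ?g ` carrier (fob F M')" using gr_homD(1)[OF u' x(1)] by (metis imageI)
    qed
  qed
  then have "g' ` carrier M' = carrier N'" using F_reflects_surj[OF M' N' g'(1)] g'(2) by simp
  then obtain h' where h': "h' \<in> gr_hom P M'" "compose (carrier P) g' h' = f'"
    using proj M' N' g'(1) f'(1) unfolding gr_projective_def by blast
  note Fh' = F(2)[OF P M' h'(1)]
  have eq: "compose (carrier (fob F P)) ?g (fmor F P M' h') = compose (carrier (fob F P)) v' f"
    using F(4)[OF P M' N' h'(1) g'(1)] h'(2) f'(2) g'(2) by simp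
  let ?h = "compose (carrier (fob F P)) u (fmor F P M' h')"
  have h: "?h \<in> gr_hom (fob F P) M" by (rule gr_hom_compose[OF FP Fh' u])
  have "compose (carrier (fob F P)) g ?h = f"
  proof (rule gr_hom_eqI[OF gr_hom_compose[OF FP h g] f])
    fix x assume x: "x \<in> carrier (fob F P)"
    have "v' (g (u (fmor F P M' h' x))) = v' (f x)"
      using fun_cong[OF eq, of x] x gr_homD(1)[OF Fh' x] by (simp add: compose_def)
    then have "v (v' (g (u (fmor F P M' h' x)))) = v (v' (f x))" by (rule arg_cong)
    then have "g (u (fmor F P M' h' x)) = f x"
      unfolding vv(2)[OF gr_homD(1)[OF g gr_homD(1)[OF u gr_homD(1)[OF Fh' x]]]] vv(2)[OF gr_homD(1)[OF f x]] .
    then show "compose (carrier (fob F P)) g ?h x = f x" using x by (simp add: compose_def)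
  qed
  with h show "\<exists>h\<in>gr_hom (fob F P) M. compose (carrier (fob F P)) g h = f" by (intro bexI[of _ ?h])
qed

lemma F_FP_infinity:
  assumes T: "graded_module A T" and FP: "gr_FP_infinity TYPE('u) A T"
  shows "gr_FP_infinity TYPE('u) B (fob F T)"
proof -
  obtain P :: "nat \<Rightarrow> ('a, 'u) gmodule" and d \<epsilon> where
    Pd: "\<forall>n. gr_projective A (P n) \<and> finitely_generated (P n)"
      "\<forall>n. d n \<in> gr_hom (P (Suc n)) (P n)" and \<epsilon>: "\<epsilon> \<in> gr_hom (P 0) T"
    and ex: "\<epsilon> ` carrier (P 0) = carrier T"
      "d 0 ` carrier (P 1) = {x \<in> carrier (P 0). \<epsilon> x = \<zero>\<^bsub>T\<^esub>}"
      "\<forall>n. d (Suc n) ` carrier (P (Suc (Suc n))) = {x \<in> carrier (P (Suc n)). d n x = \<zero>\<^bsub>P n\<^esub>}"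
    using FP by (rule gr_FP_infinityE)
  have P: "gr_projective A (P n)" "finitely_generated (P n)" and d: "d n \<in> gr_hom (P (Suc n)) (P n)" for n
    using Pd by blast+
  have PM: "graded_module A (P n)" for n using P(1) by (simp add: gr_projective_def)
  have d0: "d 0 \<in> gr_hom (P 1) (P 0)" using d[of 0] by simp
  show ?thesis unfolding gr_FP_infinity_def
  proof (intro exI[of _ "\<lambda>n. fob F (P n)"] exI[of _ "\<lambda>n. fmor F (P (Suc n)) (P n) (d n)"]
      exI[of _ "fmor F (P 0) T \<epsilon>"] conjI allI)
    show "gr_projective B (fob F (P n))" "finitely_generated (fob F (P n))" for n
      using F_projective[OF P(1)] F_finitely_generated[OF PM P(2)] by blast+
    show "fmor F (P (Suc n)) (P n) (d n) \<in> gr_hom (fob F (P (Suc n))) (fob F (P n))" for n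
      by (rule F(2)[OF PM PM d])
    show "fmor F (P 0) T \<epsilon> \<in> gr_hom (fob F (P 0)) (fob F T)" by (rule F(2)[OF PM T \<epsilon>])
    show "fmor F (P 0) T \<epsilon> ` carrier (fob F (P 0)) = carrier (fob F T)" by (rule F_surj[OF PM T \<epsilon> ex(1)])
    show "fmor F (P (Suc 0)) (P 0) (d 0) ` carrier (fob F (P 1)) =
        {x \<in> carrier (fob F (P 0)). fmor F (P 0) T \<epsilon> x = \<zero>\<^bsub>fob F T\<^esub>}"
      using F_exact[OF PM PM T d0 \<epsilon> ex(2)] by simp
    show "fmor F (P (Suc (Suc n))) (P (Suc n)) (d (Suc n)) ` carrier (fob F (P (Suc (Suc n)))) =
        {x \<in> carrier (fob F (P (Suc n))). fmor F (P (Suc n)) (P n) (d n) x = \<zero>\<^bsub>fob F (P n)\<^esub>}" for n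
      by (rule F_exact[OF PM PM PM d d ex(3)[rule_format]])
  qed
qed

end

lemma gr_FP_infinity_iso:
  fixes N :: "('a :: {ring, monoid_mult}, 'm) gmodule"
  assumes FP: "gr_FP_infinity TYPE('u) A N" and \<theta>: "\<theta> \<in> gr_hom N N'"
    and bij: "bij_betw \<theta> (carrier N) (carrier N')" and z: "\<zero>\<^bsub>N\<^esub> \<in> carrier N" "\<theta> \<zero>\<^bsub>N\<^esub> = \<zero>\<^bsub>N'\<^esub>"
  shows "gr_FP_infinity TYPE('u) A N'"
proof -
  obtain P :: "nat \<Rightarrow> ('a, 'u) gmodule" and d \<epsilon> where
    P: "\<forall>n. gr_projective A (P n) \<and> finitely_generated (P n)"
    and d: "\<forall>n. d n \<in> gr_hom (P (Suc n)) (P n)" and \<epsilon>: "\<epsilon> \<in> gr_hom (P 0) N"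
    and ex: "\<epsilon> ` carrier (P 0) = carrier N"
      "d 0 ` carrier (P 1) = {x \<in> carrier (P 0). \<epsilon> x = \<zero>\<^bsub>N\<^esub>}"
      "\<forall>n. d (Suc n) ` carrier (P (Suc (Suc n))) = {x \<in> carrier (P (Suc n)). d n x = \<zero>\<^bsub>P n\<^esub>}"
    using FP by (rule gr_FP_infinityE)
  have P0: "graded_module A (P 0)" using P by (simp add: gr_projective_def)
  let ?\<epsilon> = "compose (carrier (P 0)) \<theta> \<epsilon>"
  have 1: "?\<epsilon> \<in> gr_hom (P 0) N'" by (rule gr_hom_compose[OF P0 \<epsilon> \<theta>])
  have "?\<epsilon> ` carrier (P 0) = \<theta> ` (\<epsilon> ` carrier (P 0))" by (auto simp: compose_def image_iff)
  then have 2: "?\<epsilon> ` carrier (P 0) = carrier N'" using ex(1) bij by (simp add: bij_betw_def)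
  have "?\<epsilon> x = \<zero>\<^bsub>N'\<^esub> \<longleftrightarrow> \<epsilon> x = \<zero>\<^bsub>N\<^esub>" if "x \<in> carrier (P 0)" for x
    using that z inj_on_eq_iff[OF bij_betw_imp_inj_on[OF bij] gr_homD(1)[OF \<epsilon> that] z(1)] by (simp add: compose_def)
  then have 3: "d 0 ` carrier (P 1) = {x \<in> carrier (P 0). ?\<epsilon> x = \<zero>\<^bsub>N'\<^esub>}" using ex(2) by auto
  show ?thesis unfolding gr_FP_infinity_def
    by (intro exI[of _ P] exI[of _ d] exI[of _ ?\<epsilon>] conjI P d 1 2 3 ex(3))
qed

lemma gr_projective_shift:
  fixes P :: "('a :: {ring, monoid_mult}, 'u) gmodule"
  assumes P: "gr_projective A P"
  shows "gr_projective A (shift m P)"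
  unfolding gr_projective_def
proof (intro conjI allI impI)
  have PM: "graded_module A P" using P by (simp add: gr_projective_def)
  then show "graded_module A (shift m P)" by (rule graded_module_shift)
  fix M N :: "('a, 'u) gmodule" and g f
  assume *: "graded_module A M \<and> graded_module A N \<and> g \<in> gr_hom M N \<and> g ` carrier M = carrier N \<and>
    f \<in> gr_hom (shift m P) N"
  let ?M = "shift (- m) M" and ?N = "shift (- m) N"
  have "g \<in> gr_hom ?M ?N" "f \<in> gr_hom P ?N"
    using * gr_hom_shift[of "- m" "shift m P" N] by simp_all
  then obtain h where "h \<in> gr_hom P ?M" "compose (carrier P) g h = f"
    using P * graded_module_shift[of A M "- m"] graded_module_shift[of A N "- m"]
    unfolding gr_projective_def by (metis shift_simps(1))
  then show "\<exists>h\<in>gr_hom (shift m P) M. compose (carrier (shift m P)) g h = f"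
    using gr_hom_shift[of m P ?M] by auto
qed

lemma gr_FP_infinity_shift:
  fixes N :: "('a :: {ring, monoid_mult}, 'm) gmodule"
  assumes "gr_FP_infinity TYPE('u) A N"
  shows "gr_FP_infinity TYPE('u) A (shift m N)"
proof -
  obtain P :: "nat \<Rightarrow> ('a, 'u) gmodule" and d \<epsilon> where
    P: "\<forall>n. gr_projective A (P n) \<and> finitely_generated (P n)"
    and d: "\<forall>n. d n \<in> gr_hom (P (Suc n)) (P n)" and \<epsilon>: "\<epsilon> \<in> gr_hom (P 0) N"
    and ex: "\<epsilon> ` carrier (P 0) = carrier N"
      "d 0 ` carrier (P 1) = {x \<in> carrier (P 0). \<epsilon> x = \<zero>\<^bsub>N\<^esub>}"
      "\<forall>n. d (Suc n) ` carrier (P (Suc (Suc n))) = {x \<in> carrier (P (Suc n)). d n x = \<zero>\<^bsub>P n\<^esub>}"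
    using assms by (rule gr_FP_infinityE)
  have fg: "finitely_generated (shift m M) = finitely_generated M" for M :: "('a, 'u) gmodule"
    by (simp add: finitely_generated_def)
  show ?thesis unfolding gr_FP_infinity_def
    by (intro exI[of _ "\<lambda>n. shift m (P n)"] exI[of _ d] exI[of _ \<epsilon>])
      (use P d \<epsilon> ex in \<open>simp add: fg gr_projective_shift\<close>)
qed

section \<open>Vertex simples\<close>

lemma positive_part_add:
  assumes A: "elementary_graded_algebra A" and x: "x \<in> positive_part A" and y: "y \<in> positive_part A"
  shows "x + y \<in> positive_part A"
proof -
  interpret A: elementary_graded_algebra A by fact
  obtain S f where x: "x = (\<Sum>n\<in>S. f n)" "finite S" "\<forall>n\<in>S. n > 0 \<and> f n \<in> deg A n"
    using x unfolding positive_part_def by blast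
  obtain T g where y: "y = (\<Sum>n\<in>T. g n)" "finite T" "\<forall>n\<in>T. n > 0 \<and> g n \<in> deg A n"
    using y unfolding positive_part_def by blast
  let ?f = "\<lambda>n. if n \<in> S then f n else 0" and ?g = "\<lambda>n. if n \<in> T then g n else 0"
  have "x = (\<Sum>n\<in>S \<union> T. ?f n)" "y = (\<Sum>n\<in>S \<union> T. ?g n)"
    unfolding x(1) y(1) using x(2) y(2) by (auto intro!: sum.mono_neutral_cong_left)
  then have "x + y = (\<Sum>n\<in>S \<union> T. ?f n + ?g n)" by (simp add: sum.distrib)
  moreover have "\<forall>n\<in>S \<union> T. n > 0 \<and> ?f n + ?g n \<in> deg A n"
    using x(3) y(3) A.deg_zero A.deg_add by auto
  ultimately show ?thesis unfolding positive_part_def using x(2) y(2)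
    by (intro CollectI exI[of _ "S \<union> T"] exI[of _ "\<lambda>n. ?f n + ?g n"]) simp
qed

lemma positive_part_decomp:
  assumes A: "elementary_graded_algebra A"
  shows "\<exists>b \<in> deg A 0. \<exists>c \<in> positive_part A. a = b + c"
proof -
  interpret A: elementary_graded_algebra A by fact
  have 0: "0 \<in> positive_part A" unfolding positive_part_def by (intro CollectI exI[of _ "{}"]) simp
  show ?thesis
  proof (induction a rule: A.homogeneous_induct)
    case zero
    show ?case using 0 A.deg_zero by (intro bexI[of _ 0]) auto
  next
    case (add x y)
    then obtain b c b' c' where "b \<in> deg A 0" "c \<in> positive_part A" "x = b + c"
      "b' \<in> deg A 0" "c' \<in> positive_part A" "y = b' + c'" by blast
    then show ?case using A.deg_add positive_part_add[OF A]
      by (intro bexI[of _ "b + b'"] bexI[of _ "c + c'"]) (auto simp: algebra_simps)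
  next
    case (homogeneous n x)
    show ?case
    proof (cases "n = 0")
      case True
      then show ?thesis using 0 homogeneous by (intro bexI[of _ x] bexI[of _ 0]) auto
    next
      case False
      then have "x \<in> positive_part A" unfolding positive_part_def
        using homogeneous by (intro CollectI exI[of _ "{n}"] exI[of _ "\<lambda>_. x"]) auto
      then show ?thesis using A.deg_zero by (intro bexI[of _ 0] bexI[of _ x]) auto
    qed
  qed
qed

lemma vertex_line_scal_eq_zero:
  assumes A: "elementary_graded_algebra A" and T: "vertex_line A T i n t" and c: "scal A c 1 \<odot>\<^bsub>T\<^esub> t = \<zero>\<^bsub>T\<^esub>"
  shows "c = 0"
proof (rule ccontr)
  interpret A: elementary_graded_algebra A by fact
  interpret T: graded_module A T using vertex_lineD(1)[OF T] .
  assume "c \<noteq> 0"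
  then have "t = (scal A (inverse c) 1 * scal A c 1) \<odot>\<^bsub>T\<^esub> t"
    using T.act_one[OF vertex_lineD(3)[OF T]] by (simp add: A.scal_one_mult)
  also have "\<dots> = \<zero>\<^bsub>T\<^esub>" using T.act_assoc[OF vertex_lineD(3)[OF T]] c T.act_zero_right by simp
  finally show False using vertex_lineD(4)[OF T] by simp
qed

text \<open>The map \<open>A e\<^sub>i \<rightarrow> T\<close> with \<open>e\<^sub>i \<mapsto> t\<close> is onto, and its kernel is \<open>J e\<^sub>i\<close>: the elements of \<open>J\<close> kill \<open>t\<close> for
  reasons of degree, and modulo \<open>J e\<^sub>i\<close> only multiples of \<open>e\<^sub>i\<close> remain. So its fibres are the cosets that
  make up \<^const>\<open>vertex_simple\<close>, and the isomorphism sends an element of \<open>T\<close> to its fibre.\<close>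

lemma vertex_simple_iso:
  assumes A: "elementary_graded_algebra A" and T: "vertex_line A T i 0 t" and i: "i < rk A"
  shows "\<exists>\<theta> \<theta>'. \<theta> \<in> gr_hom T (vertex_simple A i) \<and> \<theta>' \<in> gr_hom (vertex_simple A i) T \<and>
    (\<forall>y \<in> carrier T. \<theta>' (\<theta> y) = y) \<and> (\<forall>Y \<in> carrier (vertex_simple A i). \<theta> (\<theta>' Y) = Y) \<and>
    \<theta> \<zero>\<^bsub>T\<^esub> = \<zero>\<^bsub>vertex_simple A i\<^esub>"
proof -
  interpret A: elementary_graded_algebra A by fact
  note TM = vertex_lineD(1)[OF T] and tc = vertex_lineD(3)[OF T]
  interpret T: graded_module A T by (rule TM)
  define V where "V = vertex_projective A i"
  let ?H = "{a * idem A i | a. a \<in> positive_part A}" and ?S = "vertex_simple A i"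
  have VG: "vertex_generator A V i 0 (idem A i)" unfolding V_def by (rule A.vertex_projective_generator[OF i])
  note VM = vertex_generatorD(1)[OF VG] and ec = vertex_generatorD(3)[OF VG]
  interpret V: graded_module A V by (rule VM)
  have V: "x \<oplus>\<^bsub>V\<^esub> y = x + y" "a \<odot>\<^bsub>V\<^esub> x = a * x" "\<zero>\<^bsub>V\<^esub> = 0" "carrier V = {a * idem A i | a. True}" for x y a
    by (simp_all add: V_def vertex_projective_def)
  obtain \<phi> where \<phi>: "\<phi> \<in> gr_hom V T" "\<phi> (idem A i) = t"
    using vertex_generator_hom[OF VG TM vertex_lineD(2)[OF T]] by blast
  note \<phi>D = gr_homD[OF \<phi>(1)]
  have \<phi>a: "\<phi> (a * idem A i) = a \<odot>\<^bsub>T\<^esub> t" for a using \<phi>D(4)[OF ec, of a] \<phi>(2) by (simp add: V)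
  have \<phi>add: "\<phi> (x + y) = \<phi> x \<oplus>\<^bsub>T\<^esub> \<phi> y" if "x \<in> carrier V" "y \<in> carrier V" for x y
    using \<phi>D(3)[OF that] by (simp add: V)
  have diff: "x - y \<in> carrier V" if "x \<in> carrier V" "y \<in> carrier V" for x y
    using that by (auto simp: V left_diff_distrib[symmetric])
  have surj: "\<exists>x \<in> carrier V. \<phi> x = y" if y: "y \<in> carrier T" for y
    using vertex_lineD(5)[OF T y] \<phi>a by (auto simp: V)
  have T0: "carrier T \<subseteq> gpart T 0"
    using vertex_lineD(5)[OF T] vpartD(1)[OF T.scal_vpart[OF A vertex_lineD(2)[OF T]]] by blast
  have pos: "a \<odot>\<^bsub>T\<^esub> t = \<zero>\<^bsub>T\<^esub>" if "a \<in> deg A n" "n > 0" for a n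
    using T.gpart_disjoint[of "a \<odot>\<^bsub>T\<^esub> t" "int n" 0] T.gpart_act[OF that(1) vpartD(1)[OF vertex_lineD(2)[OF T]]]
      T0 T.act_closed[OF tc, of a] that(2) by auto
  have ker: "\<phi> x = \<zero>\<^bsub>T\<^esub> \<longleftrightarrow> x \<in> ?H" if x: "x \<in> carrier V" for x
  proof
    assume "x \<in> ?H"
    then obtain S f where S: "finite S" "\<forall>n\<in>S. n > 0 \<and> f n \<in> deg A n" and x: "x = (\<Sum>n\<in>S. f n) * idem A i"
      unfolding positive_part_def by blast
    have "(\<Sum>n\<in>S. f n) \<odot>\<^bsub>T\<^esub> t = \<zero>\<^bsub>T\<^esub>"
      using S
    proof (induction S)
      case (insert n S)
      then show ?case using pos[of "f n" n] T.act_add_left[OF tc] by simp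
    qed (simp add: T.act_zero_left tc)
    then show "\<phi> x = \<zero>\<^bsub>T\<^esub>" using x \<phi>a by simp
  next
    assume 0: "\<phi> x = \<zero>\<^bsub>T\<^esub>"
    obtain a where a: "x = a * idem A i" using x by (auto simp: V)
    obtain b c where bc: "b \<in> deg A 0" "c \<in> positive_part A" "a = b + c"
      using positive_part_decomp[OF A] by blast
    obtain s where s: "b * idem A i = scal A s (idem A i)" using A.deg0_idem[OF bc(1) i] by blast
    obtain S f where S: "finite S" "\<forall>n\<in>S. n > 0 \<and> f n \<in> deg A n" and c: "c = (\<Sum>n\<in>S. f n)"
      using bc(2) unfolding positive_part_def by blast
    have "c \<odot>\<^bsub>T\<^esub> t = \<zero>\<^bsub>T\<^esub>"
      unfolding c using S
    proof (induction S)
      case (insert n S)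
      then show ?case using pos[of "f n" n] T.act_add_left[OF tc] by simp
    qed (simp add: T.act_zero_left tc)
    then have "b \<odot>\<^bsub>T\<^esub> t = \<zero>\<^bsub>T\<^esub>"
      using 0 a bc(3) \<phi>a T.act_add_left[OF tc, of b c] T.act_closed[OF tc, of b] by simp
    moreover have "b \<odot>\<^bsub>T\<^esub> t = scal A s 1 \<odot>\<^bsub>T\<^esub> t"
      using T.act_assoc[OF tc, of b "idem A i"] T.act_assoc[OF tc, of "scal A s 1" "idem A i"] s
        vpartD(2)[OF vertex_lineD(2)[OF T]] by (simp add: A.scal_one_mult)
    ultimately have "s = 0" using vertex_line_scal_eq_zero[OF A T] by simp
    then have "x = c * idem A i" using a bc(3) s by (simp add: distrib_right)
    then show "x \<in> ?H" using bc(2) by blast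
  qed
  have HV: "?H \<subseteq> carrier V" by (auto simp: V)
  define fib where "fib y = {x \<in> carrier V. \<phi> x = y}" for y
  have coset: "?H +>\<^bsub>V\<^esub> x = fib (\<phi> x)" if x: "x \<in> carrier V" for x
  proof (intro equalityI subsetI)
    fix z assume "z \<in> ?H +>\<^bsub>V\<^esub> x"
    then obtain h where h: "h \<in> ?H" "z = h + x" unfolding a_r_coset_def' V by blast
    have "z \<in> carrier V" using V.add.m_closed[of h x] h HV x by (auto simp: V(1))
    moreover have "\<phi> z = \<phi> x" using \<phi>add[of h x] ker[of h] h HV x \<phi>D(1)[OF x] by auto
    ultimately show "z \<in> fib (\<phi> x)" by (simp add: fib_def)
  next
    fix z assume "z \<in> fib (\<phi> x)"
    then have z: "z \<in> carrier V" "\<phi> z = \<phi> x" by (auto simp: fib_def)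
    have "\<phi> (z - x) \<oplus>\<^bsub>T\<^esub> \<phi> x = \<zero>\<^bsub>T\<^esub> \<oplus>\<^bsub>T\<^esub> \<phi> x"
      using \<phi>add[OF diff[OF z(1) x] x] z(2) \<phi>D(1)[OF x] by simp
    then have "\<phi> (z - x) = \<zero>\<^bsub>T\<^esub>"
      by (subst (asm) T.add.right_cancel) (use \<phi>D(1)[OF x] \<phi>D(1)[OF diff[OF z(1) x]] in auto)
    then have "z - x \<in> ?H" using ker[OF diff[OF z(1) x]] by simp
    then have "(z - x) + x \<in> ?H +>\<^bsub>V\<^esub> x" unfolding a_r_coset_def' V(1) by blast
    then show "z \<in> ?H +>\<^bsub>V\<^esub> x" by simp
  qed
  have S: "carrier ?S = a_rcosets\<^bsub>V\<^esub> ?H" "\<zero>\<^bsub>?S\<^esub> = ?H" "add ?S = set_add V"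
    "a \<odot>\<^bsub>?S\<^esub> X = (\<Union>x\<in>X. ?H +>\<^bsub>V\<^esub> (a \<odot>\<^bsub>V\<^esub> x))" "gpart ?S n = (\<lambda>x. ?H +>\<^bsub>V\<^esub> x) ` gpart V n" for a X n
    by (simp_all add: vertex_simple_def gr_quotient_def quotient_module_def module.defs gmodule.defs V_def)
  have carS: "carrier ?S = fib ` carrier T"
  proof -
    have "a_rcosets\<^bsub>V\<^esub> ?H = (\<lambda>x. ?H +>\<^bsub>V\<^esub> x) ` carrier V" unfolding A_RCOSETS_def' by blast
    also have "\<dots> = (\<lambda>x. fib (\<phi> x)) ` carrier V" using coset by (intro image_cong) auto
    also have "\<dots> = fib ` (\<phi> ` carrier V)" by (simp add: image_image)
    also have "\<phi> ` carrier V = carrier T" using surj \<phi>D(1) by (auto simp: image_iff)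
    finally show ?thesis by (simp add: S)
  qed
  have inj: "y = y'" if "fib y = fib y'" "y \<in> carrier T" for y y'
    using surj[OF that(2)] that(1) by (auto simp: fib_def)
  have add: "fib y \<oplus>\<^bsub>?S\<^esub> fib y' = fib (y \<oplus>\<^bsub>T\<^esub> y')" if y: "y \<in> carrier T" and y': "y' \<in> carrier T" for y y'
  proof (intro equalityI subsetI)
    fix z assume "z \<in> fib y \<oplus>\<^bsub>?S\<^esub> fib y'"
    then obtain u v where "u \<in> fib y" "v \<in> fib y'" "z = u + v" unfolding S set_add_def' V by blast
    then show "z \<in> fib (y \<oplus>\<^bsub>T\<^esub> y')" using \<phi>add V.add.m_closed[of u v] by (auto simp: fib_def V(1))
  next
    fix z assume z: "z \<in> fib (y \<oplus>\<^bsub>T\<^esub> y')"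
    obtain x where x: "x \<in> carrier V" "\<phi> x = y" using surj[OF y] by blast
    have zx: "z - x \<in> carrier V" using z x(1) diff by (auto simp: fib_def)
    have "y \<oplus>\<^bsub>T\<^esub> \<phi> (z - x) = y \<oplus>\<^bsub>T\<^esub> y'" using \<phi>add[OF x(1) zx] x(2) z by (simp add: fib_def)
    then have "\<phi> (z - x) \<oplus>\<^bsub>T\<^esub> y = y' \<oplus>\<^bsub>T\<^esub> y" using y y' \<phi>D(1)[OF zx] by (simp add: T.a_comm)
    then have "\<phi> (z - x) = y'" by (subst (asm) T.add.right_cancel) (use y y' \<phi>D(1)[OF zx] in auto)
    then have "x \<in> fib y" "z - x \<in> fib y'" using x zx by (simp_all add: fib_def)
    then have "x + (z - x) \<in> fib y \<oplus>\<^bsub>?S\<^esub> fib y'" unfolding S set_add_def' V(1) by blast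
    then show "z \<in> fib y \<oplus>\<^bsub>?S\<^esub> fib y'" by simp
  qed
  have act: "a \<odot>\<^bsub>?S\<^esub> fib y = fib (a \<odot>\<^bsub>T\<^esub> y)" if y: "y \<in> carrier T" for a y
  proof -
    have "?H +>\<^bsub>V\<^esub> (a \<odot>\<^bsub>V\<^esub> x) = fib (a \<odot>\<^bsub>T\<^esub> y)" if "x \<in> fib y" for x
      using coset[OF V.act_closed[of x a]] \<phi>D(4)[of x a] that by (auto simp: fib_def)
    moreover have "fib y \<noteq> {}" using surj[OF y] by (auto simp: fib_def)
    ultimately show ?thesis unfolding S(4) by auto
  qed
  have zero: "fib \<zero>\<^bsub>T\<^esub> = \<zero>\<^bsub>?S\<^esub>" unfolding S(2)
  proof (intro equalityI subsetI)
    fix x assume "x \<in> fib \<zero>\<^bsub>T\<^esub>"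
    then have x: "x \<in> carrier V" "\<phi> x = \<zero>\<^bsub>T\<^esub>" by (simp_all add: fib_def)
    from ker[OF x(1)] x(2) show "x \<in> ?H" by (rule iffD1)
  next
    fix x assume x: "x \<in> ?H"
    have xc: "x \<in> carrier V" by (rule subsetD[OF HV x])
    from ker[OF xc] x have "\<phi> x = \<zero>\<^bsub>T\<^esub>" by (rule iffD2)
    with xc show "x \<in> fib \<zero>\<^bsub>T\<^esub>" by (simp add: fib_def)
  qed
  define \<theta> where "\<theta> = restrict fib (carrier T)"
  define \<theta>' where "\<theta>' = (\<lambda>Y\<in>carrier ?S. THE y. y \<in> carrier T \<and> Y = fib y)"
  have \<theta>': "\<theta>' (fib y) = y" if "y \<in> carrier T" for y
    unfolding \<theta>'_def carS using that inj by (auto intro!: the_equality)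
  have "\<theta> \<in> gr_hom T ?S"
  proof (rule gr_homI)
    fix n y assume y: "y \<in> gpart T n"
    obtain x0 where "x0 \<in> carrier V" "\<phi> x0 = y" using surj[OF T.gpart_carrier[OF y]] by blast
    then obtain x where "x \<in> gpart V n" "\<phi> x = y" using gr_hom_lift_gpart[OF VM TM \<phi>(1)] y by metis
    then show "\<theta> y \<in> gpart ?S n" using coset[OF V.gpart_carrier, of x n] T.gpart_carrier[OF y]
      unfolding S(5) \<theta>_def by auto
  qed (use add act in \<open>simp_all add: \<theta>_def carS T.act_closed\<close>)
  moreover have "\<theta>' \<in> gr_hom ?S T"
  proof (rule gr_homI)
    show "\<theta>' \<in> extensional (carrier ?S)" by (simp add: \<theta>'_def)
    fix Y assume "Y \<in> carrier ?S"
    then obtain y where y: "y \<in> carrier T" "Y = fib y" unfolding carS by blast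
    show "\<theta>' Y \<in> carrier T" using y \<theta>' by simp
    show "\<theta>' (a \<odot>\<^bsub>?S\<^esub> Y) = a \<odot>\<^bsub>T\<^esub> \<theta>' Y" for a using y act \<theta>' T.act_closed by simp
    fix Y' assume "Y' \<in> carrier ?S"
    then obtain y' where "y' \<in> carrier T" "Y' = fib y'" unfolding carS by blast
    then show "\<theta>' (Y \<oplus>\<^bsub>?S\<^esub> Y') = \<theta>' Y \<oplus>\<^bsub>T\<^esub> \<theta>' Y'" using y add \<theta>' by simp
  next
    fix n Y assume "Y \<in> gpart ?S n"
    then obtain x where x: "x \<in> gpart V n" "Y = ?H +>\<^bsub>V\<^esub> x" unfolding S(5) by blast
    then show "\<theta>' Y \<in> gpart T n"
      using coset[OF V.gpart_carrier[OF x(1)]] \<phi>D(5)[OF x(1)] \<theta>'[OF T.gpart_carrier[OF \<phi>D(5)[OF x(1)]]] by simp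
  qed
  moreover have "\<forall>y \<in> carrier T. \<theta>' (\<theta> y) = y" using \<theta>' by (simp add: \<theta>_def)
  moreover have "\<forall>Y \<in> carrier ?S. \<theta> (\<theta>' Y) = Y" using \<theta>' unfolding carS by (simp add: \<theta>_def)
  moreover have "\<theta> \<zero>\<^bsub>T\<^esub> = \<zero>\<^bsub>?S\<^esub>" using zero by (simp add: \<theta>_def)
  ultimately show ?thesis by blast
qed

text \<open>The elements of \<^const>\<open>vertex_simple\<close> are cosets, which lie outside the universe, so a functor on
  \<^const>\<open>GrMod\<close> can only be applied to a copy \<open>T\<close> of this module.\<close>

lemma gr_FP_infinity_vertex_line:
  assumes A: "elementary_graded_algebra A" and T: "vertex_line A T i 0 t" and i: "i < rk A"
  shows "gr_FP_infinity TYPE('u) A (vertex_simple A i) \<longleftrightarrow> gr_FP_infinity TYPE('u) A T"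
proof -
  interpret T: graded_module A T using vertex_lineD(1)[OF T] .
  let ?S = "vertex_simple A i"
  obtain \<theta> \<theta>' where \<theta>: "\<theta> \<in> gr_hom T ?S" and \<theta>': "\<theta>' \<in> gr_hom ?S T"
    and inv: "\<And>y. y \<in> carrier T \<Longrightarrow> \<theta>' (\<theta> y) = y" "\<And>Y. Y \<in> carrier ?S \<Longrightarrow> \<theta> (\<theta>' Y) = Y"
    and z: "\<theta> \<zero>\<^bsub>T\<^esub> = \<zero>\<^bsub>?S\<^esub>" using vertex_simple_iso[OF A T i] by metis
  have "bij_betw \<theta> (carrier T) (carrier ?S)"
    by (rule bij_betwI[of _ _ _ \<theta>']) (use gr_homD(1)[OF \<theta>] gr_homD(1)[OF \<theta>'] inv in auto)
  moreover have "bij_betw \<theta>' (carrier ?S) (carrier T)"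
    by (rule bij_betwI[of _ _ _ \<theta>]) (use gr_homD(1)[OF \<theta>] gr_homD(1)[OF \<theta>'] inv in auto)
  moreover have "\<zero>\<^bsub>?S\<^esub> \<in> carrier ?S" "\<theta>' \<zero>\<^bsub>?S\<^esub> = \<zero>\<^bsub>T\<^esub>"
    using gr_homD(1)[OF \<theta> T.zero_closed] inv(1)[OF T.zero_closed] z by simp_all
  ultimately show ?thesis
    using gr_FP_infinity_iso[OF _ \<theta>] gr_FP_infinity_iso[OF _ \<theta>'] z by blast
qed

lemma (in vertex_matching) F_FP_infinity_vertex_simple:
  assumes i: "i < rk A" and FP: "gr_FP_infinity TYPE('u) A (vertex_simple A i)"
  shows "gr_FP_infinity TYPE('u) B (vertex_simple B (\<sigma> i))"
proof -
  obtain T :: "('a, 'u) gmodule" where T: "vertex_line A T i 0 (gen i 0)"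
    using ex_vertex_line[OF A.elementary_graded_algebra_axioms gen[OF i] i] by blast
  have "gr_FP_infinity TYPE('u) A T"
    using FP gr_FP_infinity_vertex_line[OF A.elementary_graded_algebra_axioms T i] by blast
  then have 1: "gr_FP_infinity TYPE('u) B (shift (- m i) (fob F T))"
    by (rule gr_FP_infinity_shift[OF F_FP_infinity[OF vertex_lineD(1)[OF T]]])
  have 2: "vertex_line B (shift (- m i) (fob F T)) (\<sigma> i) 0 (\<tau> T i 0 (gen i 0))"
    using vertex_line_shift[OF F_vertex_line[OF T i], of "- m i"] by simp
  show ?thesis
    by (rule iffD2[OF gr_FP_infinity_vertex_line[OF B.elementary_graded_algebra_axioms 2 \<sigma>_less[OF i]] 1])
qed

section \<open>The matching of vertices\<close>

lemma gr_iso_sym: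
  assumes "graded_module A M" "graded_module A N" "gr_iso M N"
  shows "gr_iso N M"
  using assms gr_hom_inv(1,4)[OF assms(1,2)] unfolding gr_iso_def by blast

lemma gr_iso_trans:
  assumes L: "graded_module A L" and "gr_iso L M" "gr_iso M N"
  shows "gr_iso L N"
proof -
  obtain f where f: "f \<in> gr_hom L M" "bij_betw f (carrier L) (carrier M)" using assms(2) unfolding gr_iso_def by blast
  obtain g where g: "g \<in> gr_hom M N" "bij_betw g (carrier M) (carrier N)" using assms(3) unfolding gr_iso_def by blast
  have "bij_betw (compose (carrier L) g f) (carrier L) (carrier N)"
    using bij_betw_trans[OF f(2) g(2)] by (rule bij_betw_cong[THEN iffD1, rotated]) (simp add: compose_def)
  then show ?thesis using gr_hom_compose[OF L f(1) g(1)] unfolding gr_iso_def by blast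
qed

lemma gr_iso_shift: "gr_iso M N \<Longrightarrow> gr_iso (shift n M) (shift n N)"
  unfolding gr_iso_def by simp

lemma gr_iso_iff_iso_in:
  assumes "graded_module A M" "graded_module A N"
  shows "gr_iso M N \<longleftrightarrow> (\<exists>f. is_iso_in (GrMod A) M N f)"
  unfolding gr_iso_def using is_iso_in_GrMod[OF assms] by blast

lemma vertex_generator_gr_iso:
  assumes "vertex_generator A P i n p" "graded_module A Q" "gr_iso P Q"
  shows "\<exists>q. vertex_generator A Q i n q"
  using assms vertex_generator_transport unfolding gr_iso_def by metis

lemma gr_iso_vertex_generators:
  assumes "vertex_generator A P i n p" "vertex_generator A Q i n q"
  shows "gr_iso P Q"
  using vertex_generator_iso[OF assms] unfolding gr_iso_def by blast

lemma functor_gr_iso: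
  assumes F: "is_functor (GrMod A) (GrMod B) F" and M: "graded_module A M" and N: "graded_module A N" and "gr_iso M N"
  shows "gr_iso (fob F M) (fob F N)"
proof -
  obtain f where "is_iso_in (GrMod A) M N f" using assms gr_iso_iff_iso_in[OF M N] by blast
  then have "is_iso_in (GrMod B) (fob F M) (fob F N) (fmor F M N f)"
    using functor_iso[OF F, of M N f] M N by simp
  then show ?thesis using gr_iso_iff_iso_in[OF GrMod_functorD(1)[OF F M] GrMod_functorD(1)[OF F N]] by blast
qed

lemma naturally_isomorphic_id_gr_iso:
  assumes F: "is_functor (GrMod A) (GrMod B) F" and G: "is_functor (GrMod B) (GrMod A) G"
    and GF: "naturally_isomorphic (GrMod A) (GrMod A) (comp_functor G F) id_functor" and M: "graded_module A M"
  shows "gr_iso (fob G (fob F M)) M"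
proof -
  obtain \<eta> where "is_iso_in (GrMod A) (fob G (fob F M)) M (\<eta> M)"
    using naturally_isomorphic_GrMod_id[OF GF] M by blast
  then show ?thesis
    using gr_iso_iff_iso_in[OF GrMod_functorD(1)[OF G GrMod_functorD(1)[OF F M]] M] by blast
qed

text \<open>The commutation with \<open>\<langle>1\<rangle>\<close> iterates to positive shifts. For \<open>n < 0\<close> the case of \<open>- n\<close> is
  applied to \<open>M\<langle>n\<rangle>\<close>, and the result is shifted by \<open>n\<close>.\<close>

lemma shift_functor_gr_iso:
  assumes F: "is_functor (GrMod A) (GrMod B) F"
    and nat: "naturally_isomorphic (GrMod A) (GrMod B) (comp_functor F (shift_functor 1)) (comp_functor (shift_functor 1) F)"
    and M: "graded_module A M"
  shows "gr_iso (fob F (shift n M)) (shift n (fob F M))"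
proof -
  note Fo = GrMod_functorD(1)[OF F]
  have one: "gr_iso (fob F (shift 1 N)) (shift 1 (fob F N))" if N: "graded_module A N" for N
  proof -
    have "\<exists>\<eta>. \<forall>N. graded_module A N \<longrightarrow> is_iso_in (GrMod B) (fob F (shift 1 N)) (shift 1 (fob F N)) (\<eta> N)"
      using nat unfolding naturally_isomorphic_def comp_functor_def shift_functor_def
      by (elim exE conjE) (rule exI, simp)
    then show ?thesis
      using gr_iso_iff_iso_in[OF Fo[OF graded_module_shift[OF N]] graded_module_shift[OF Fo[OF N]]] N by blast
  qed
  have nat: "gr_iso (fob F (shift (int k) N)) (shift (int k) (fob F N))" if N: "graded_module A N" for k N
  proof (induction k)
    case 0
    show ?case using gr_hom_id[OF Fo[OF N]] unfolding gr_iso_def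
      by (intro bexI[of _ "\<lambda>x\<in>carrier (fob F N). x"]) (auto simp: bij_betw_def inj_on_def)
  next
    case (Suc k)
    have "gr_iso (fob F (shift 1 (shift (int k) N))) (shift 1 (fob F (shift (int k) N)))"
      by (rule one[OF graded_module_shift[OF N]])
    from gr_iso_trans[OF Fo[OF graded_module_shift[OF graded_module_shift[OF N]]] this gr_iso_shift[OF Suc]]
    show ?case by simp
  qed
  show ?thesis
  proof (cases "n \<ge> 0")
    case True
    then show ?thesis using nat[OF M, of "nat n"] by simp
  next
    case False
    let ?N = "shift n M"
    have N: "graded_module A ?N" by (rule graded_module_shift[OF M])
    have "gr_iso (fob F (shift (- n) ?N)) (shift (- n) (fob F ?N))" using nat[OF N, of "nat (- n)"] False by simp
    then have "gr_iso (shift n (fob F M)) (shift n (shift (- n) (fob F ?N)))" by (intro gr_iso_shift) simp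
    then have "gr_iso (shift n (fob F M)) (fob F ?N)" by simp
    then show ?thesis by (rule gr_iso_sym[OF graded_module_shift[OF Fo[OF M]] Fo[OF N]])
  qed
qed

text \<open>The objects isomorphic to \<open>A e\<^sub>i\<close> are those with a vertex generator at \<open>i\<close> of degree \<open>0\<close>, and
  likewise for \<open>B f\<^sub>j\<langle>m\<rangle>\<close>.\<close>

lemma maps_vertex_projective_iff:
  fixes F :: "(('a :: {ring, monoid_mult}, 'u) gmodule, 'u \<Rightarrow> 'u, ('b :: {ring, monoid_mult}, 'u) gmodule, 'u \<Rightarrow> 'u) cfunctor"
  assumes A: "elementary_graded_algebra A" and B: "elementary_graded_algebra B"
    and F: "is_functor (GrMod A) (GrMod B) F" and i: "i < rk A" and j: "j < rk B"
  shows "maps_vertex_projective F A B i j m \<longleftrightarrow>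
    (\<forall>P p. vertex_generator A P i 0 p \<longrightarrow> (\<exists>q. vertex_generator B (fob F P) j m q))"
proof -
  note VA = elementary_graded_algebra.vertex_projective_generator[OF A i]
  have VB: "vertex_generator B (shift m (vertex_projective B j)) j m (idem B j)"
    using vertex_generator_shift[OF elementary_graded_algebra.vertex_projective_generator[OF B j], of m] by simp
  have 1: "gr_iso P (vertex_projective A i) \<longleftrightarrow> (\<exists>p. vertex_generator A P i 0 p)" if "graded_module A P" for P :: "('a, 'u) gmodule"
  proof
    assume "gr_iso P (vertex_projective A i)"
    from vertex_generator_gr_iso[OF VA that gr_iso_sym[OF that vertex_generatorD(1)[OF VA] this]]
    show "\<exists>p. vertex_generator A P i 0 p" .
  next
    assume "\<exists>p. vertex_generator A P i 0 p"
    then show "gr_iso P (vertex_projective A i)" using gr_iso_vertex_generators[OF _ VA] by (elim exE)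
  qed
  have 2: "gr_iso Q (shift m (vertex_projective B j)) \<longleftrightarrow> (\<exists>q. vertex_generator B Q j m q)" if "graded_module B Q" for Q :: "('b, 'u) gmodule"
  proof
    assume "gr_iso Q (shift m (vertex_projective B j))"
    from vertex_generator_gr_iso[OF VB that gr_iso_sym[OF that vertex_generatorD(1)[OF VB] this]]
    show "\<exists>p. vertex_generator B Q j m p" .
  next
    assume "\<exists>p. vertex_generator B Q j m p"
    then show "gr_iso Q (shift m (vertex_projective B j))" using gr_iso_vertex_generators[OF _ VB] by (elim exE)
  qed
  show ?thesis
  proof (intro iffI allI impI)
    fix P :: "('a, 'u) gmodule" and p
    assume maps: "maps_vertex_projective F A B i j m" and P: "vertex_generator A P i 0 p"
    note PM = vertex_generatorD(1)[OF P]
    have "gr_iso P (vertex_projective A i)" using 1[OF PM] P by blast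
    then have "gr_iso (fob F P) (shift m (vertex_projective B j))"
      using maps PM unfolding maps_vertex_projective_def by simp
    then show "\<exists>q. vertex_generator B (fob F P) j m q" using 2[OF GrMod_functorD(1)[OF F PM]] by blast
  next
    assume *: "\<forall>P p. vertex_generator A P i 0 p \<longrightarrow> (\<exists>q. vertex_generator B (fob F P) j m q)"
    show "maps_vertex_projective F A B i j m" unfolding maps_vertex_projective_def
    proof (intro ballI impI)
      fix P :: "('a, 'u) gmodule" assume "P \<in> ob (GrMod A)" and iso: "gr_iso P (vertex_projective A i)"
      then have PM: "graded_module A P" by simp
      then obtain p where "vertex_generator A P i 0 p" using 1[OF PM] iso by blast
      then have "\<exists>q. vertex_generator B (fob F P) j m q" using * by blast
      then show "gr_iso (fob F P) (shift m (vertex_projective B j))"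
        by (rule iffD2[OF 2[OF GrMod_functorD(1)[OF F PM]]])
    qed
  qed
qed

text \<open>The matching is injective because \<open>G\<close> recovers \<open>A e\<^sub>i\<close> from its image, and surjective because \<open>G\<close> carries
  \<open>B f\<^sub>j\<close> to some \<open>A e\<^sub>i\<langle>n\<rangle>\<close>; in both cases the vertex is determined by the isomorphism class.\<close>

lemma graded_morita_matching:
  fixes F :: "(('a :: {ring, monoid_mult}, 'u) gmodule, 'u \<Rightarrow> 'u, ('b :: {ring, monoid_mult}, 'u) gmodule, 'u \<Rightarrow> 'u) cfunctor"
  assumes A: "elementary_graded_algebra A" and B: "elementary_graded_algebra B"
    and injA: "\<exists>\<iota> :: 'a \<Rightarrow> 'u. inj \<iota>" and injB: "\<exists>\<iota> :: 'b \<Rightarrow> 'u. inj \<iota>"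
    and F: "graded_morita_equivalence A B F"
  shows "\<exists>\<sigma> m. bij_betw \<sigma> {..<rk A} {..<rk B} \<and> (\<forall>i<rk A. maps_vertex_projective F A B i (\<sigma> i) (m i))"
proof -
  have equiv: "is_equivalence (GrMod A) (GrMod B) F"
    and nat: "naturally_isomorphic (GrMod A) (GrMod B) (comp_functor F (shift_functor 1)) (comp_functor (shift_functor 1) F)"
    using F unfolding graded_morita_equivalence_def by blast+
  obtain G where equivG: "is_equivalence (GrMod B) (GrMod A) G"
    and GF: "naturally_isomorphic (GrMod A) (GrMod A) (comp_functor G F) id_functor"
    and FG: "naturally_isomorphic (GrMod B) (GrMod B) (comp_functor F G) id_functor"
    using equivalence_inverse[OF equiv] by blast
  note Ff = GrMod_equivalence_functor[OF equiv] and Gf = GrMod_equivalence_functor[OF equivG]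
  note Fo = GrMod_functorD(1)[OF Ff] and Go = GrMod_functorD(1)[OF Gf]
  note GF_iso = naturally_isomorphic_id_gr_iso[OF Ff Gf GF] and FG_iso = naturally_isomorphic_id_gr_iso[OF Gf Ff FG]
  note F_shift = shift_functor_gr_iso[OF Ff nat]
  have "\<forall>i. \<exists>(P :: ('a, 'u) gmodule). i < rk A \<longrightarrow> (\<exists>p. vertex_generator A P i 0 p)"
    using ex_vertex_generator[OF A injA] by blast
  then obtain P :: "nat \<Rightarrow> ('a, 'u) gmodule" where P: "\<And>i. i < rk A \<Longrightarrow> \<exists>p. vertex_generator A (P i) i 0 p" by metis
  have PM: "graded_module A (P i)" if i: "i < rk A" for i
  proof -
    obtain p where "vertex_generator A (P i) i 0 p" using P[OF i] by blast
    then show ?thesis by (rule vertex_generatorD(1))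
  qed
  have "\<forall>i. \<exists>j n. i < rk A \<longrightarrow> j < rk B \<and> (\<exists>q. vertex_generator B (fob F (P i)) j n q)"
  proof
    fix i
    show "\<exists>j n. i < rk A \<longrightarrow> j < rk B \<and> (\<exists>q. vertex_generator B (fob F (P i)) j n q)"
    proof (cases "i < rk A")
      case True
      then obtain p where "vertex_generator A (P i) i 0 p" using P[OF True] by blast
      from equivalence_vertex_generator[OF A B injB equiv this True] show ?thesis by blast
    qed simp
  qed
  then obtain \<sigma> m where \<sigma>: "\<And>i. i < rk A \<Longrightarrow> \<sigma> i < rk B"
    and gen: "\<And>i. i < rk A \<Longrightarrow> \<exists>q. vertex_generator B (fob F (P i)) (\<sigma> i) (m i) q" by metis
  have gen_shift: "\<exists>q. vertex_generator B (fob F (shift n (P i))) (\<sigma> i) (m i + n) q" if i: "i < rk A" for i n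
  proof -
    obtain q where q: "vertex_generator B (fob F (P i)) (\<sigma> i) (m i) q" using gen[OF i] by blast
    have "gr_iso (shift n (fob F (P i))) (fob F (shift n (P i)))"
      by (rule gr_iso_sym[OF Fo[OF graded_module_shift[OF PM[OF i]]] graded_module_shift[OF Fo[OF PM[OF i]]] F_shift[OF PM[OF i]]])
    from vertex_generator_gr_iso[OF vertex_generator_shift[OF q] Fo[OF graded_module_shift[OF PM[OF i]]] this]
    show ?thesis .
  qed
  have maps: "maps_vertex_projective F A B i (\<sigma> i) (m i)" if i: "i < rk A" for i
    unfolding maps_vertex_projective_iff[OF A B Ff i \<sigma>[OF i]]
  proof (intro allI impI)
    fix Q :: "('a, 'u) gmodule" and p assume Q: "vertex_generator A Q i 0 p"
    obtain p' where p': "vertex_generator A (P i) i 0 p'" using P[OF i] by blast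
    obtain q where q: "vertex_generator B (fob F (P i)) (\<sigma> i) (m i) q" using gen[OF i] by blast
    have "gr_iso (fob F (P i)) (fob F Q)"
      by (rule functor_gr_iso[OF Ff PM[OF i] vertex_generatorD(1)[OF Q] gr_iso_vertex_generators[OF p' Q]])
    then show "\<exists>q. vertex_generator B (fob F Q) (\<sigma> i) (m i) q"
      by (rule vertex_generator_gr_iso[OF q Fo[OF vertex_generatorD(1)[OF Q]]])
  qed
  have "inj_on \<sigma> {..<rk A}"
  proof (rule inj_onI)
    fix i i' assume "i \<in> {..<rk A}" "i' \<in> {..<rk A}" and eq: "\<sigma> i = \<sigma> i'"
    then have i: "i < rk A" and i': "i' < rk A" by auto
    let ?P' = "shift (m i - m i') (P i')"
    have P'M: "graded_module A ?P'" by (rule graded_module_shift[OF PM[OF i']])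
    obtain p where p: "vertex_generator A (P i) i 0 p" using P[OF i] by blast
    obtain p' where p': "vertex_generator A (P i') i' 0 p'" using P[OF i'] by blast
    obtain q where q: "vertex_generator B (fob F (P i)) (\<sigma> i) (m i) q" using gen[OF i] by blast
    obtain q' where q': "vertex_generator B (fob F ?P') (\<sigma> i') (m i' + (m i - m i')) q'"
      using gen_shift[OF i', of "m i - m i'"] by blast
    have "gr_iso (fob F (P i)) (fob F ?P')" using gr_iso_vertex_generators[OF q] q' eq by simp
    then have "gr_iso (fob G (fob F (P i))) (fob G (fob F ?P'))"
      by (rule functor_gr_iso[OF Gf Fo[OF PM[OF i]] Fo[OF P'M]])
    then have "gr_iso (fob G (fob F (P i))) ?P'"
      using gr_iso_trans[OF Go[OF Fo[OF PM[OF i]]] _ GF_iso[OF P'M]] by blast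
    then have "gr_iso (P i) ?P'"
      using gr_iso_trans[OF PM[OF i] gr_iso_sym[OF Go[OF Fo[OF PM[OF i]]] PM[OF i] GF_iso[OF PM[OF i]]]] by blast
    then obtain r where "vertex_generator A ?P' i 0 r" using vertex_generator_gr_iso[OF p P'M] by blast
    from vertex_generator_unique[OF A this i vertex_generator_shift[OF p'] i'] show "i = i'" by simp
  qed
  moreover have "\<sigma> ` {..<rk A} = {..<rk B}"
  proof (intro equalityI subsetI)
    fix j assume "j \<in> {..<rk B}"
    then have j: "j < rk B" by simp
    obtain Q :: "('b, 'u) gmodule" and q where Q: "vertex_generator B Q j 0 q" using ex_vertex_generator[OF B injB j] by blast
    note QM = vertex_generatorD(1)[OF Q]
    obtain i n p where i: "i < rk A" and p: "vertex_generator A (fob G Q) i n p"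
      using equivalence_vertex_generator[OF B A injA equivG Q j] by blast
    obtain p' where p': "vertex_generator A (P i) i 0 p'" using P[OF i] by blast
    have SM: "graded_module A (shift n (P i))" by (rule graded_module_shift[OF PM[OF i]])
    have "gr_iso (shift n (P i)) (fob G Q)" using gr_iso_vertex_generators[OF vertex_generator_shift[OF p', of n]] p by simp
    then have "gr_iso (fob F (shift n (P i))) (fob F (fob G Q))" by (rule functor_gr_iso[OF Ff SM Go[OF QM]])
    then have iso: "gr_iso (fob F (shift n (P i))) Q" by (rule gr_iso_trans[OF Fo[OF SM] _ FG_iso[OF QM]])
    obtain r where r: "vertex_generator B (fob F (shift n (P i))) (\<sigma> i) (m i + n) r" using gen_shift[OF i] by blast
    obtain r' where "vertex_generator B Q (\<sigma> i) (m i + n) r'" using vertex_generator_gr_iso[OF r QM iso] by blast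
    from vertex_generator_unique[OF B this \<sigma>[OF i] Q j] show "j \<in> \<sigma> ` {..<rk A}" using i by blast
  qed (use \<sigma> in auto)
  ultimately have "bij_betw \<sigma> {..<rk A} {..<rk B}" by (simp add: bij_betw_def)
  with maps show ?thesis by blast
qed

lemma vertex_matchingI:
  fixes F :: "(('a :: {ring, monoid_mult}, 'u) gmodule, 'u \<Rightarrow> 'u, ('b :: {ring, monoid_mult}, 'u) gmodule, 'u \<Rightarrow> 'u) cfunctor"
  assumes A: "elementary_graded_algebra A" and B: "elementary_graded_algebra B"
    and injA: "\<exists>\<iota> :: 'a \<Rightarrow> 'u. inj \<iota>" and F: "graded_morita_equivalence A B F"
    and \<sigma>: "bij_betw \<sigma> {..<rk A} {..<rk B}" and maps: "\<forall>i<rk A. maps_vertex_projective F A B i (\<sigma> i) (m i)"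
  shows "vertex_matching A B F \<sigma> m"
proof -
  have equiv: "is_equivalence (GrMod A) (GrMod B) F" and lin: "linear_functor A B F"
    and nat: "naturally_isomorphic (GrMod A) (GrMod B) (comp_functor F (shift_functor 1)) (comp_functor (shift_functor 1) F)"
    using F unfolding graded_morita_equivalence_def by blast+
  note Ff = GrMod_equivalence_functor[OF equiv]
  have "\<exists>q. vertex_generator B (fob F P) (\<sigma> i) (n + m i) q" if P: "vertex_generator A P i n p" and i: "i < rk A"
    for P :: "('a, 'u) gmodule" and i n p
  proof -
    note PM = vertex_generatorD(1)[OF P]
    note FPM = GrMod_functorD(1)[OF Ff PM]
    have \<sigma>i: "\<sigma> i < rk B" using bij_betw_apply[OF \<sigma>] i by simp
    have "vertex_generator A (shift (- n) P) i 0 p" using vertex_generator_shift[OF P, of "- n"] by simp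
    then obtain q where q: "vertex_generator B (fob F (shift (- n) P)) (\<sigma> i) (m i) q"
      using maps i maps_vertex_projective_iff[OF A B Ff i \<sigma>i, of "m i"] by blast
    obtain q' where "vertex_generator B (shift (- n) (fob F P)) (\<sigma> i) (m i) q'"
      using vertex_generator_gr_iso[OF q graded_module_shift[OF FPM] shift_functor_gr_iso[OF Ff nat PM]] by blast
    from vertex_generator_shift[OF this, of n] show ?thesis by (auto simp: add.commute)
  qed
  then show ?thesis
    unfolding vertex_matching_def vertex_matching_axioms_def using A B injA equiv lin \<sigma> by simp
qed

section \<open>Hilbert series\<close>

text \<open>The map \<open>g\<close> is linear on the subspace \<open>S\<close> only. Extending it from a basis of \<open>S\<close> gives a
  linear map on the whole space that agrees with \<open>g\<close> on \<open>S\<close>.\<close>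

lemma dim_eq_if_linear_bij:
  fixes s1 :: "'k :: field \<Rightarrow> 'a :: ab_group_add \<Rightarrow> 'a" and s2 :: "'k \<Rightarrow> 'b :: ab_group_add \<Rightarrow> 'b"
  assumes V: "vector_space s1" and W: "vector_space s2" and S: "module.subspace s1 S"
    and bij: "bij_betw g S T"
    and add: "\<And>x y. x \<in> S \<Longrightarrow> y \<in> S \<Longrightarrow> g (x + y) = g x + g y"
    and scale: "\<And>c x. x \<in> S \<Longrightarrow> g (s1 c x) = s2 c (g x)"
  shows "vector_space.dim s1 S = vector_space.dim s2 T"
proof -
  interpret vs1: vector_space s1 by fact
  interpret vs2: vector_space s2 by fact
  interpret vector_space_pair s1 s2 ..
  obtain b where b: "b \<subseteq> S" "vs1.independent b" "S \<subseteq> vs1.span b" "card b = vs1.dim S"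
    using vs1.basis_exists by blast
  have span: "vs1.span b = S" using b S vs1.span_minimal[OF b(1) S] by blast
  define h where "h = construct b g"
  have h: "Vector_Spaces.linear s1 s2 h" unfolding h_def by (rule linear_construct[OF b(2)])
  interpret h: Vector_Spaces.linear s1 s2 h by (rule h)
  have g0: "g 0 = 0" using scale[of 0 0] vs1.subspace_0[OF S] by simp
  have hg: "h x = g x" if "x \<in> S" for x
  proof -
    have "x \<in> vs1.span b" using that span by simp
    then have "h x = g x \<and> x \<in> S"
    proof (induction rule: vs1.span_induct_alt)
      case base
      show ?case using g0 h.zero vs1.subspace_0[OF S] by simp
    next
      case (step c x y)
      have x: "x \<in> S" "h x = g x" using step(1) b(1) construct_basis[OF b(2) step(1)] by (auto simp: h_def)
      then show ?case
        using step add scale vs1.subspace_scale[OF S] vs1.subspace_add[OF S] by (simp add: h.add h.scale)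
    qed
    then show ?thesis by simp
  qed
  have inj: "inj_on h (vs1.span b)" unfolding span
    using bij_betw_imp_inj_on[OF bij] hg by (simp add: inj_on_def)
  have "vs2.independent (h ` b)" by (rule h.independent_injective_image[OF b(2) inj])
  moreover have "vs2.span (h ` b) = T"
    using h.span_image[of b] span hg bij by (simp add: bij_betw_def cong: image_cong)
  moreover have "card (h ` b) = card b" by (rule card_image[OF inj_on_subset[OF inj vs1.span_superset]])
  ultimately show ?thesis
    using vs2.dim_span_eq_card_independent[of "h ` b"] b(4) by simp
qed

text \<open>The component \<open>e\<^sub>i A\<^sub>n e\<^sub>j\<close>, with an integer degree, so that the transfer below needs no case
  distinction when a shift makes a degree negative.\<close>

definition corner :: "('k, 'a :: {ring, monoid_mult}) graded_algebra \<Rightarrow> nat \<Rightarrow> nat \<Rightarrow> int \<Rightarrow> 'a set" where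
  "corner A i j n = {idem A i * a * idem A j | a. a \<in> (if n < 0 then {0} else deg A (nat n))}"

lemma (in elementary_graded_algebra) corner_eq:
  assumes "i < rk A" "j < rk A"
  shows "corner A i j n = {x \<in> (if n < 0 then {0} else deg A (nat n)). idem A i * x = x \<and> x * idem A j = x}"
proof -
  let ?D = "if n < 0 then {0} else deg A (nat n)"
  have "idem A i * a * idem A j \<in> ?D" if "a \<in> ?D" for a
    using that deg_mult[OF deg_mult[OF idem_deg[OF assms(1)], of a "nat n"] idem_deg[OF assms(2)]]
    by (simp split: if_splits)
  moreover have "x \<in> corner A i j n" if "x \<in> ?D" "idem A i * x = x" "x * idem A j = x" for x
    unfolding corner_def using that(1) by (intro CollectI exI[of _ x]) (simp add: that(2,3))
  moreover have "idem A i * (idem A i * a * idem A j) = idem A i * a * idem A j"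
    "idem A i * a * idem A j * idem A j = idem A i * a * idem A j" for a
    using idem_sq[OF assms(1)] idem_sq[OF assms(2)] by (simp_all add: mult.assoc) (simp add: mult.assoc[symmetric])
  ultimately show ?thesis unfolding corner_def by blast
qed

lemma (in elementary_graded_algebra) corner_subspace:
  assumes "i < rk A" "j < rk A"
  shows "subspace (corner A i j n)"
  unfolding corner_eq[OF assms] subspace_def
  using deg_zero deg_add deg_scal by (auto simp: distrib_left distrib_right scal_mult_left scal_mult_right)

text \<open>The component \<open>e\<^sub>i A\<^sub>n e\<^sub>j\<close> of the algebra is the vertex component \<open>e\<^sub>i (A e\<^sub>j)\<^sub>n\<close> of a
  module.\<close>

lemma corner_bij:
  assumes A: "elementary_graded_algebra A" and P: "vertex_generator A P j d p" and i: "i < rk A" and j: "j < rk A"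
  shows "bij_betw (\<lambda>y. y \<odot>\<^bsub>P\<^esub> p) (corner A i j n) (vpart A P i (n + d))"
proof -
  interpret A: elementary_graded_algebra A by fact
  interpret P: graded_module A P using vertex_generatorD(1)[OF P] .
  note pc = vertex_generatorD(3)[OF P] and pv = vertex_generatorD(2)[OF P]
  let ?D = "if n < 0 then {0} else deg A (nat n)"
  show ?thesis unfolding bij_betw_def
  proof (intro conjI inj_onI equalityI subsetI)
    fix x y assume x: "x \<in> corner A i j n" and y: "y \<in> corner A i j n" and eq: "x \<odot>\<^bsub>P\<^esub> p = y \<odot>\<^bsub>P\<^esub> p"
    from vertex_generatorD(6)[OF P P.act_diff_eq_zero[OF pc eq]] show "x = y"
      using x y unfolding A.corner_eq[OF i j] by (simp add: left_diff_distrib)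
  next
    fix z assume "z \<in> (\<lambda>y. y \<odot>\<^bsub>P\<^esub> p) ` corner A i j n"
    then obtain y where y: "y \<in> ?D" "idem A i * y = y" "z = y \<odot>\<^bsub>P\<^esub> p" unfolding A.corner_eq[OF i j] by blast
    show "z \<in> vpart A P i (n + d)"
    proof (cases "n < 0")
      case True
      then show ?thesis using y P.zero_vpart P.act_zero_left[OF pc] by simp
    next
      case False
      then show ?thesis using P.act_vpart[OF A i _ y(2) vpartD(1)[OF pv], of "nat n"] y(1,3) by simp
    qed
  next
    fix z assume z: "z \<in> vpart A P i (n + d)"
    have "\<exists>a \<in> ?D. z = a \<odot>\<^bsub>P\<^esub> p"
      using vertex_generatorD(5)[OF P vpartD(1)[OF z]]
    proof
      assume "z = \<zero>\<^bsub>P\<^esub>"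
      then show ?thesis using A.deg_zero P.act_zero_left[OF pc] by (intro bexI[of _ 0]) simp_all
    qed simp
    then obtain a where a: "a \<in> ?D" "z = a \<odot>\<^bsub>P\<^esub> p" by blast
    have "z = (idem A i * a * idem A j) \<odot>\<^bsub>P\<^esub> p"
      using vpartD(2)[OF z] vpartD(2)[OF pv] a(2) P.act_assoc[OF pc] P.act_closed[OF pc] by simp
    moreover have "idem A i * a * idem A j \<in> corner A i j n" unfolding corner_def using a(1) by blast
    ultimately show "z \<in> (\<lambda>y. y \<odot>\<^bsub>P\<^esub> p) ` corner A i j n" by blast
  qed
qed

text \<open>Both sides are spaces of homomorphisms: \<open>e\<^sub>i A\<^sub>n e\<^sub>j\<close> is \<open>Hom(A e\<^sub>i\<langle>n\<rangle>, A e\<^sub>j)\<close>, and \<open>F\<close> carries it to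
  \<open>Hom(B f\<^bsub>\<sigma> i\<^esub>\<langle>n + m i\<rangle>, B f\<^bsub>\<sigma> j\<^esub>\<langle>m j\<rangle>)\<close>.\<close>

lemma (in vertex_matching) corner_transfer:
  assumes i: "i < rk A" and j: "j < rk A" and n: "n + m i = k + m j"
  shows "vector_space.dim (scal B) (corner B (\<sigma> i) (\<sigma> j) k) = vector_space.dim (scal A) (corner A i j n)"
proof -
  let ?P = "proj j 0" and ?p = "gen j 0" and ?q = "img j 0"
  let ?R = "fob F ?P"
  note PD = genD[where n = 0, OF j] and QD = imgD[where n = 0, OF j]
  interpret P: graded_module A ?P by (rule PD(1))
  interpret R: graded_module B ?R by (rule QD(1))
  note bA = corner_bij[where n = n, OF A.elementary_graded_algebra_axioms gen[where n = 0, OF j] i j]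
  note bB = corner_bij[where n = k, OF B.elementary_graded_algebra_axioms img[where n = 0, OF j] \<sigma>_less[OF i] \<sigma>_less[OF j]]
  define f where "f y = \<tau> ?P i n (y \<odot>\<^bsub>?P\<^esub> ?p)" for y
  define g where "g y = inv_into (corner B (\<sigma> i) (\<sigma> j) k) (\<lambda>b. b \<odot>\<^bsub>?R\<^esub> ?q) (f y)" for y
  have f: "bij_betw f (corner A i j n) (vpart B ?R (\<sigma> i) (k + m j))"
    using bij_betw_trans[OF bA[unfolded add_0_right] \<tau>_bij[OF i PD(1), of n]] n
    by (simp add: f_def[abs_def] comp_def)
  have g: "bij_betw g (corner A i j n) (corner B (\<sigma> i) (\<sigma> j) k)"
    using bij_betw_trans[OF f] bij_betw_inv_into[OF bB] by (simp add: g_def[abs_def] comp_def)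
  have gf: "g y \<odot>\<^bsub>?R\<^esub> ?q = f y" if "y \<in> corner A i j n" for y
    unfolding g_def by (rule bij_betw_inv_into_right[OF bB]) (use bij_betw_apply[OF f that] in simp)
  have gI: "g y = z" if "y \<in> corner A i j n" "z \<in> corner B (\<sigma> i) (\<sigma> j) k" "f y = z \<odot>\<^bsub>?R\<^esub> ?q" for y z
    by (rule inj_onD[OF bij_betw_imp_inj_on[OF bB] _ bij_betw_apply[OF g that(1)] that(2)])
      (use gf[OF that(1)] that(3) in simp)
  have yv: "y \<odot>\<^bsub>?P\<^esub> ?p \<in> vpart A ?P i n" if "y \<in> corner A i j n" for y
    using bij_betw_apply[OF bA that] by simp
  note sA = A.corner_subspace[OF i j, of n] and sB = B.corner_subspace[OF \<sigma>_less[OF i] \<sigma>_less[OF j], of k]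
  have "vector_space.dim (scal A) (corner A i j n) = vector_space.dim (scal B) (corner B (\<sigma> i) (\<sigma> j) k)"
  proof (rule dim_eq_if_linear_bij[OF A.vector_space_axioms B.vector_space_axioms sA g])
    fix x y assume x: "x \<in> corner A i j n" and y: "y \<in> corner A i j n"
    show "g (x + y) = g x + g y"
    proof (rule gI)
      show "x + y \<in> corner A i j n" by (rule A.subspace_add[OF sA x y])
      show "g x + g y \<in> corner B (\<sigma> i) (\<sigma> j) k"
        by (rule B.subspace_add[OF sB bij_betw_apply[OF g x] bij_betw_apply[OF g y]])
      show "f (x + y) = (g x + g y) \<odot>\<^bsub>?R\<^esub> ?q"
        using P.act_add_left[OF PD(3)] R.act_add_left[OF QD(3)] \<tau>_add[OF i PD(1) yv[OF x] yv[OF y]] gf[OF x] gf[OF y]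
        by (simp add: f_def)
    qed
  next
    fix c x assume x: "x \<in> corner A i j n"
    show "g (scal A c x) = scal B c (g x)"
    proof (rule gI)
      show "scal A c x \<in> corner A i j n" by (rule A.subspace_scale[OF sA x])
      show "scal B c (g x) \<in> corner B (\<sigma> i) (\<sigma> j) k" by (rule B.subspace_scale[OF sB bij_betw_apply[OF g x]])
      show "f (scal A c x) = scal B c (g x) \<odot>\<^bsub>?R\<^esub> ?q"
        using P.act_assoc[OF PD(3), of "scal A c 1" x] R.act_assoc[OF QD(3), of "scal B c 1" "g x"]
          \<tau>_scal[OF i PD(1) yv[OF x], of c] gf[OF x]
        by (simp add: f_def A.scal_one_mult B.scal_one_mult)
    qed
  qed
  then show ?thesis by simp
qed

section \<open>Monomial matrices\<close>

lemma matrix_inverse_eqI: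
  fixes M :: "'a :: field mat"
  assumes M: "M \<in> carrier_mat n n" and N: "N \<in> carrier_mat n n" and MN: "M * N = 1\<^sub>m n" and NM: "N * M = 1\<^sub>m n"
  shows "matrix_inverse M = N"
proof -
  have "M \<in> Units (ring_mat TYPE('a) n ())"
    unfolding Units_def ring_mat_def using M N MN NM by auto
  then have "mat_inverse M \<noteq> None" using mat_inverse(1)[OF M, of "()"] by blast
  then obtain K where K: "mat_inverse M = Some K" by blast
  have "M * K = 1\<^sub>m n" "K \<in> carrier_mat n n" using mat_inverse(2)[OF M K] by auto
  then have "K = N * (M * K)" using assoc_mult_mat[OF N M, of K n] NM by simp
  then show ?thesis using K N \<open>M * K = 1\<^sub>m n\<close> by simp
qed

text \<open>The matrices \<open>\<Pi> diag(x)\<close> and \<open>diag(y) \<Pi>\<^sup>T\<close>, given by their entries; they are inverse to each other if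
  \<open>x\<^sub>i y\<^sub>i = 1\<close>. Conjugation by them relabels the entries by \<open>\<sigma>\<close> and rescales them.\<close>

definition monomial_mat :: "nat \<Rightarrow> (nat \<Rightarrow> nat) \<Rightarrow> (nat \<Rightarrow> 'a :: zero) \<Rightarrow> 'a mat" where
  "monomial_mat r \<sigma> x = mat r r (\<lambda>(a, b). if a = \<sigma> b then x b else 0)"
definition monomial_inv :: "nat \<Rightarrow> (nat \<Rightarrow> nat) \<Rightarrow> (nat \<Rightarrow> 'a :: zero) \<Rightarrow> 'a mat" where
  "monomial_inv r \<sigma> y = mat r r (\<lambda>(a, b). if b = \<sigma> a then y a else 0)"

lemma monomial_carrier [simp]:
  "monomial_mat r \<sigma> x \<in> carrier_mat r r" "monomial_inv r \<sigma> x \<in> carrier_mat r r"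
  "dim_row (monomial_mat r \<sigma> x) = r" "dim_col (monomial_mat r \<sigma> x) = r"
  "dim_row (monomial_inv r \<sigma> x) = r" "dim_col (monomial_inv r \<sigma> x) = r"
  by (simp_all add: monomial_mat_def monomial_inv_def)

lemma map_monomial:
  assumes "h 0 = 0"
  shows "map_mat h (monomial_mat r \<sigma> x) = monomial_mat r \<sigma> (\<lambda>i. h (x i))"
    "map_mat h (monomial_inv r \<sigma> x) = monomial_inv r \<sigma> (\<lambda>i. h (x i))"
  by (rule eq_matI; simp add: monomial_mat_def monomial_inv_def assms)+

context
  fixes r :: nat and \<sigma> :: "nat \<Rightarrow> nat"
  assumes \<sigma>: "\<sigma> permutes {..<r}"
begin

lemma permutes_lt: "i < r \<Longrightarrow> \<sigma> i < r"
  using permutes_in_image[OF \<sigma>] by simp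

lemma permutes_cases: "a < r \<Longrightarrow> \<exists>i<r. a = \<sigma> i"
  using permutes_image[OF \<sigma>] by (metis imageE lessThan_iff)

lemma permutes_eq_iff: "\<sigma> i = \<sigma> j \<longleftrightarrow> i = j"
  using permutes_inj[OF \<sigma>] by (simp add: inj_eq)

lemma monomial_mult_index:
  fixes M :: "'a :: comm_ring_1 mat"
  assumes M: "M \<in> carrier_mat r r" and i: "i < r" and k: "k < r"
  shows "(monomial_mat r \<sigma> x * M) $$ (\<sigma> i, k) = x i * M $$ (i, k)"
proof -
  have "(monomial_mat r \<sigma> x * M) $$ (\<sigma> i, k) = (\<Sum>l = 0..<r. (if i = l then x l else 0) * M $$ (l, k))"
    using M k permutes_lt[OF i] by (simp add: scalar_prod_def monomial_mat_def permutes_eq_iff)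
  also have "\<dots> = (\<Sum>l = 0..<r. if i = l then x l * M $$ (l, k) else 0)" by (rule sum.cong) auto
  finally show ?thesis using i by simp
qed

lemma mult_monomial_inv_index:
  fixes M :: "'a :: comm_ring_1 mat"
  assumes M: "M \<in> carrier_mat r r" and j: "j < r" and k: "k < r"
  shows "(M * monomial_inv r \<sigma> y) $$ (k, \<sigma> j) = M $$ (k, j) * y j"
proof -
  have "(M * monomial_inv r \<sigma> y) $$ (k, \<sigma> j) = (\<Sum>l = 0..<r. M $$ (k, l) * (if j = l then y l else 0))"
    using M k permutes_lt[OF j] by (simp add: scalar_prod_def monomial_inv_def permutes_eq_iff)
  also have "\<dots> = (\<Sum>l = 0..<r. if j = l then M $$ (k, l) * y l else 0)" by (rule sum.cong) auto
  finally show ?thesis using j by simp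
qed

lemma monomial_conj_eqI:
  fixes M :: "'a :: comm_ring_1 mat"
  assumes M: "M \<in> carrier_mat r r" and N: "N \<in> carrier_mat r r"
    and eq: "\<And>i j. i < r \<Longrightarrow> j < r \<Longrightarrow> N $$ (\<sigma> i, \<sigma> j) = x i * M $$ (i, j) * y j"
  shows "N = monomial_mat r \<sigma> x * M * monomial_inv r \<sigma> y"
proof (rule eq_matI)
  fix a b assume "a < dim_row (monomial_mat r \<sigma> x * M * monomial_inv r \<sigma> y)"
    "b < dim_col (monomial_mat r \<sigma> x * M * monomial_inv r \<sigma> y)"
  then have "a < r" "b < r" by simp_all
  then obtain i j where i: "i < r" "a = \<sigma> i" and j: "j < r" "b = \<sigma> j" using permutes_cases by meson
  have "monomial_mat r \<sigma> x * M \<in> carrier_mat r r" using M by (intro mult_carrier_mat) simp_all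
  from mult_monomial_inv_index[OF this j(1) permutes_lt[OF i(1)], of y] show "N $$ (a, b) = (monomial_mat r \<sigma> x * M * monomial_inv r \<sigma> y) $$ (a, b)"
    using monomial_mult_index[OF M i(1) j(1), of x]
      eq[OF i(1) j(1)] i(2) j(2) by simp
qed (use N in simp_all)

lemma monomial_inverse:
  fixes x y :: "nat \<Rightarrow> 'a :: comm_ring_1"
  assumes xy: "\<And>i. i < r \<Longrightarrow> x i * y i = 1"
  shows "monomial_mat r \<sigma> x * monomial_inv r \<sigma> y = 1\<^sub>m r"
    and "monomial_inv r \<sigma> y * monomial_mat r \<sigma> x = 1\<^sub>m r"
proof -
  have "1\<^sub>m r = monomial_mat r \<sigma> x * 1\<^sub>m r * monomial_inv r \<sigma> y"
    by (rule monomial_conj_eqI) (auto simp: permutes_lt permutes_eq_iff xy)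
  then show "monomial_mat r \<sigma> x * monomial_inv r \<sigma> y = 1\<^sub>m r"
    by (simp only: right_mult_one_mat[OF monomial_carrier(1)])
  show "monomial_inv r \<sigma> y * monomial_mat r \<sigma> x = 1\<^sub>m r"
  proof (rule eq_matI)
    fix a b assume "a < dim_row (1\<^sub>m r :: 'a mat)" "b < dim_col (1\<^sub>m r :: 'a mat)"
    then have ab: "a < r" "b < r" by simp_all
    have "(monomial_inv r \<sigma> y * monomial_mat r \<sigma> x) $$ (a, b) =
        (\<Sum>l = 0..<r. (if l = \<sigma> a then y a else 0) * (if l = \<sigma> b then x b else 0))"
      using ab by (simp add: scalar_prod_def monomial_inv_def monomial_mat_def)
    also have "\<dots> = (\<Sum>l = 0..<r. if l = \<sigma> a then y a * (if a = b then x b else 0) else 0)"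
      by (rule sum.cong) (auto simp: permutes_eq_iff)
    also have "\<dots> = 1\<^sub>m r $$ (a, b)" using ab permutes_lt[OF ab(1)] xy[OF ab(1)]
      by (cases "a = b") (simp_all add: mult.commute)
    finally show "(monomial_inv r \<sigma> y * monomial_mat r \<sigma> x) $$ (a, b) = 1\<^sub>m r $$ (a, b)" .
  qed simp_all
qed

lemma permutation_diag:
  fixes x :: "nat \<Rightarrow> 'a :: comm_ring_1"
  shows "permutation_matrix r \<sigma> * mat_diag r x = monomial_mat r \<sigma> x"
    and "mat_diag r x * transpose_mat (permutation_matrix r \<sigma>) = monomial_inv r \<sigma> x"
proof -
  have P: "(permutation_matrix r \<sigma> :: 'a mat) \<in> carrier_mat r r" by (simp add: permutation_matrix_def)
  then have PT: "transpose_mat (permutation_matrix r \<sigma> :: 'a mat) \<in> carrier_mat r r" by simp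
  show "permutation_matrix r \<sigma> * mat_diag r x = monomial_mat r \<sigma> x"
    unfolding mat_diag_mult_right[OF P]
    by (rule eq_matI) (simp_all add: permutation_matrix_def monomial_mat_def)
  show "mat_diag r x * transpose_mat (permutation_matrix r \<sigma>) = monomial_inv r \<sigma> x"
    unfolding mat_diag_mult_left[OF PT]
    by (rule eq_matI) (simp_all add: permutation_matrix_def monomial_inv_def)
qed

end

lemma matrix_inverse_mat_diag:
  fixes x :: "nat \<Rightarrow> 'a :: field"
  assumes "\<And>i. i < r \<Longrightarrow> x i \<noteq> 0"
  shows "matrix_inverse (mat_diag r x) = mat_diag r (\<lambda>i. inverse (x i))"
proof (rule matrix_inverse_eqI[of _ r])
  have d: "mat_diag r f * mat_diag r g = mat_diag r (\<lambda>i. f i * g i)" for f g :: "nat \<Rightarrow> 'a"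
    unfolding mat_diag_mult_left[OF mat_diag_dim] by (rule eq_matI) (auto simp: mat_diag_def)
  show "mat_diag r x * mat_diag r (\<lambda>i. inverse (x i)) = 1\<^sub>m r" "mat_diag r (\<lambda>i. inverse (x i)) * mat_diag r x = 1\<^sub>m r"
    unfolding d using assms by (auto simp: mat_diag_def intro!: eq_matI)
qed simp_all

section \<open>Laurent expansions of rational functions\<close>

definition poly_at :: "rat \<Rightarrow> rat poly \<Rightarrow> rat fls" where
  "poly_at c p = fps_to_fls (fps_of_poly (pcompose p [:c, 1:]))"

lemma poly_at_hom: "poly_at c (p + q) = poly_at c p + poly_at c q" "poly_at c (p * q) = poly_at c p * poly_at c q"
  "poly_at c 1 = 1" "poly_at c 0 = 0"
  by (simp_all add: poly_at_def pcompose_add pcompose_mult fps_of_poly_add fps_of_poly_mult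
      fls_times_fps_to_fls pcompose_1)

lemma poly_at_eq_0: "poly_at c p = 0 \<longleftrightarrow> p = 0"
  using pcompose_eq_0[of p "[:c, 1:]"] fps_of_poly_eq_iff[of "pcompose p [:c, 1:]" 0] by (auto simp: poly_at_def)

text \<open>The definition of \<^const>\<open>laurent_at\<close> refers to the normalised fraction. That any representing
  fraction has the same expansion makes it a homomorphism of fields.\<close>

lemma laurent_at_Fract:
  assumes "q \<noteq> 0"
  shows "laurent_at c (Fract p q) = poly_at c p / poly_at c q"
proof -
  obtain p' q' where pq: "quot_of_fract (Fract p q) = (p', q')" by force
  have "q' \<noteq> 0" "Fract p' q' = Fract p q"
    using snd_quot_of_fract_nonzero[of "Fract p q"] Fract_quot_of_fract[of "Fract p q"] by (simp_all add: pq)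
  then have "p' * q = p * q'" using assms by (simp add: eq_fract)
  then have "poly_at c p' * poly_at c q = poly_at c p * poly_at c q'" by (metis poly_at_hom(2))
  then have "poly_at c p' / poly_at c q' = poly_at c p / poly_at c q"
    using \<open>q' \<noteq> 0\<close> assms by (simp add: frac_eq_eq poly_at_eq_0)
  then show ?thesis by (simp add: laurent_at_def pq poly_at_def)
qed

interpretation laurent_at: field_hom "laurent_at c" for c
proof
  show "laurent_at c 0 = 0" "laurent_at c 1 = 1"
    by (simp_all add: laurent_at_def pcompose_1)
  fix x y :: "rat poly fract"
  obtain p q where x: "x = Fract p q" "q \<noteq> 0" by (cases x)
  obtain p' q' where y: "y = Fract p' q'" "q' \<noteq> 0" by (cases y)
  show "laurent_at c (x + y) = laurent_at c x + laurent_at c y"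
    using x y by (simp add: laurent_at_Fract poly_at_hom poly_at_eq_0 field_simps)
  show "laurent_at c (x * y) = laurent_at c x * laurent_at c y"
    using x y by (simp add: laurent_at_Fract poly_at_hom poly_at_eq_0)
qed

lemma laurent_at_X: "laurent_at c (Fract [:0, 1:] 1) = fps_to_fls (fps_const c + fps_X)"
  by (simp add: laurent_at_Fract poly_at_hom) (simp add: poly_at_def pcompose_pCons fps_of_poly_linear add.commute)

lemma field_hom_power_int:
  assumes "field_hom h"
  shows "h (x powi n) = h x powi n"
proof -
  interpret h: field_hom h by fact
  show ?thesis by (simp add: power_int_def h.hom_power h.hom_inverse)
qed

lemma inj_map_mat:
  assumes "inj h" "map_mat h M = map_mat h N"
  shows "M = N"
proof (rule eq_matI)
  have d: "dim_row M = dim_row N" "dim_col M = dim_col N"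
    using arg_cong[OF assms(2), of dim_row] arg_cong[OF assms(2), of dim_col] by simp_all
  fix i j assume ij: "i < dim_row N" "j < dim_col N"
  have "map_mat h M $$ (i, j) = map_mat h N $$ (i, j)" using assms(2) by simp
  then show "M $$ (i, j) = N $$ (i, j)" using ij d injD[OF assms(1)] by simp
qed (use arg_cong[OF assms(2), of dim_row] arg_cong[OF assms(2), of dim_col] in simp_all)

lemma rational_hilbert_unique: "rational_hilbert A R \<Longrightarrow> rational_hilbert A R' \<Longrightarrow> R = R'"
  unfolding rational_hilbert_def using inj_map_mat[OF laurent_at.inj_f] by metis

interpretation int_fps_to_fls: comm_ring_hom int_fps_to_fls
  by unfold_locales
    (simp_all add: int_fps_to_fls_def fps_to_fls_plus[symmetric] fls_times_fps_to_fls[symmetric] del: fps_to_fls_plus,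
      simp_all add: fps_eq_iff fps_mult_nth)

lemma int_fps_to_fls_eq_0: "int_fps_to_fls f = 0 \<longleftrightarrow> f = 0"
  by (simp add: int_fps_to_fls_def fps_eq_iff)

interpretation fps_nth_0: comm_ring_hom "\<lambda>f :: int fps. fps_nth f 0"
  by unfold_locales simp_all

lemma dim_corner_0:
  assumes A: "elementary_graded_algebra A" and i: "i < rk A" and j: "j < rk A"
  shows "vector_space.dim (scal A) (corner A i j 0) = (if i = j then 1 else 0)"
proof -
  interpret A: elementary_graded_algebra A by fact
  have "corner A i j 0 = (if i = j then A.span {idem A i} else {0})"
  proof (intro equalityI subsetI)
    fix x assume "x \<in> corner A i j 0"
    then obtain a where a: "a \<in> deg A 0" "x = idem A i * a * idem A j" by (auto simp: corner_def)
    obtain c where "a * idem A j = scal A c (idem A j)" using A.deg0_idem[OF a(1) j] by blast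
    then have "x = scal A c (idem A i * idem A j)" using a(2) by (simp add: mult.assoc A.scal_mult_right)
    then show "x \<in> (if i = j then A.span {idem A i} else {0})"
      using A.idem_mult[OF i j] by (auto intro: A.span_scale A.span_base)
  next
    fix x assume x: "x \<in> (if i = j then A.span {idem A i} else {0})"
    show "x \<in> corner A i j 0"
    proof (cases "i = j")
      case True
      then obtain c where "x = scal A c (idem A i)" using x by (auto simp: A.span_singleton)
      then show ?thesis unfolding A.corner_eq[OF i j]
        using True A.idem_sq[OF i] A.deg_scal[OF A.idem_deg[OF i]] by (simp add: A.scal_mult_left A.scal_mult_right)
    next
      case False
      then show ?thesis using x A.subspace_0[OF A.corner_subspace[OF i j]] by simp
    qed
  qed
  moreover have "A.dim {idem A i} = 1"
    using A.dim_eq_card_independent[of "{idem A i}"] A.idem_nonzero[OF i] by (simp add: A.independent_insert)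
  moreover have "A.dim {0} = 0" by (intro A.dim_unique[of "{}"]) (simp_all add: A.independent_empty)
  ultimately show ?thesis by (cases "i = j") (simp_all add: A.dim_span)
qed

text \<open>The Hilbert matrix is the identity modulo \<open>x\<close>, so its determinant is not zero.\<close>

lemma rational_hilbert_invertible:
  assumes A: "elementary_graded_algebra A" and R: "rational_hilbert A R"
  shows "\<exists>R'. R' \<in> carrier_mat (rk A) (rk A) \<and> R * R' = 1\<^sub>m (rk A) \<and> R' * R = 1\<^sub>m (rk A)"
proof -
  let ?r = "rk A" and ?H = "hilbert_matrix A"
  have Rc: "R \<in> carrier_mat ?r ?r" and RH: "map_mat (laurent_at 0) R = map_mat int_fps_to_fls ?H"
    using R by (simp_all add: rational_hilbert_def)
  have "map_mat (\<lambda>f. fps_nth f 0) ?H = 1\<^sub>m ?r"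
    by (rule eq_matI) (auto simp: hilbert_matrix_def dim_corner_0[OF A, unfolded corner_def, simplified])
  then have "fps_nth (det ?H) 0 = 1" using fps_nth_0.hom_det[of ?H] by simp
  then have "int_fps_to_fls (det ?H) \<noteq> 0" unfolding int_fps_to_fls_eq_0 by auto
  then have "laurent_at 0 (det R) \<noteq> 0"
    using int_fps_to_fls.hom_det[of ?H] laurent_at.hom_det[of 0 R] RH by simp
  then have "det R \<noteq> 0" by auto
  from det_non_zero_imp_unit[OF Rc this, of "()"] show ?thesis
    unfolding Units_def ring_mat_def by auto
qed

lemma euler_matrix_eq:
  assumes R: "rational_hilbert A R" and R': "R' \<in> carrier_mat (rk A) (rk A)" "R * R' = 1\<^sub>m (rk A)" "R' * R = 1\<^sub>m (rk A)"
  shows "euler_matrix A = R'"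
proof -
  have The: "(THE R. rational_hilbert A R) = R"
    by (rule the_equality[of "rational_hilbert A", OF R rational_hilbert_unique[OF _ R]])
  have "R \<in> carrier_mat (rk A) (rk A)" using R by (simp add: rational_hilbert_def)
  from matrix_inverse_eqI[OF this R'] show ?thesis unfolding euler_matrix_def The .
qed

section \<open>Conjugation over \<open>\<rat>[[t]]\<close>\<close>

lemma invertible_mat_mult:
  fixes U V U' V' :: "'a :: comm_ring_1 mat"
  assumes "U \<in> carrier_mat r r" "V \<in> carrier_mat r r" "invertible_mat U" "invertible_mat V"
  shows "invertible_mat (U * V)"
proof -
  obtain U' where U': "U * U' = 1\<^sub>m r" "U' * U = 1\<^sub>m (dim_row U')"
    using assms by (auto simp: invertible_mat_def inverts_mat_def)
  obtain V' where V': "V * V' = 1\<^sub>m r" "V' * V = 1\<^sub>m (dim_row V')"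
    using assms by (auto simp: invertible_mat_def inverts_mat_def)
  have U'c: "U' \<in> carrier_mat r r"
    using assms arg_cong[OF U'(1), of dim_col] arg_cong[OF U'(2), of dim_col] by auto
  have V'c: "V' \<in> carrier_mat r r"
    using assms arg_cong[OF V'(1), of dim_col] arg_cong[OF V'(2), of dim_col] by auto
  have "U * V * (V' * U') = U * (V * V') * U'"
    using assms U'c V'c by (simp add: assoc_mult_mat[of _ r r _ r _ r])
  moreover have "V' * U' * (U * V) = V' * (U' * U) * V"
    using assms U'c V'c by (simp add: assoc_mult_mat[of _ r r _ r _ r])
  ultimately have "U * V * (V' * U') = 1\<^sub>m r" "V' * U' * (U * V) = 1\<^sub>m r"
    using assms U' V' U'c V'c by (simp_all add: right_mult_one_mat[of _ r r])
  then show ?thesis unfolding invertible_mat_def inverts_mat_def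
    using assms U'c V'c by (auto intro!: exI[of _ "V' * U'"])
qed

interpretation fps_to_fls: comm_ring_hom "fps_to_fls :: rat fps \<Rightarrow> rat fls"
  by unfold_locales (simp_all add: fls_times_fps_to_fls)

text \<open>If \<open>P E\<^sub>A Q\<close> is the Smith form, then so is \<open>(P U\<^sup>-\<^sup>1) E\<^sub>B (U Q)\<close>.\<close>

lemma euler_smith_profile_conj:
  fixes U U' :: "rat fps mat"
  assumes rk: "rk A = r" "rk B = r" and E: "euler_matrix_at_1 A \<in> carrier_mat r r"
    and U: "U \<in> carrier_mat r r" and U': "U' \<in> carrier_mat r r" and UU': "U * U' = 1\<^sub>m r" "U' * U = 1\<^sub>m r"
    and EB: "euler_matrix_at_1 B = map_mat fps_to_fls U * euler_matrix_at_1 A * map_mat fps_to_fls U'"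
    and prof: "euler_smith_profile A as"
  shows "euler_smith_profile B as"
proof -
  let ?f = "map_mat fps_to_fls :: rat fps mat \<Rightarrow> rat fls mat"
  let ?E = "euler_matrix_at_1 A"
  have inv: "invertible_mat U" "invertible_mat U'"
    using U U' UU' unfolding invertible_mat_def inverts_mat_def by auto
  obtain P Q where P: "P \<in> carrier_mat r r" "invertible_mat P" and Q: "Q \<in> carrier_mat r r" "invertible_mat Q"
    and D: "?f P * ?E * ?f Q = mat_diag r (\<lambda>i. fls_X_intpow (as ! i))" and as: "length as = r" "sorted as"
    using prof unfolding euler_smith_profile_def rk by blast
  have hU: "?f U * ?f U' = 1\<^sub>m r" "?f U' * ?f U = 1\<^sub>m r"
    using fps_to_fls.mat_hom_mult[OF U U'] fps_to_fls.mat_hom_mult[OF U' U] UU' fps_to_fls.mat_hom_one by metis+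
  note [simp] = assoc_mult_mat[of _ r r _ r _ r]
  have c: "?f P \<in> carrier_mat r r" "?f Q \<in> carrier_mat r r" "?f U \<in> carrier_mat r r" "?f U' \<in> carrier_mat r r"
    using P Q U U' by simp_all
  have "?f (P * U') * euler_matrix_at_1 B * ?f (U * Q) = ?f P * ((?f U' * ?f U) * (?E * ((?f U' * ?f U) * ?f Q)))"
    unfolding EB fps_to_fls.mat_hom_mult[OF P(1) U'] fps_to_fls.mat_hom_mult[OF U Q(1)]
    using c E by (simp add: mult_carrier_mat[of _ r r _ r])
  also have "\<dots> = ?f P * ?E * ?f Q" unfolding hU using c E by (simp add: mult_carrier_mat[of _ r r _ r])
  finally have "?f (P * U') * euler_matrix_at_1 B * ?f (U * Q) = mat_diag r (\<lambda>i. fls_X_intpow (as ! i))"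
    using D by simp
  then show ?thesis unfolding euler_smith_profile_def rk
    using as invertible_mat_mult[OF P(1) U' P(2) inv(2)] invertible_mat_mult[OF U Q(1) inv(1) Q(2)] P(1) Q(1) U U'
    by (intro conjI bexI[of _ "P * U'"] bexI[of _ "U * Q"]) (simp_all add: mult_carrier_mat[of _ r r _ r])
qed

lemma standard_lattice_eq: "standard_lattice r = map_vec fps_to_fls ` carrier_vec r"
proof (intro equalityI subsetI)
  fix v assume v: "v \<in> standard_lattice r"
  define w where "w = map_vec fls_regpart v"
  have vc: "v \<in> carrier_vec r" using v by (simp add: standard_lattice_def)
  have "map_vec fps_to_fls w = v"
  proof (rule eq_vecI)
    fix i assume i: "i < dim_vec v"
    then have "v $ i \<in> range fps_to_fls" using v vc by (simp add: standard_lattice_def)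
    then obtain f where "v $ i = fps_to_fls f" by (rule rangeE)
    then show "map_vec fps_to_fls w $ i = v $ i" using i by (simp add: w_def)
  qed (simp add: w_def)
  moreover have "w \<in> carrier_vec r" using vc by (simp add: w_def)
  ultimately show "v \<in> map_vec fps_to_fls ` carrier_vec r" by (metis imageI)
next
  fix v :: "rat fls vec" assume "v \<in> map_vec fps_to_fls ` carrier_vec r"
  then obtain w where w: "v = map_vec fps_to_fls w" "w \<in> carrier_vec r" by (rule imageE)
  then show "v \<in> standard_lattice r" unfolding standard_lattice_def w(1) by simp
qed

lemma mult_standard_lattice:
  assumes U: "(U :: rat fps mat) \<in> carrier_mat r r" and v: "v \<in> standard_lattice r"
  shows "map_mat fps_to_fls U *\<^sub>v v \<in> standard_lattice r"
proof -
  obtain w where w: "w \<in> carrier_vec r" "v = map_vec fps_to_fls w" using v unfolding standard_lattice_eq by blast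
  have "map_mat fps_to_fls U *\<^sub>v v = map_vec fps_to_fls (U *\<^sub>v w)"
    using fps_to_fls.mult_mat_vec_hom[OF U w(1)] w(2) by simp
  then show ?thesis unfolding standard_lattice_eq using U w(1) by (auto intro!: imageI)
qed

text \<open>The cosets in \<open>N\<close> are the images under \<open>f\<close> of the cosets in \<open>M\<close>, so the operations on them
  can be computed in \<open>M\<close>.\<close>

lemma mod_iso_quotient_module:
  fixes M :: "('a, 'm) module" and N :: "('a, 'n) module"
  assumes M: "abelian_group M" and H: "additive_subgroup H M"
    and actH: "\<And>a h. h \<in> H \<Longrightarrow> a \<odot>\<^bsub>M\<^esub> h \<in> H"
    and act: "\<And>a x. x \<in> carrier M \<Longrightarrow> a \<odot>\<^bsub>M\<^esub> x \<in> carrier M"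
    and distr: "\<And>a x y. x \<in> carrier M \<Longrightarrow> y \<in> carrier M \<Longrightarrow> a \<odot>\<^bsub>M\<^esub> (x \<oplus>\<^bsub>M\<^esub> y) = a \<odot>\<^bsub>M\<^esub> x \<oplus>\<^bsub>M\<^esub> a \<odot>\<^bsub>M\<^esub> y"
    and bij: "bij_betw f (carrier M) (carrier N)" and fH: "f ` H = K"
    and f_add: "\<And>x y. x \<in> carrier M \<Longrightarrow> y \<in> carrier M \<Longrightarrow> f (x \<oplus>\<^bsub>M\<^esub> y) = f x \<oplus>\<^bsub>N\<^esub> f y"
    and f_act: "\<And>a x. x \<in> carrier M \<Longrightarrow> f (a \<odot>\<^bsub>M\<^esub> x) = a \<odot>\<^bsub>N\<^esub> f x"
  shows "mod_iso (quotient_module M H) (quotient_module N K)"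
proof -
  interpret M: abelian_group M by fact
  interpret H: additive_subgroup H M by fact
  interpret HM: abelian_subgroup H M by (rule abelian_subgroupI3[OF H M])
  let ?M = "quotient_module M H" and ?N = "quotient_module N K"
  have Hc: "h \<in> carrier M" if "h \<in> H" for h using H.a_subset that by blast
  have carM: "carrier ?M = (\<lambda>x. H +>\<^bsub>M\<^esub> x) ` carrier M" and carN: "carrier ?N = (\<lambda>x. K +>\<^bsub>N\<^esub> x) ` carrier N"
    by (auto simp: quotient_module_def A_RCOSETS_def')
  have coset: "f ` (H +>\<^bsub>M\<^esub> x) = K +>\<^bsub>N\<^esub> f x" if "x \<in> carrier M" for x
  proof -
    have "f ` (H +>\<^bsub>M\<^esub> x) = (\<lambda>h. f (h \<oplus>\<^bsub>M\<^esub> x)) ` H" by (auto simp: a_r_coset_def')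
    also have "\<dots> = (\<lambda>h. f h \<oplus>\<^bsub>N\<^esub> f x) ` H" using f_add Hc that by (intro image_cong) auto
    finally show ?thesis unfolding fH[symmetric] by (auto simp: a_r_coset_def')
  qed
  have cosetc: "H +>\<^bsub>M\<^esub> x \<subseteq> carrier M" if "x \<in> carrier M" for x
    using that Hc by (auto simp: a_r_coset_def')
  have self: "x \<in> H +>\<^bsub>M\<^esub> x" if "x \<in> carrier M" for x by (rule HM.a_rcos_self[OF that])
  have addM: "(H +>\<^bsub>M\<^esub> x) \<oplus>\<^bsub>?M\<^esub> (H +>\<^bsub>M\<^esub> y) = H +>\<^bsub>M\<^esub> (x \<oplus>\<^bsub>M\<^esub> y)"
    if "x \<in> carrier M" "y \<in> carrier M" for x y
    using HM.a_rcos_sum[OF that] by (simp add: quotient_module_def)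
  have actM: "a \<odot>\<^bsub>?M\<^esub> (H +>\<^bsub>M\<^esub> x) = H +>\<^bsub>M\<^esub> (a \<odot>\<^bsub>M\<^esub> x)" if x: "x \<in> carrier M" for a x
  proof -
    have eq: "H +>\<^bsub>M\<^esub> (a \<odot>\<^bsub>M\<^esub> z) = H +>\<^bsub>M\<^esub> (a \<odot>\<^bsub>M\<^esub> x)" if z: "z \<in> H +>\<^bsub>M\<^esub> x" for z
    proof -
      obtain h where h: "h \<in> H" "z = h \<oplus>\<^bsub>M\<^esub> x" using z by (auto simp: a_r_coset_def')
      have "a \<odot>\<^bsub>M\<^esub> z \<in> H +>\<^bsub>M\<^esub> (a \<odot>\<^bsub>M\<^esub> x)"
        using actH[OF h(1)] distr[OF Hc[OF h(1)] x] h(2) by (auto simp: a_r_coset_def')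
      from HM.a_repr_independence'[OF this act[OF x]] show ?thesis by simp
    qed
    have "(\<Union>z\<in>H +>\<^bsub>M\<^esub> x. H +>\<^bsub>M\<^esub> (a \<odot>\<^bsub>M\<^esub> z)) = (\<Union>z\<in>H +>\<^bsub>M\<^esub> x. H +>\<^bsub>M\<^esub> (a \<odot>\<^bsub>M\<^esub> x))"
      by (rule SUP_cong[OF refl eq])
    also have "\<dots> = H +>\<^bsub>M\<^esub> (a \<odot>\<^bsub>M\<^esub> x)" by (rule cSUP_const) (use self[OF x] in blast)
    finally show ?thesis by (simp add: quotient_module_def)
  qed
  define \<phi> where "\<phi> = (\<lambda>X\<in>carrier ?M. f ` X)"
  have \<phi>: "\<phi> (H +>\<^bsub>M\<^esub> x) = K +>\<^bsub>N\<^esub> f x" if "x \<in> carrier M" for x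
    using that coset by (simp add: \<phi>_def carM)
  have img: "\<phi> ` carrier ?M = carrier ?N"
  proof -
    have "\<phi> ` carrier ?M = (\<lambda>x. K +>\<^bsub>N\<^esub> f x) ` carrier M"
      unfolding carM image_image using \<phi> by (intro image_cong) auto
    also have "\<dots> = (\<lambda>x. K +>\<^bsub>N\<^esub> x) ` (f ` carrier M)" by (simp add: image_image)
    finally show ?thesis using bij by (simp add: carN bij_betw_def)
  qed
  have N_add: "(K +>\<^bsub>N\<^esub> f x) \<oplus>\<^bsub>?N\<^esub> (K +>\<^bsub>N\<^esub> f y) = K +>\<^bsub>N\<^esub> f (x \<oplus>\<^bsub>M\<^esub> y)"
    if x: "x \<in> carrier M" and y: "y \<in> carrier M" for x y
  proof -
    let ?X = "H +>\<^bsub>M\<^esub> x" and ?Y = "H +>\<^bsub>M\<^esub> y"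
    have "f ` (?X <+>\<^bsub>M\<^esub> ?Y) = (\<Union>u\<in>?X. \<Union>v\<in>?Y. {f (u \<oplus>\<^bsub>M\<^esub> v)})" by (auto simp: set_add_def')
    also have "\<dots> = (\<Union>u\<in>?X. \<Union>v\<in>?Y. {f u \<oplus>\<^bsub>N\<^esub> f v})"
      using f_add subsetD[OF cosetc[OF x]] subsetD[OF cosetc[OF y]] by (intro SUP_cong refl) simp
    also have "\<dots> = (f ` ?X) <+>\<^bsub>N\<^esub> (f ` ?Y)" by (auto simp: set_add_def')
    finally show ?thesis using coset[OF x] coset[OF y] coset[of "x \<oplus>\<^bsub>M\<^esub> y"] addM[OF x y] x y
      by (simp add: quotient_module_def)
  qed
  have N_act: "a \<odot>\<^bsub>?N\<^esub> (K +>\<^bsub>N\<^esub> f x) = K +>\<^bsub>N\<^esub> f (a \<odot>\<^bsub>M\<^esub> x)" if x: "x \<in> carrier M" for a x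
  proof -
    let ?X = "H +>\<^bsub>M\<^esub> x"
    have "f ` (\<Union>u\<in>?X. H +>\<^bsub>M\<^esub> (a \<odot>\<^bsub>M\<^esub> u)) = (\<Union>u\<in>?X. f ` (H +>\<^bsub>M\<^esub> (a \<odot>\<^bsub>M\<^esub> u)))" by blast
    also have "\<dots> = (\<Union>u\<in>?X. K +>\<^bsub>N\<^esub> (a \<odot>\<^bsub>N\<^esub> f u))"
      using coset act f_act subsetD[OF cosetc[OF x]] by (intro SUP_cong refl) simp
    also have "\<dots> = (\<Union>v\<in>f ` ?X. K +>\<^bsub>N\<^esub> (a \<odot>\<^bsub>N\<^esub> v))" by blast
    finally show ?thesis using coset[OF x] coset[OF act[OF x, of a]] actM[OF x, of a]
      by (simp add: quotient_module_def)
  qed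
  have "\<phi> \<in> mod_hom ?M ?N" unfolding mod_hom_def
  proof (intro CollectI conjI ballI allI)
    show "\<phi> \<in> carrier ?M \<rightarrow>\<^sub>E carrier ?N" using img by (auto simp: \<phi>_def)
    fix X assume "X \<in> carrier ?M"
    then obtain x where x: "x \<in> carrier M" "X = H +>\<^bsub>M\<^esub> x" unfolding carM by blast
    show "\<phi> (a \<odot>\<^bsub>?M\<^esub> X) = a \<odot>\<^bsub>?N\<^esub> \<phi> X" for a
      using x actM \<phi> act N_act by simp
    fix Y assume "Y \<in> carrier ?M"
    then obtain y where y: "y \<in> carrier M" "Y = H +>\<^bsub>M\<^esub> y" unfolding carM by blast
    show "\<phi> (X \<oplus>\<^bsub>?M\<^esub> Y) = \<phi> X \<oplus>\<^bsub>?N\<^esub> \<phi> Y" using x y addM \<phi> N_add by simp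
  qed
  moreover have "inj_on \<phi> (carrier ?M)"
  proof (rule inj_onI)
    fix X Y assume X: "X \<in> carrier ?M" and Y: "Y \<in> carrier ?M" and eq: "\<phi> X = \<phi> Y"
    have "X \<subseteq> carrier M" "Y \<subseteq> carrier M" using X Y cosetc unfolding carM by auto
    then show "X = Y" using eq X Y inj_on_image_eq_iff[OF bij_betw_imp_inj_on[OF bij], of X Y] by (simp add: \<phi>_def)
  qed
  ultimately show ?thesis unfolding mod_iso_def using img by (auto simp: bij_betw_def)
qed

definition fps_submodule :: "nat \<Rightarrow> rat fls vec set \<Rightarrow> bool" where
  "fps_submodule r S \<longleftrightarrow> S \<subseteq> carrier_vec r \<and> 0\<^sub>v r \<in> S \<and> (\<forall>x\<in>S. \<forall>y\<in>S. x + y \<in> S) \<and>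
     (\<forall>a. \<forall>x\<in>S. fps_to_fls a \<cdot>\<^sub>v x \<in> S)"

lemma fps_submodule_uminus:
  assumes "fps_submodule r S" "x \<in> S"
  shows "- x \<in> S"
proof -
  have "fps_to_fls (- 1) \<cdot>\<^sub>v x \<in> S" using assms unfolding fps_submodule_def by blast
  moreover have "fps_to_fls (- 1) \<cdot>\<^sub>v x = - x" by (intro eq_vecI) auto
  ultimately show ?thesis by simp
qed

lemma fps_submodule_abelian_group:
  assumes S: "fps_submodule r S"
  shows "abelian_group ((laurent_module r)\<lparr>carrier := S\<rparr>)"
proof (rule abelian_groupI)
  let ?M = "(laurent_module r)\<lparr>carrier := S\<rparr>"
  note c = S[unfolded fps_submodule_def]
  fix x assume x: "x \<in> carrier ?M"
  then have xv: "x \<in> carrier_vec r" using c by (auto simp: laurent_module_def)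
  show "\<zero>\<^bsub>?M\<^esub> \<oplus>\<^bsub>?M\<^esub> x = x" using xv by (simp add: laurent_module_def)
  show "\<exists>y\<in>carrier ?M. y \<oplus>\<^bsub>?M\<^esub> x = \<zero>\<^bsub>?M\<^esub>"
    using fps_submodule_uminus[OF S, of x] x xv by (intro bexI[of _ "- x"]) (auto simp: laurent_module_def)
  fix y assume y: "y \<in> carrier ?M"
  then have yv: "y \<in> carrier_vec r" using c by (auto simp: laurent_module_def)
  show "x \<oplus>\<^bsub>?M\<^esub> y \<in> carrier ?M" using c x y by (simp add: laurent_module_def)
  show "x \<oplus>\<^bsub>?M\<^esub> y = y \<oplus>\<^bsub>?M\<^esub> x" using comm_add_vec[OF xv yv] by (simp add: laurent_module_def)
  fix z assume "z \<in> carrier ?M"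
  then have "z \<in> carrier_vec r" using c by (auto simp: laurent_module_def)
  then show "x \<oplus>\<^bsub>?M\<^esub> y \<oplus>\<^bsub>?M\<^esub> z = x \<oplus>\<^bsub>?M\<^esub> (y \<oplus>\<^bsub>?M\<^esub> z)"
    using assoc_add_vec[OF xv yv] by (simp add: laurent_module_def)
qed (use S in \<open>simp add: fps_submodule_def laurent_module_def\<close>)

lemma fps_submodule_standard: "fps_submodule r (standard_lattice r)"
proof -
  have add: "x + y \<in> range fps_to_fls" if "x \<in> range fps_to_fls" "y \<in> range fps_to_fls" for x y :: "rat fls"
    using that by (auto simp: fps_to_fls_plus[symmetric] simp del: fps_to_fls_plus)
  have mult: "fps_to_fls a * x \<in> range fps_to_fls" if "x \<in> range fps_to_fls" for a and x :: "rat fls"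
    using that by (auto simp: fls_times_fps_to_fls[symmetric])
  have "0 \<in> range (fps_to_fls :: rat fps \<Rightarrow> rat fls)" by (rule range_eqI[of _ _ 0]) simp
  then show ?thesis unfolding fps_submodule_def standard_lattice_def using add mult by auto
qed

lemma fps_submodule_image:
  assumes S: "fps_submodule r S" and E: "E \<in> carrier_mat r r"
  shows "fps_submodule r ((\<lambda>v. E *\<^sub>v v) ` S)"
  unfolding fps_submodule_def
proof (intro conjI ballI allI)
  have c: "v \<in> carrier_vec r" if "v \<in> S" for v using S that by (auto simp: fps_submodule_def)
  show "(\<lambda>v. E *\<^sub>v v) ` S \<subseteq> carrier_vec r" using E c by auto
  have "E *\<^sub>v 0\<^sub>v r = 0\<^sub>v r" using E by (intro eq_vecI) auto
  then show "0\<^sub>v r \<in> (\<lambda>v. E *\<^sub>v v) ` S" using S unfolding fps_submodule_def by (metis imageI)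
  fix x assume "x \<in> (\<lambda>v. E *\<^sub>v v) ` S"
  then obtain v where v: "v \<in> S" "x = E *\<^sub>v v" by blast
  show "fps_to_fls a \<cdot>\<^sub>v x \<in> (\<lambda>v. E *\<^sub>v v) ` S" for a
    using S v mult_mat_vec[OF E c[OF v(1)], of "fps_to_fls a"] unfolding fps_submodule_def by (metis imageI)
  fix y assume "y \<in> (\<lambda>v. E *\<^sub>v v) ` S"
  then obtain w where w: "w \<in> S" "y = E *\<^sub>v w" by blast
  show "x + y \<in> (\<lambda>v. E *\<^sub>v v) ` S"
    using S v w mult_add_distrib_mat_vec[OF E c[OF v(1)] c[OF w(1)]] unfolding fps_submodule_def by (metis imageI)
qed

lemma mod_iso_laurent_quotient:
  assumes S: "fps_submodule r S" and H: "fps_submodule r H" and HS: "H \<subseteq> S"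
    and W: "W \<in> carrier_mat r r" and W': "W' \<in> carrier_mat r r" and W'W: "W' * W = 1\<^sub>m r"
    and WS: "(\<lambda>v. W *\<^sub>v v) ` S = S'" and WH: "(\<lambda>v. W *\<^sub>v v) ` H = H'"
  shows "mod_iso (quotient_module ((laurent_module r)\<lparr>carrier := S\<rparr>) H)
    (quotient_module ((laurent_module r)\<lparr>carrier := S'\<rparr>) H')"
proof (rule mod_iso_quotient_module[where f = "\<lambda>v. W *\<^sub>v v"])
  let ?M = "(laurent_module r)\<lparr>carrier := S\<rparr>"
  interpret M: abelian_group ?M by (rule fps_submodule_abelian_group[OF S])
  have c: "v \<in> carrier_vec r" if "v \<in> S" for v using S that by (auto simp: fps_submodule_def)
  show "abelian_group ?M" by (rule M.abelian_group_axioms)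
  show "additive_subgroup H ?M"
  proof (rule additive_subgroup.intro, rule M.add.subgroupI)
    show "H \<subseteq> carrier ?M" "H \<noteq> {}" using HS H by (auto simp: fps_submodule_def)
    fix x assume x: "x \<in> H"
    then have xv: "x \<in> carrier_vec r" using HS c by blast
    have "\<ominus>\<^bsub>?M\<^esub> x = - x"
      by (rule M.minus_equality) (use x xv HS fps_submodule_uminus[OF S, of x] in \<open>auto simp: laurent_module_def\<close>)
    then show "\<ominus>\<^bsub>?M\<^esub> x \<in> H" using fps_submodule_uminus[OF H x] by simp
    fix y assume "y \<in> H"
    then show "x \<oplus>\<^bsub>?M\<^esub> y \<in> H" using x H by (simp add: fps_submodule_def laurent_module_def)
  qed
  show "a \<odot>\<^bsub>?M\<^esub> h \<in> H" if "h \<in> H" for a h using that H by (simp add: fps_submodule_def laurent_module_def)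
  show "a \<odot>\<^bsub>?M\<^esub> x \<in> carrier ?M" if "x \<in> carrier ?M" for a x
    using that S by (simp add: fps_submodule_def laurent_module_def)
  have inv: "W' *\<^sub>v (W *\<^sub>v v) = v" if "v \<in> S" for v
    using assoc_mult_mat_vec[OF W' W c[OF that]] W'W c[OF that] by simp
  have "inj_on (\<lambda>v. W *\<^sub>v v) S" by (rule inj_onI) (metis inv)
  then show "bij_betw (\<lambda>v. W *\<^sub>v v) (carrier ?M) (carrier ((laurent_module r)\<lparr>carrier := S'\<rparr>))"
    using WS by (simp add: bij_betw_def)
  show "(\<lambda>v. W *\<^sub>v v) ` H = H'" by (rule WH)
  fix a x assume "x \<in> carrier ?M"
  then have x: "x \<in> S" by simp
  show "W *\<^sub>v (a \<odot>\<^bsub>?M\<^esub> x) = a \<odot>\<^bsub>(laurent_module r)\<lparr>carrier := S'\<rparr>\<^esub> (W *\<^sub>v x)"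
    using mult_mat_vec[OF W c[OF x]] by (simp add: laurent_module_def)
  fix y assume "y \<in> carrier ?M"
  then have y: "y \<in> S" by simp
  show "W *\<^sub>v (x \<oplus>\<^bsub>?M\<^esub> y) = (W *\<^sub>v x) \<oplus>\<^bsub>(laurent_module r)\<lparr>carrier := S'\<rparr>\<^esub> (W *\<^sub>v y)"
    using mult_add_distrib_mat_vec[OF W c[OF x] c[OF y]] by (simp add: laurent_module_def)
  show "a \<odot>\<^bsub>?M\<^esub> (x \<oplus>\<^bsub>?M\<^esub> y) = a \<odot>\<^bsub>?M\<^esub> x \<oplus>\<^bsub>?M\<^esub> a \<odot>\<^bsub>?M\<^esub> y"
    using smult_add_distrib_vec[OF c[OF x] c[OF y]] by (simp add: laurent_module_def)
qed

text \<open>Multiplication by \<open>U\<^sup>-\<^sup>1\<close> maps \<open>\<rat>[[t]]\<^sup>r\<close> onto itself and, as \<open>U\<^sup>-\<^sup>1 E\<^sub>B = E\<^sub>A U\<^sup>-\<^sup>1\<close>, the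
  lattice of \<open>B\<close> onto that of \<open>A\<close>.\<close>

lemma mod_iso_conj:
  fixes U U' :: "rat fps mat"
  assumes rk: "rk A = r" "rk B = r" and E: "euler_matrix_at_1 A \<in> carrier_mat r r"
    and U: "U \<in> carrier_mat r r" and U': "U' \<in> carrier_mat r r" and UU': "U * U' = 1\<^sub>m r" "U' * U = 1\<^sub>m r"
    and EB: "euler_matrix_at_1 B = map_mat fps_to_fls U * euler_matrix_at_1 A * map_mat fps_to_fls U'"
  shows "mod_iso (G_plus B) (G_plus A)" "mod_iso (G_minus B) (G_minus A)"
proof -
  let ?W = "map_mat fps_to_fls U" and ?W' = "map_mat fps_to_fls U'" and ?E = "euler_matrix_at_1 A"
  let ?L = "standard_lattice r" and ?LA = "euler_lattice A" and ?LB = "euler_lattice B"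
  have W: "?W \<in> carrier_mat r r" "?W' \<in> carrier_mat r r" using U U' by simp_all
  have WW: "?W * ?W' = 1\<^sub>m r" "?W' * ?W = 1\<^sub>m r"
    using fps_to_fls.mat_hom_mult[OF U U'] fps_to_fls.mat_hom_mult[OF U' U] UU' fps_to_fls.mat_hom_one by metis+
  have Lc: "v \<in> carrier_vec r" if "v \<in> ?L" for v using that by (simp add: standard_lattice_def)
  have inv: "?W *\<^sub>v (?W' *\<^sub>v v) = v" "?W' *\<^sub>v (?W *\<^sub>v v) = v" if "v \<in> carrier_vec r" for v
    using assoc_mult_mat_vec[OF W that] assoc_mult_mat_vec[OF W(2,1) that] WW that by simp_all
  have EBc: "euler_matrix_at_1 B \<in> carrier_mat r r"
    unfolding EB using W E by (intro mult_carrier_mat[of _ r r]) auto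
  have WL: "(\<lambda>v. ?W' *\<^sub>v v) ` ?L = ?L"
  proof (intro equalityI subsetI)
    fix v assume v: "v \<in> ?L"
    then have "?W' *\<^sub>v (?W *\<^sub>v v) \<in> (\<lambda>v. ?W' *\<^sub>v v) ` ?L" using mult_standard_lattice[OF U v] by blast
    then show "v \<in> (\<lambda>v. ?W' *\<^sub>v v) ` ?L" using inv(2)[OF Lc[OF v]] by simp
  qed (use mult_standard_lattice[OF U'] in auto)
  have EBv: "?W' *\<^sub>v (euler_matrix_at_1 B *\<^sub>v v) = ?E *\<^sub>v (?W' *\<^sub>v v)" if v: "v \<in> carrier_vec r" for v
  proof -
    have W'v: "?W' *\<^sub>v v \<in> carrier_vec r" using W v by simp
    have "euler_matrix_at_1 B *\<^sub>v v = ?W *\<^sub>v (?E *\<^sub>v (?W' *\<^sub>v v))"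
      unfolding EB assoc_mult_mat_vec[OF mult_carrier_mat[OF W(1) E] W(2) v] assoc_mult_mat_vec[OF W(1) E W'v] ..
    then show ?thesis using inv(2)[OF mult_mat_vec_carrier[OF E W'v]] by simp
  qed
  have WLB: "(\<lambda>v. ?W' *\<^sub>v v) ` ?LB = ?LA"
  proof -
    have "(\<lambda>v. ?W' *\<^sub>v v) ` ?LB = (\<lambda>v. ?E *\<^sub>v (?W' *\<^sub>v v)) ` ?L"
      unfolding euler_lattice_def rk image_image using EBv Lc by (intro image_cong) auto
    also have "\<dots> = (\<lambda>v. ?E *\<^sub>v v) ` ((\<lambda>v. ?W' *\<^sub>v v) ` ?L)" by (simp add: image_image)
    finally show ?thesis unfolding WL euler_lattice_def rk .
  qed
  have LB: "fps_submodule r ?LB"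
    unfolding euler_lattice_def rk by (rule fps_submodule_image[OF fps_submodule_standard EBc])
  have H: "fps_submodule r (?L \<inter> ?LB)" using fps_submodule_standard[of r] LB unfolding fps_submodule_def by blast
  have injW: "inj_on (\<lambda>v. ?W' *\<^sub>v v) (carrier_vec r)" by (rule inj_onI) (metis inv(1))
  have WH: "(\<lambda>v. ?W' *\<^sub>v v) ` (?L \<inter> ?LB) = ?L \<inter> ?LA"
    using inj_on_image_Int[OF injW, of ?L ?LB] LB Lc WL WLB by (auto simp: fps_submodule_def)
  show "mod_iso (G_plus B) (G_plus A)"
    unfolding G_plus_def rk by (rule mod_iso_laurent_quotient[OF fps_submodule_standard H _ W(2,1) WW(1) WL WH]) simp
  show "mod_iso (G_minus B) (G_minus A)"
    unfolding G_minus_def rk by (rule mod_iso_laurent_quotient[OF LB H _ W(2,1) WW(1) WLB WH]) simp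
qed

section \<open>Conjugation of the Hilbert and Euler matrices\<close>

lemma fls_nth_hilbert_matrix:
  assumes A: "elementary_graded_algebra A" and i: "i < rk A" and j: "j < rk A"
  shows "fls_nth (hilbert_matrix_fls A $$ (i, j)) n = of_nat (vector_space.dim (scal A) (corner A i j n))"
proof (cases "n < 0")
  case True
  interpret A: elementary_graded_algebra A by fact
  have "A.dim {0} = 0" by (intro A.dim_unique[of "{}"]) (simp_all add: A.independent_empty)
  moreover have "corner A i j n = {0}" using True by (simp add: corner_def)
  ultimately show ?thesis using i j True by (simp add: hilbert_matrix_def int_fps_to_fls_def)
next
  case False
  then show ?thesis using i j by (simp add: hilbert_matrix_def int_fps_to_fls_def corner_def)
qed

lemma (in vertex_matching) hilbert_matrix_conj:
  assumes rk: "rk B = rk A" and perm: "\<sigma> permutes {..<rk A}"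
  shows "hilbert_matrix_fls B = monomial_mat (rk A) \<sigma> (\<lambda>i. fls_X_intpow (m i)) * hilbert_matrix_fls A *
    monomial_inv (rk A) \<sigma> (\<lambda>i. fls_X_intpow (- m i))"
proof (rule monomial_conj_eqI[OF perm])
  show "hilbert_matrix_fls A \<in> carrier_mat (rk A) (rk A)" "hilbert_matrix_fls B \<in> carrier_mat (rk A) (rk A)"
    using rk by (simp_all add: hilbert_matrix_def)
  fix i j assume i: "i < rk A" and j: "j < rk A"
  note nthA = fls_nth_hilbert_matrix[OF A.elementary_graded_algebra_axioms i j]
    and nthB = fls_nth_hilbert_matrix[OF B.elementary_graded_algebra_axioms \<sigma>_less[OF i] \<sigma>_less[OF j]]
  have shift: "fls_X_intpow (m i) * f * fls_X_intpow (- m j) = fls_shift (m j - m i) f" for f :: "rat fls"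
    unfolding fls_X_intpow_times_conv_shift(1) fls_X_intpow_times_conv_shift(2) by (simp add: add.commute)
  show "hilbert_matrix_fls B $$ (\<sigma> i, \<sigma> j) =
      fls_X_intpow (m i) * hilbert_matrix_fls A $$ (i, j) * fls_X_intpow (- m j)"
    unfolding shift
  proof (rule fls_eqI)
    fix n
    have "vector_space.dim (scal B) (corner B (\<sigma> i) (\<sigma> j) n) = vector_space.dim (scal A) (corner A i j (n + (m j - m i)))"
      by (rule corner_transfer[OF i j]) simp
    then show "fls_nth (hilbert_matrix_fls B $$ (\<sigma> i, \<sigma> j)) n = fls_nth (fls_shift (m j - m i) (hilbert_matrix_fls A $$ (i, j))) n"
      by (simp only: fls_shift_nth nthA nthB)
  qed
qed

lemma inverse_fls_X_intpow: "inverse (fls_X_intpow k :: rat fls) = fls_X_intpow (- k)"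
  by (metis fls_X_power_int power_int_minus)

text \<open>The powers of \<open>1 + t\<close>, all of them units of \<open>\<rat>[[t]]\<close>.\<close>

definition unit_power :: "int \<Rightarrow> rat fps" where
  "unit_power k = (if k \<ge> 0 then (1 + fps_X) ^ nat k else inverse (1 + fps_X) ^ nat (- k))"

lemma fps_to_fls_unit_power: "fps_to_fls (unit_power k) = fps_to_fls (1 + fps_X) powi k"
proof -
  have "subdegree (1 + fps_X :: rat fps) = 0" by (simp add: subdegree_eq_0_iff)
  then show ?thesis
    by (simp add: unit_power_def power_int_def fps_to_fls_power fls_inverse_fps_to_fls del: fps_to_fls_plus)
qed

lemma unit_power_mult: "unit_power k * unit_power (- k) = 1"
proof -
  have "(1 + fps_X :: rat fps) \<noteq> 0" by (metis fps_X_nth fps_add_nth fps_one_nth fps_zero_nth add.right_neutral zero_neq_one)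
  then have "fps_to_fls (1 + fps_X :: rat fps) \<noteq> 0" by (simp del: fps_to_fls_plus)
  then have "fps_to_fls (unit_power k * unit_power (- k)) = 1"
    by (simp add: fls_times_fps_to_fls fps_to_fls_unit_power power_int_minus del: fps_to_fls_plus)
  then show ?thesis by simp
qed

lemma mult_inverse_conj:
  fixes P Q R R' :: "'a :: comm_ring_1 mat"
  assumes "P \<in> carrier_mat r r" "Q \<in> carrier_mat r r" "R \<in> carrier_mat r r" "R' \<in> carrier_mat r r"
    and "Q * P = 1\<^sub>m r" "P * Q = 1\<^sub>m r" "R * R' = 1\<^sub>m r"
  shows "(P * R * Q) * (P * R' * Q) = 1\<^sub>m r"
proof -
  note [simp] = assoc_mult_mat[of _ r r _ r _ r] mult_carrier_mat[of _ r r _ r]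
  have "(P * R * Q) * (P * R' * Q) = P * (R * ((Q * P) * (R' * Q)))" using assms(1-4) by simp
  also have "\<dots> = P * ((R * R') * Q)" unfolding assms(5) using assms(1-4) by simp
  also have "\<dots> = 1\<^sub>m r" unfolding assms(7) using assms(2,6) by simp
  finally show ?thesis .
qed

text \<open>Over \<open>\<rat>(x)\<close> the Hilbert matrices are conjugate by \<open>\<Pi> X(x)\<close>, and so are their inverses. The
  expansion of \<open>x\<^sup>k\<close> at \<open>1\<close> is the unit \<open>(1 + t)\<^sup>k\<close>, so at this point the conjugating matrix is
  invertible over \<open>\<rat>[[t]]\<close>.\<close>

lemma euler_matrix_conj:
  assumes A: "elementary_graded_algebra A" and R: "rational_hilbert A R" and rk: "rk A = r" "rk B = r"
    and perm: "\<sigma> permutes {..<r}"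
    and conj: "hilbert_matrix_fls B = monomial_mat r \<sigma> (\<lambda>i. fls_X_intpow (m i)) * hilbert_matrix_fls A *
      monomial_inv r \<sigma> (\<lambda>i. fls_X_intpow (- m i))"
  defines "U \<equiv> monomial_mat r \<sigma> (\<lambda>i. unit_power (m i))" and "U' \<equiv> monomial_inv r \<sigma> (\<lambda>i. unit_power (- m i))"
  shows "\<exists>RB. rational_hilbert B RB"
    and "euler_matrix_at_1 A \<in> carrier_mat r r"
    and "euler_matrix_at_1 B = map_mat fps_to_fls U * euler_matrix_at_1 A * map_mat fps_to_fls U'"
    and "U * U' = 1\<^sub>m r" "U' * U = 1\<^sub>m r"
proof -
  define X :: "rat poly fract" where "X = Fract [:0, 1:] 1"
  have X0: "X \<noteq> 0" by (simp add: X_def Zero_fract_def eq_fract)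
  let ?P = "monomial_mat r \<sigma> (\<lambda>i. X powi m i)" and ?Q = "monomial_inv r \<sigma> (\<lambda>i. X powi (- m i))"
  have Xm: "X powi m i * X powi (- m i) = 1" for i using X0 by (simp add: power_int_minus)
  have PQ: "?P * ?Q = 1\<^sub>m r" "?Q * ?P = 1\<^sub>m r"
    by (rule monomial_inverse[OF perm]; rule Xm)+
  obtain R' where R': "R' \<in> carrier_mat r r" "R * R' = 1\<^sub>m r" "R' * R = 1\<^sub>m r"
    using rational_hilbert_invertible[OF A R] rk by auto
  have Rc: "R \<in> carrier_mat r r" and RA: "map_mat (laurent_at 0) R = hilbert_matrix_fls A"
    using R rk by (simp_all add: rational_hilbert_def)
  \<comment> \<open>Needed at \<open>c = 0\<close> to recognise the Hilbert matrix of \<open>B\<close>, and at \<open>c = 1\<close> for the Euler matrices.\<close>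
  have lc: "map_mat (laurent_at c) (?P * M * ?Q) =
      monomial_mat r \<sigma> (\<lambda>i. fps_to_fls (fps_const c + fps_X) powi m i) * map_mat (laurent_at c) M *
      monomial_inv r \<sigma> (\<lambda>i. fps_to_fls (fps_const c + fps_X) powi (- m i))" if M: "M \<in> carrier_mat r r" for c M
    using laurent_at.mat_hom_mult[OF mult_carrier_mat[OF monomial_carrier(1) M] monomial_carrier(2)]
      laurent_at.mat_hom_mult[OF monomial_carrier(1) M]
    by (simp add: map_monomial field_hom_power_int[OF laurent_at.field_hom_axioms] X_def laurent_at_X
        del: fps_to_fls_plus)
  have u0: "fps_to_fls (fps_const 0 + fps_X) = (fls_X :: rat fls)" by simp
  have RB: "rational_hilbert B (?P * R * ?Q)"
    unfolding rational_hilbert_def rk conj lc[OF Rc] RA u0 fls_X_power_int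
    using Rc by (simp add: mult_carrier_mat[of _ r r _ r])
  then show "\<exists>RB. rational_hilbert B RB" ..
  have EA: "euler_matrix A = R'" by (rule euler_matrix_eq[OF R]) (use R' rk in simp_all)
  then show "euler_matrix_at_1 A \<in> carrier_mat r r" using R'(1) by (simp add: euler_matrix_at_1_def)
  have EB: "euler_matrix B = ?P * R' * ?Q"
    by (rule euler_matrix_eq[OF RB])
      (use rk R'(1) mult_inverse_conj[OF monomial_carrier(1,2) Rc R'(1) PQ(2,1) R'(2)]
        mult_inverse_conj[OF monomial_carrier(1,2) R'(1) Rc PQ(2,1) R'(3)] in \<open>simp_all add: mult_carrier_mat[of _ r r _ r]\<close>)
  show "euler_matrix_at_1 B = map_mat fps_to_fls U * euler_matrix_at_1 A * map_mat fps_to_fls U'"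
    unfolding euler_matrix_at_1_def EA EB lc[OF R'(1)] U_def U'_def
    by (simp add: map_monomial fps_to_fls_unit_power del: fps_to_fls_plus)
  show "U * U' = 1\<^sub>m r" "U' * U = 1\<^sub>m r" unfolding U_def U'_def
    by (rule monomial_inverse[OF perm]; rule unit_power_mult)+
qed

section \<open>Invariance under graded Morita equivalence\<close>

theorem theorem6p2:
  fixes A :: "('k :: field, 'a :: {ring, monoid_mult}) graded_algebra"
    and B :: "('k, 'b :: {ring, monoid_mult}) graded_algebra"
    and F :: "(('a, 'u) gmodule, 'u \<Rightarrow> 'u, ('b, 'u) gmodule, 'u \<Rightarrow> 'u) cfunctor"
  assumes A: "elementary_graded_algebra A"
    and B: "elementary_graded_algebra B"
    and universe: "infinite (UNIV :: 'u set)"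
      "\<exists>\<iota> :: 'a \<Rightarrow> 'u. inj \<iota>" "\<exists>\<iota> :: 'b \<Rightarrow> 'u. inj \<iota>"
    and standing_A: "standing_hypotheses TYPE('u) A"
    and F: "graded_morita_equivalence A B F"
  shows "rk A = rk B \<and>
    (\<exists>\<sigma> m. \<sigma> permutes {..<rk A} \<and>
       (\<forall>i < rk A. maps_vertex_projective F A B i (\<sigma> i) (m i))) \<and>
    (\<forall>\<sigma> m. \<sigma> permutes {..<rk A} \<and>
       (\<forall>i < rk A. maps_vertex_projective F A B i (\<sigma> i) (m i)) \<longrightarrow>
       (let P = permutation_matrix (rk A) \<sigma>;
            X = mat_diag (rk A) (\<lambda>i. fls_X_intpow (m i))
        in hilbert_matrix_fls B =
             P * X * hilbert_matrix_fls A * matrix_inverse X * transpose_mat P)) \<and>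
    standing_hypotheses TYPE('u) B \<and>
    (\<forall>as. euler_smith_profile A as \<longleftrightarrow> euler_smith_profile B as) \<and>
    mod_iso (G_plus B) (G_plus A) \<and>
    mod_iso (G_minus B) (G_minus A)"
proof -
  have matching: "\<exists>\<sigma> m. bij_betw \<sigma> {..<rk A} {..<rk B} \<and> (\<forall>i<rk A. maps_vertex_projective F A B i (\<sigma> i) (m i))"
    by (rule graded_morita_matching[OF A B universe(2,3) F])
  then have rk: "rk B = rk A" using bij_betw_same_card by fastforce
  obtain R where R: "rational_hilbert A R" using standing_A unfolding standing_hypotheses_def by blast
  have conj: "hilbert_matrix_fls B = monomial_mat (rk A) \<sigma> (\<lambda>i. fls_X_intpow (m i)) * hilbert_matrix_fls A *
      monomial_inv (rk A) \<sigma> (\<lambda>i. fls_X_intpow (- m i))"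
    if "\<sigma> permutes {..<rk A}" "\<forall>i < rk A. maps_vertex_projective F A B i (\<sigma> i) (m i)" for \<sigma> m
  proof -
    have "bij_betw \<sigma> {..<rk A} {..<rk B}" using permutes_imp_bij[OF that(1)] rk by simp
    from vertex_matchingI[OF A B universe(2) F this that(2)]
    show ?thesis by (rule vertex_matching.hilbert_matrix_conj[OF _ rk that(1)])
  qed
  have formula: "let P = permutation_matrix (rk A) \<sigma>; X = mat_diag (rk A) (\<lambda>i. fls_X_intpow (m i))
      in hilbert_matrix_fls B = P * X * hilbert_matrix_fls A * matrix_inverse X * transpose_mat P"
    if "\<sigma> permutes {..<rk A} \<and> (\<forall>i < rk A. maps_vertex_projective F A B i (\<sigma> i) (m i))" for \<sigma> m
  proof -
    let ?P = "permutation_matrix (rk A) \<sigma> :: rat fls mat" and ?X = "mat_diag (rk A) (\<lambda>i. fls_X_intpow (m i)) :: rat fls mat"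
    let ?H = "hilbert_matrix_fls A"
    have perm: "\<sigma> permutes {..<rk A}" using that by blast
    have inv: "matrix_inverse ?X = mat_diag (rk A) (\<lambda>i. fls_X_intpow (- m i))"
      unfolding inverse_fls_X_intpow[symmetric] by (rule matrix_inverse_mat_diag) simp
    have PX: "?P * ?X = monomial_mat (rk A) \<sigma> (\<lambda>i. fls_X_intpow (m i))" by (rule permutation_diag(1)[OF perm])
    have "?H \<in> carrier_mat (rk A) (rk A)" by (simp add: hilbert_matrix_def)
    moreover have "transpose_mat ?P \<in> carrier_mat (rk A) (rk A)" by (simp add: permutation_matrix_def)
    ultimately have "?P * ?X * ?H * matrix_inverse ?X * transpose_mat ?P =
        monomial_mat (rk A) \<sigma> (\<lambda>i. fls_X_intpow (m i)) * ?H * monomial_inv (rk A) \<sigma> (\<lambda>i. fls_X_intpow (- m i))"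
      unfolding inv PX permutation_diag(2)[OF perm, symmetric]
      by (intro assoc_mult_mat[of _ "rk A" "rk A" _ "rk A" _ "rk A"] mult_carrier_mat[of _ "rk A" "rk A"]) simp_all
    then show ?thesis using conj[OF perm] that by (simp add: Let_def)
  qed
  obtain \<tau> m where \<tau>: "bij_betw \<tau> {..<rk A} {..<rk A}" and maps\<tau>: "\<forall>i<rk A. maps_vertex_projective F A B i (\<tau> i) (m i)"
    using matching rk by auto
  \<comment> \<open>A permutation of a set is the identity outside of it, by convention.\<close>
  define \<sigma> where "\<sigma> i = (if i < rk A then \<tau> i else i)" for i
  have perm: "\<sigma> permutes {..<rk A}"
  proof (rule bij_imp_permutes)
    show "bij_betw \<sigma> {..<rk A} {..<rk A}"
      by (rule bij_betw_cong[THEN iffD1, OF _ \<tau>]) (simp add: \<sigma>_def)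
  qed (simp add: \<sigma>_def)
  have maps: "\<forall>i<rk A. maps_vertex_projective F A B i (\<sigma> i) (m i)" using maps\<tau> by (simp add: \<sigma>_def)
  interpret vertex_matching A B F \<sigma> m
    by (rule vertex_matchingI[OF A B universe(2) F _ maps]) (use permutes_imp_bij[OF perm] rk in simp)
  let ?U = "monomial_mat (rk A) \<sigma> (\<lambda>i. unit_power (m i))" and ?U' = "monomial_inv (rk A) \<sigma> (\<lambda>i. unit_power (- m i))"
  note E = euler_matrix_conj[OF A R refl rk perm conj[OF perm maps]]
  have UU: "?U \<in> carrier_mat (rk A) (rk A)" "?U' \<in> carrier_mat (rk A) (rk A)" by simp_all
  let ?EA = "euler_matrix_at_1 A" and ?EB = "euler_matrix_at_1 B"
  let ?W = "map_mat fps_to_fls ?U :: rat fls mat" and ?W' = "map_mat fps_to_fls ?U' :: rat fls mat"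
  have W: "?W \<in> carrier_mat (rk A) (rk A)" "?W' \<in> carrier_mat (rk A) (rk A)" by simp_all
  have WW: "?W' * ?W = 1\<^sub>m (rk A)"
    unfolding fps_to_fls.mat_hom_mult[OF UU(2,1), symmetric] E(5) by (rule fps_to_fls.mat_hom_one)
  note [simp] = assoc_mult_mat[of _ "rk A" "rk A" _ "rk A" _ "rk A"] mult_carrier_mat[of _ "rk A" "rk A" _ "rk A"]
  \<comment> \<open>The same relation with \<open>A\<close> and \<open>B\<close> exchanged gives the converse for the profiles.\<close>
  have EB: "?EB \<in> carrier_mat (rk A) (rk A)" unfolding E(3) using W E(2) by simp
  have "?W' * ?EB * ?W = (?W' * ?W) * ?EA * (?W' * ?W)" unfolding E(3) using W E(2) by simp
  then have EA: "?EA = ?W' * ?EB * ?W" unfolding WW using E(2) by simp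
  have profile: "euler_smith_profile A as \<longleftrightarrow> euler_smith_profile B as" for as
    using euler_smith_profile_conj[OF refl rk E(2) UU E(4,5,3)]
      euler_smith_profile_conj[OF rk refl EB UU(2,1) E(5,4) EA] by blast
  have "gr_FP_infinity TYPE('u) B (vertex_simple B j)" if j: "j < rk B" for j
  proof -
    obtain i where "i < rk A" "j = \<sigma> i" using \<sigma>_surj[OF j] by blast
    then show ?thesis using F_FP_infinity_vertex_simple standing_A unfolding standing_hypotheses_def by blast
  qed
  then have standing_B: "standing_hypotheses TYPE('u) B" unfolding standing_hypotheses_def using E(1) by blast
  show ?thesis
    using rk perm maps formula standing_B profile mod_iso_conj[OF refl rk E(2) UU E(4,5,3)] by auto
qed

end
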